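(* Let $\Omega\subset\mathbb C$ be a simply connected domain containing $0$ with $\Omega\ne\mathbb C$, and let $g_0\in H(\Omega)$ satisfy $g_0(0)=1$ and have zeros in $\Omega$. (i) For every nonempty multiple variety $W\prec W(g_0)$ in $\Omega$ the set $S(W)$ is a proper closed $D_{0,g_0}$-invariant subspace of $H(\Omega)$. (ii) For every polynomial $p\in\mathcal D(g_0)$, every $n$ which is either an integer $n\ge0$ with $n\ge\deg(p)-1$ or $n=-\infty$, and every finite or empty multiple variety $\Upsilon=\{(\lambda,n_\lambda)\,|\,\lambda\in\Lambda\}$ in $\mathbb C\setminus\Omega$, the set $\frac{g_0}{p}\mathbb C[z]_n+g_0\mathbb C^-_\Upsilon(z)$ is a closed $D_{0,g_0}$-invariant subspace of $H(\Omega)$. Moreover, it is proper if and only if $n\ne-\infty$ or $\Upsilon$ is nonempty. (iii) For every proper closed $D_{0,g_0}$-invariant subspace $S$ of $H(\Omega)$, either $S=S(W(S))$, or $S\subset g_0\mathbb C(z)$ and $$S=\frac{g_0}{p_S}\mathbb C[z]_{n(S)}+g_0\mathbb C^-_{\Upsilon(S)}(z).$$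
   Context: $H(\Omega)$ is the Fréchet space of all holomorphic functions on $\Omega$ with the topology of compact convergence. The generalized backward shift (Pommiez operator) is the continuous linear operator $D_{0,g_0}:H(\Omega)\to H(\Omega)$, $D_{0,g_0}(f)(t)=\frac{f(t)-g_0(t)f(0)}{t}$ for $t\ne0$, $D_{0,g_0}(f)(0)=f'(0)-g_0'(0)f(0)$. A subspace of $H(\Omega)$ is proper if it is neither $\{0\}$ nor $H(\Omega)$. $\mathbb C[z]_n$ ($n\ge0$) is the set of complex polynomials of degree at most $n$; $\mathbb C[z]_{-\infty}:=\{0\}$; the zero polynomial has degree $-\infty$. $\mathbb C(z)$ is the set of rational functions over $\mathbb C$; $S\subset g_0\mathbb C(z)$ means each $f\in S$ has the form $f=g_0R$ with $R$ rational. For a function $h$ and a set of functions $Q$, $hQ:=\{hf\,|\,f\in Q\}$. A multiple variety in $\Omega$ is a finite or infinite sequence $W=\{(\lambda_k,m_k)\}$ where the $\lambda_k$ are distinct, $Z(W):=\{\lambda_k\}$ is a discrete subset of $\Omega$ and $m_k\in\mathbb N=\{1,2,\dots\}$. For nonempty $W$, $S(W):=\{f\in H(\Omega)\,|\,f^{(j)}(\lambda_k)=0,\ 0\le j\le m_k-1,\text{ for all }k\}$; $S(\emptyset):=H(\Omega)$. For multiple varieties $W=\{(\lambda,n_\lambda)\}$ and $V=\{(\nu,m_\nu)\}$, $W\prec V$ means $Z(W)\subset Z(V)$ and $n_\lambda\le m_\lambda$ for all $\lambda\in Z(W)$. For a function $h\in H(\Omega)$: $Z(h)$ is the set of zeros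 of $h$ in $\Omega$, $m(\lambda,h)$ is the multiplicity of the zero $\lambda$ ($m(\lambda,h):=0$ if $h(\lambda)\neq0$), $W(h):=\{(\lambda,m(\lambda,h))\,|\,\lambda\in Z(h)\}$ for $h\ne 0$. For a set $S\subset H(\Omega)$, $S\ne\{0\}$: $Z(S):=\bigcap_{h\in S}Z(h)$, $m(\lambda,S):=\min\{m(\lambda,h)\,|\,h\in S\}$ (the zero function being assigned multiplicity $+\infty$), $W(S):=\{(\lambda,m(\lambda,S))\,|\,\lambda\in Z(S)\}$, with $W(S)=\emptyset$ if $Z(S)=\emptyset$. $\mathcal D(g_0)$ is the set of all polynomials $p$ such that $p(0)=1$, $g_0/p$ is holomorphic in $\Omega$, and $p$ has no roots in $\mathbb C\setminus\Omega$. For $\lambda\in\mathbb C$, $k\in\mathbb N$ put $q_{\lambda,k}(t):=\frac1{(t-\lambda)^k}$. For a finite multiple variety $\Upsilon=\{(\lambda,n_\lambda)\,|\,\lambda\in\Lambda\}$ in $\mathbb C\setminus\Omega$ (i.e. $\Lambda\subset\mathbb C\setminus\Omega$ finite, $n_\lambda\in\mathbb N$), $\mathbb C^-_\Upsilon(z):=\mathrm{span}\{q_{\lambda,k}\,|\,\lambda\in\Lambda,\ 1\le k\le n_\lambda\}$; if $\Upsilon$ is empty, $\mathbb C^-_\Upsilon(z):=\{0\}$. Definition of $p_S$, $n(S)$, $\Upsilon(S)$: let $S\subset g_0\mathbb C(z)$ be a proper closed $D_{0,g_0}$-invariant subspace. Then $p_S$ is the unique polynomial in $\mathcal D(g_0)$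 with $W(S)=W(g_0/p_S)$. Each nonzero $f\in S$ is uniquely written as $f=\frac{g_0}{p_S}r(f)+g_0\frac{u(f)}{v(f)}$ with polynomials $r(f),u(f),v(f)$ such that $\deg u(f)<\deg v(f)$, $v(f)$ is monic without roots in $\Omega$, and $u(f),v(f)$ have no common roots; for $f=0$ put $r(f)=u(f)=0$, $v(f)=1$. Put $n(S):=\sup_{f\in S}\deg r(f)$, $\mathcal P(S):=\{\lambda\in\mathbb C\setminus\Omega\,|\,\exists f\in S\setminus\{0\}:\ v(f)(\lambda)=0\}$, $n_\lambda(S):=\sup_{f\in S}m(\lambda,v(f))$ (multiplicity of $\lambda$ as a root of $v(f)$), and $\Upsilon(S):=\{(\lambda,n_\lambda(S))\,|\,\lambda\in\mathcal P(S)\}$. (For such $S$ one has $n(S)<+\infty$, $\mathcal P(S)$ finite or empty, each $n_\lambda(S)$ finite.) *)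

theory Defs
  imports
    "HOL-Complex_Analysis.Complex_Analysis"
    "HOL-Library.Function_Algebras"
    "HOL-Library.Set_Algebras"
begin

text \<open>
  An element of \<open>H(\<Omega>)\<close> is represented by a total function that is holomorphic on \<open>\<Omega>\<close> and
  vanishes off \<open>\<Omega>\<close>. This makes the representative unique, so that equality of functions on \<open>\<Omega>\<close>
  is equality in HOL. Functions carry the pointwise operations of \<open>Function_Algebras\<close>;
  \<open>A + B\<close> and \<open>h *o Q\<close> (the set of all products of \<open>h\<close> with elements of \<open>Q\<close>) are the operations
  of \<open>Set_Algebras\<close>. A factor supported in \<open>\<Omega>\<close> makes the whole product vanish off \<open>\<Omega>\<close>.
\<close>

definition Hol :: "complex set \<Rightarrow> (complex \<Rightarrow> complex) set" where
  "Hol \<Omega> = {f. f holomorphic_on \<Omega> \<and> (\<forall>z. z \<notin> \<Omega> \<longrightarrow> f z = 0)}"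

definition cscale :: "complex \<Rightarrow> (complex \<Rightarrow> complex) \<Rightarrow> (complex \<Rightarrow> complex)" where
  "cscale c f = (\<lambda>z. c * f z)"

interpretation cfun: vector_space cscale
  by unfold_locales (auto simp: cscale_def fun_eq_iff algebra_simps)


text \<open>The topology of compact convergence on \<open>H(\<Omega>)\<close>.\<close>

definition compact_nbhd ::
  "complex set \<Rightarrow> (complex \<Rightarrow> complex) \<Rightarrow> complex set \<Rightarrow> real \<Rightarrow> (complex \<Rightarrow> complex) set" where
  "compact_nbhd \<Omega> f K \<epsilon> = {g \<in> Hol \<Omega>. \<forall>z\<in>K. dist (g z) (f z) < \<epsilon>}"

definition Hol_topology :: "complex set \<Rightarrow> (complex \<Rightarrow> complex) topology" where
  "Hol_topology \<Omega> = topology (\<lambda>U. U \<subseteq> Hol \<Omega> \<and>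
     (\<forall>f\<in>U. \<exists>K \<epsilon>. compact K \<and> K \<subseteq> \<Omega> \<and> \<epsilon> > 0 \<and> compact_nbhd \<Omega> f K \<epsilon> \<subseteq> U))"

lemma openin_Hol_topology:
  "openin (Hol_topology \<Omega>) U \<longleftrightarrow> U \<subseteq> Hol \<Omega> \<and>
     (\<forall>f\<in>U. \<exists>K \<epsilon>. compact K \<and> K \<subseteq> \<Omega> \<and> \<epsilon> > 0 \<and> compact_nbhd \<Omega> f K \<epsilon> \<subseteq> U)"
proof -
  let ?P = "\<lambda>f U K \<epsilon>. compact K \<and> K \<subseteq> \<Omega> \<and> \<epsilon> > (0::real) \<and> compact_nbhd \<Omega> f K \<epsilon> \<subseteq> U"
  let ?O = "\<lambda>U. U \<subseteq> Hol \<Omega> \<and> (\<forall>f\<in>U. \<exists>K \<epsilon>. ?P f U K \<epsilon>)"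
  have inter: "?O (S \<inter> T)" if S: "?O S" and T: "?O T" for S T
  proof (intro conjI ballI)
    show "S \<inter> T \<subseteq> Hol \<Omega>" using S by blast
    fix f assume "f \<in> S \<inter> T"
    with S T obtain K \<epsilon> L \<delta> where 1: "?P f S K \<epsilon>" and 2: "?P f T L \<delta>" by blast
    have "compact_nbhd \<Omega> f (K \<union> L) (min \<epsilon> \<delta>) \<subseteq> compact_nbhd \<Omega> f K \<epsilon> \<inter> compact_nbhd \<Omega> f L \<delta>"
      by (auto simp: compact_nbhd_def)
    with 1 2 have "?P f (S \<inter> T) (K \<union> L) (min \<epsilon> \<delta>)" by auto
    then show "\<exists>K \<epsilon>. ?P f (S \<inter> T) K \<epsilon>" by blast
  qed
  have union: "?O (\<Union>\<K>)" if "\<forall>S\<in>\<K>. ?O S" for \<K>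
  proof (intro conjI ballI)
    show "\<Union>\<K> \<subseteq> Hol \<Omega>" using that by blast
    fix f assume "f \<in> \<Union>\<K>"
    then obtain S where "S \<in> \<K>" "f \<in> S" by blast
    with that obtain K \<epsilon> where "?P f S K \<epsilon>" by meson
    with \<open>S \<in> \<K>\<close> show "\<exists>K \<epsilon>. ?P f (\<Union>\<K>) K \<epsilon>" by (meson Union_upper subset_trans)
  qed
  have "istopology ?O"
    unfolding istopology_def using inter union by blast
  then show ?thesis
    by (simp add: Hol_topology_def topology_inverse')
qed

lemma topspace_Hol_topology: "topspace (Hol_topology \<Omega>) = Hol \<Omega>"
proof -
  have "openin (Hol_topology \<Omega>) (Hol \<Omega>)"
    unfolding openin_Hol_topology
  proof (intro conjI ballI order_refl)
    fix f
    show "\<exists>K \<epsilon>. compact K \<and> K \<subseteq> \<Omega> \<and> \<epsilon> > 0 \<and> compact_nbhd \<Omega> f K \<epsilon> \<subseteq> Hol \<Omega>"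
      by (rule exI[of _ "{}"], rule exI[of _ 1]) (auto simp: compact_nbhd_def)
  qed
  then show ?thesis
    by (metis openin_Hol_topology openin_topspace openin_subset subset_antisym)
qed


definition pommiez ::
  "complex set \<Rightarrow> (complex \<Rightarrow> complex) \<Rightarrow> (complex \<Rightarrow> complex) \<Rightarrow> (complex \<Rightarrow> complex)" where
  "pommiez \<Omega> g\<^sub>0 f = (\<lambda>t. if t \<notin> \<Omega> then 0
     else if t = 0 then deriv f 0 - deriv g\<^sub>0 0 * f 0
     else (f t - g\<^sub>0 t * f 0) / t)"

definition closed_invariant_subspace ::
  "complex set \<Rightarrow> (complex \<Rightarrow> complex) \<Rightarrow> (complex \<Rightarrow> complex) set \<Rightarrow> bool" where
  "closed_invariant_subspace \<Omega> g\<^sub>0 S \<longleftrightarrow>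
     S \<subseteq> Hol \<Omega> \<and> cfun.subspace S \<and> closedin (Hol_topology \<Omega>) S \<and> pommiez \<Omega> g\<^sub>0 ` S \<subseteq> S"

definition proper_in_Hol :: "complex set \<Rightarrow> (complex \<Rightarrow> complex) set \<Rightarrow> bool" where
  "proper_in_Hol \<Omega> S \<longleftrightarrow> S \<noteq> {0} \<and> S \<noteq> Hol \<Omega>"


text \<open>
  A multiple variety is a set of pairs (point, multiplicity). Its set of points is required to have
  no limit point in \<open>A\<close>; in particular it is countable for open \<open>A\<close>.
\<close>

definition multiple_variety :: "complex set \<Rightarrow> (complex \<times> nat) set \<Rightarrow> bool" where
  "multiple_variety A W \<longleftrightarrow> inj_on fst W \<and> fst ` W \<subseteq> A \<and> (\<forall>z\<in>A. \<not> z islimpt fst ` W) \<and>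
     (\<forall>(\<mu>, m)\<in>W. m \<ge> 1)"

definition variety_le :: "(complex \<times> nat) set \<Rightarrow> (complex \<times> nat) set \<Rightarrow> bool"
    (infix \<open>\<prec>\<^sub>v\<close> 50) where
  "W \<prec>\<^sub>v V \<longleftrightarrow> (\<forall>(\<mu>, n)\<in>W. \<exists>m. (\<mu>, m) \<in> V \<and> n \<le> m)"

definition S_of_variety ::
  "complex set \<Rightarrow> (complex \<times> nat) set \<Rightarrow> (complex \<Rightarrow> complex) set" where
  "S_of_variety \<Omega> W = {f \<in> Hol \<Omega>. \<forall>(\<mu>, m)\<in>W. \<forall>j<m. (deriv ^^ j) f \<mu> = 0}"

definition zeros :: "complex set \<Rightarrow> (complex \<Rightarrow> complex) \<Rightarrow> complex set" where
  "zeros \<Omega> h = {z \<in> \<Omega>. h z = 0}"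

definition zmult :: "(complex \<Rightarrow> complex) \<Rightarrow> complex \<Rightarrow> enat" where
  "zmult h \<mu> = (if h = 0 then \<infinity> else if h \<mu> \<noteq> 0 then 0 else enat (nat (zorder h \<mu>)))"

definition W_of_fun :: "complex set \<Rightarrow> (complex \<Rightarrow> complex) \<Rightarrow> (complex \<times> nat) set" where
  "W_of_fun \<Omega> h = {(\<mu>, the_enat (zmult h \<mu>)) | \<mu>. \<mu> \<in> zeros \<Omega> h}"

definition zeros_set :: "complex set \<Rightarrow> (complex \<Rightarrow> complex) set \<Rightarrow> complex set" where
  "zeros_set \<Omega> S = (\<Inter>h\<in>S. zeros \<Omega> h)"

definition zmult_set :: "(complex \<Rightarrow> complex) set \<Rightarrow> complex \<Rightarrow> enat" where
  "zmult_set S \<mu> = (INF h\<in>S. zmult h \<mu>)"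

definition W_of_set :: "complex set \<Rightarrow> (complex \<Rightarrow> complex) set \<Rightarrow> (complex \<times> nat) set" where
  "W_of_set \<Omega> S = {(\<mu>, the_enat (zmult_set S \<mu>)) | \<mu>. \<mu> \<in> zeros_set \<Omega> S}"


text \<open>
  A pointwise quotient such as \<open>g\<^sub>0 / p\<close> takes the value 0 at the zeros of \<open>p\<close>. The following
  turns it into a meromorphic function on \<open>\<Omega>\<close> with all removable singularities removed, extended
  by 0 off \<open>\<Omega>\<close>. At a pole the value is 0 by convention, so the result belongs to \<open>Hol \<Omega>\<close> iff the
  meromorphic function has no poles in \<open>\<Omega>\<close>.
\<close>

definition regularize :: "complex set \<Rightarrow> (complex \<Rightarrow> complex) \<Rightarrow> (complex \<Rightarrow> complex)" where
  "regularize \<Omega> f = (\<lambda>z. if z \<in> \<Omega> then remove_sings f z else 0)"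

definition quot_poly ::
  "complex set \<Rightarrow> (complex \<Rightarrow> complex) \<Rightarrow> complex poly \<Rightarrow> (complex \<Rightarrow> complex)" where
  "quot_poly \<Omega> g\<^sub>0 p = regularize \<Omega> (\<lambda>z. g\<^sub>0 z / poly p z)"

definition rational_functions :: "(complex \<Rightarrow> complex) set" where
  "rational_functions = {\<lambda>z. poly a z / poly b z | a b. b \<noteq> 0}"

definition subset_g0_rational ::
  "complex set \<Rightarrow> (complex \<Rightarrow> complex) \<Rightarrow> (complex \<Rightarrow> complex) set \<Rightarrow> bool" where
  "subset_g0_rational \<Omega> g\<^sub>0 S \<longleftrightarrow>
     (\<forall>f\<in>S. \<exists>R\<in>rational_functions. f = regularize \<Omega> (\<lambda>z. g\<^sub>0 z * R z))"

definition D_polys :: "complex set \<Rightarrow> (complex \<Rightarrow> complex) \<Rightarrow> complex poly set" where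
  "D_polys \<Omega> g\<^sub>0 = {p. poly p 0 = 1 \<and> quot_poly \<Omega> g\<^sub>0 p \<in> Hol \<Omega> \<and> (\<forall>z. z \<notin> \<Omega> \<longrightarrow> poly p z \<noteq> 0)}"


text \<open>The degree with the convention that the zero polynomial has degree \<open>-\<infinity>\<close>.\<close>

definition pdeg :: "complex poly \<Rightarrow> ereal" where
  "pdeg p = (if p = 0 then -\<infinity> else ereal (real (degree p)))"

definition polys_upto :: "ereal \<Rightarrow> (complex \<Rightarrow> complex) set" where
  "polys_upto n = {poly r | r. pdeg r \<le> n}"

definition q_fun :: "complex \<Rightarrow> nat \<Rightarrow> complex \<Rightarrow> complex" where
  "q_fun \<mu> k = (\<lambda>t. 1 / (t - \<mu>) ^ k)"

definition C_minus :: "(complex \<times> nat) set \<Rightarrow> (complex \<Rightarrow> complex) set" where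
  "C_minus \<Upsilon> = cfun.span {q_fun \<mu> k | \<mu> n k. (\<mu>, n) \<in> \<Upsilon> \<and> 1 \<le> k \<and> k \<le> n}"


definition p_of ::
  "complex set \<Rightarrow> (complex \<Rightarrow> complex) \<Rightarrow> (complex \<Rightarrow> complex) set \<Rightarrow> complex poly" where
  "p_of \<Omega> g\<^sub>0 S = (THE p. p \<in> D_polys \<Omega> g\<^sub>0 \<and> W_of_set \<Omega> S = W_of_fun \<Omega> (quot_poly \<Omega> g\<^sub>0 p))"

definition is_decomp ::
  "complex set \<Rightarrow> (complex \<Rightarrow> complex) \<Rightarrow> complex poly \<Rightarrow> (complex \<Rightarrow> complex) \<Rightarrow>
   complex poly \<Rightarrow> complex poly \<Rightarrow> complex poly \<Rightarrow> bool" where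
  "is_decomp \<Omega> g\<^sub>0 p f r u v \<longleftrightarrow>
     f = (\<lambda>z. quot_poly \<Omega> g\<^sub>0 p z * poly r z + g\<^sub>0 z * (poly u z / poly v z)) \<and>
     pdeg u < pdeg v \<and> lead_coeff v = 1 \<and> (\<forall>z\<in>\<Omega>. poly v z \<noteq> 0) \<and>
     (\<forall>z. \<not> (poly u z = 0 \<and> poly v z = 0))"

definition decomp ::
  "complex set \<Rightarrow> (complex \<Rightarrow> complex) \<Rightarrow> (complex \<Rightarrow> complex) set \<Rightarrow> (complex \<Rightarrow> complex) \<Rightarrow>
   complex poly \<times> complex poly \<times> complex poly" where
  "decomp \<Omega> g\<^sub>0 S f = (if f = 0 then (0, 0, 1)
     else (THE (r, u, v). is_decomp \<Omega> g\<^sub>0 (p_of \<Omega> g\<^sub>0 S) f r u v))"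

definition r_of ::
  "complex set \<Rightarrow> (complex \<Rightarrow> complex) \<Rightarrow> (complex \<Rightarrow> complex) set \<Rightarrow> (complex \<Rightarrow> complex) \<Rightarrow>
   complex poly" where
  "r_of \<Omega> g\<^sub>0 S f = (case decomp \<Omega> g\<^sub>0 S f of (r, u, v) \<Rightarrow> r)"

definition v_of ::
  "complex set \<Rightarrow> (complex \<Rightarrow> complex) \<Rightarrow> (complex \<Rightarrow> complex) set \<Rightarrow> (complex \<Rightarrow> complex) \<Rightarrow>
   complex poly" where
  "v_of \<Omega> g\<^sub>0 S f = (case decomp \<Omega> g\<^sub>0 S f of (r, u, v) \<Rightarrow> v)"

definition n_of ::
  "complex set \<Rightarrow> (complex \<Rightarrow> complex) \<Rightarrow> (complex \<Rightarrow> complex) set \<Rightarrow> ereal" where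
  "n_of \<Omega> g\<^sub>0 S = (SUP f\<in>S. pdeg (r_of \<Omega> g\<^sub>0 S f))"

definition P_of ::
  "complex set \<Rightarrow> (complex \<Rightarrow> complex) \<Rightarrow> (complex \<Rightarrow> complex) set \<Rightarrow> complex set" where
  "P_of \<Omega> g\<^sub>0 S = {\<mu>. \<mu> \<notin> \<Omega> \<and> (\<exists>f\<in>S - {0}. poly (v_of \<Omega> g\<^sub>0 S f) \<mu> = 0)}"

definition n_mult_of ::
  "complex set \<Rightarrow> (complex \<Rightarrow> complex) \<Rightarrow> (complex \<Rightarrow> complex) set \<Rightarrow> complex \<Rightarrow> enat" where
  "n_mult_of \<Omega> g\<^sub>0 S \<mu> = (SUP f\<in>S. enat (order \<mu> (v_of \<Omega> g\<^sub>0 S f)))"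

definition Upsilon_of ::
  "complex set \<Rightarrow> (complex \<Rightarrow> complex) \<Rightarrow> (complex \<Rightarrow> complex) set \<Rightarrow> (complex \<times> nat) set" where
  "Upsilon_of \<Omega> g\<^sub>0 S = {(\<mu>, the_enat (n_mult_of \<Omega> g\<^sub>0 S \<mu>)) | \<mu>. \<mu> \<in> P_of \<Omega> g\<^sub>0 S}"

end

theory Submission
  imports Defs "HOL-Computational_Algebra.Fundamental_Theorem_Algebra"
begin

text \<open>
  Write \<open>D f = (f - f(0) g) / t\<close> and let \<open>S\<close> be a proper closed \<open>D\<close>-invariant subspace.

  If \<open>g H(\<Omega>) \<subseteq> S\<close>, then modulo \<open>g\<close> the operator \<open>D\<close> is multiplication by \<open>1/t\<close>, and \<open>t\<close> is a unit
  modulo every polynomial divisor of \<open>g\<close>. Hence the jets of \<open>S\<close> at finitely many zeros of \<open>g\<close> form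
  an ideal, and approximation by polynomials in a Riemann map of \<open>\<Omega>\<close> gives \<open>S = S(W(S))\<close>.

  Otherwise a continuous functional \<open>J\<close> vanishes on \<open>S\<close> but not on \<open>g H(\<Omega>)\<close>. The functions
  \<open>(t f(t) g(z) - z f(z) g(t)) / (t - z)\<close> with \<open>f \<in> S\<close> are annihilated by \<open>J\<close> for \<open>z\<close> near 0, hence for
  all \<open>z \<in> \<Omega>\<close>. Near the boundary this reads \<open>g A = z f B\<close> with Cauchy transforms \<open>A, B\<close> that are
  holomorphic off a compact subset of \<open>\<Omega>\<close> and vanish at infinity, and \<open>B \<noteq> 0\<close> does not depend on \<open>f\<close>.
  By Liouville's theorem the quotients \<open>f / g\<close> are rational with a common denominator \<open>Q\<close> and
  numerators of bounded degree. If \<open>Q\<close> has minimal degree, \<open>D\<close>-invariance forces the numerators to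
  be all polynomials of degree less than some \<open>m \<ge> deg Q\<close>, and partial fractions give the formula.
\<close>

section \<open>Orders of vanishing\<close>

text \<open>Both cases rest on one interpolation statement, \<open>interpolate\<close> of the locale
  \<open>shift_invariant\<close>. It is applied to \<Omega> and \<open>g\<close> in the first case,
  and to the whole plane, the denominator \<open>Q\<close> and order 0 in the second. This is why
  the denominator has to be minimal: a root of \<open>Q\<close> shared by all numerators would
  destroy surjectivity modulo \<open>Q\<close>. The functional comes from Hilbert space geometry.
  The Riemann map carries a compact subset of \<Omega> into a disc of radius r < 1, where the
  supremum is bounded by the Hardy norm of any radius \<rho> with r < \<rho> < 1. A functional
  continuous for that norm has coefficients O(\<rho>^n), so it is a contour integral over every
  circle of radius between \<rho> and 1. Moving the circle links the values of the resolvent near 0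
  with those near the boundary. B \<noteq> 0 because a functional whose Cauchy transform vanishes
  near the boundary is zero, and f \<mapsto> J(g f) is not. Simple connectivity enters through the
  Riemann map, which also makes the complement of each closed subdisc connected, so that transforms
  can be continued from infinity.\<close>

lemma eq_off_finite:
  fixes a b :: "complex \<Rightarrow> complex"
  assumes "open \<Omega>" "continuous_on \<Omega> a" "continuous_on \<Omega> b" "finite F"
    and eq: "\<And>z. z \<in> \<Omega> - F \<Longrightarrow> a z = b z" and "z \<in> \<Omega>"
  shows "a z = b z"
proof -
  have "open (\<Omega> - (F - {z}))"
    using assms by (intro open_Diff finite_imp_closed) auto
  moreover have "z \<in> \<Omega> - (F - {z})" using assms by auto
  ultimately have "\<forall>\<^sub>F w in at z. w \<in> \<Omega> - (F - {z}) - {z}"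
    by (rule eventually_at_in_open)
  then have ev: "\<forall>\<^sub>F w in at z. a w = b w"
    by (rule eventually_mono) (auto intro: eq)
  have "(a \<longlongrightarrow> a z) (at z)" "(b \<longlongrightarrow> b z) (at z)"
    using assms by (auto simp: continuous_on_eq_continuous_at isCont_def)
  with ev show ?thesis
    by (metis (mono_tags, lifting) tendsto_cong tendsto_unique trivial_limit_at)
qed

lemma poly_mult_cancel:
  fixes a b :: "complex \<Rightarrow> complex"
  assumes "open \<Omega>" "continuous_on \<Omega> a" "continuous_on \<Omega> b" "p \<noteq> 0"
    and "\<And>z. z \<in> \<Omega> \<Longrightarrow> poly p z * a z = poly p z * b z" and "z \<in> \<Omega>"
  shows "a z = b z"
proof (rule eq_off_finite[of \<Omega> a b "{z. poly p z = 0}" z])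
  show "finite {z. poly p z = 0}" using assms by (simp add: poly_roots_finite)
  show "a z = b z" if "z \<in> \<Omega> - {z. poly p z = 0}" for z using assms(5)[of z] that by simp
qed (use assms in auto)

lemma linear_factor_cancel:
  fixes a b :: "complex \<Rightarrow> complex"
  assumes "open \<Omega>" "continuous_on \<Omega> a" "continuous_on \<Omega> b"
    and "\<And>z. z \<in> \<Omega> \<Longrightarrow> (z - \<mu>) ^ n * a z = (z - \<mu>) ^ n * b z" and "z \<in> \<Omega>"
  shows "a z = b z"
  using poly_mult_cancel[of \<Omega> a b "[:-\<mu>, 1:] ^ n" z] assms by (simp add: poly_power)

text \<open>The vanishing condition is conditional on \<open>\<mu> \<in> \<Omega>\<close> because
  roots of auxiliary polynomials may lie off \<Omega>, where dividing by z - \<mu> is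
  harmless.\<close>

lemma divide_linear_factor:
  assumes "open \<Omega>" "f holomorphic_on \<Omega>" "\<mu> \<in> \<Omega> \<Longrightarrow> f \<mu> = 0"
  obtains h where "h holomorphic_on \<Omega>" "\<And>z. z \<in> \<Omega> \<Longrightarrow> f z = (z - \<mu>) * h z"
proof (cases "\<mu> \<in> \<Omega>")
  case True
  have "(\<lambda>z. if z = \<mu> then deriv f \<mu> else (f z - f \<mu>) / (z - \<mu>)) holomorphic_on \<Omega>"
    using assms True by (intro pole_lemma) (auto simp: interior_open)
  moreover have "f z = (z - \<mu>) * (if z = \<mu> then deriv f \<mu> else (f z - f \<mu>) / (z - \<mu>))" if "z \<in> \<Omega>" for z
    using assms(3)[OF True] by auto
  ultimately show ?thesis using that by blast
next
  case False
  then have "(\<lambda>z. f z / (z - \<mu>)) holomorphic_on \<Omega>"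
    by (intro holomorphic_intros assms) auto
  moreover have "f z = (z - \<mu>) * (f z / (z - \<mu>))" if "z \<in> \<Omega>" for z
    using False that by auto
  ultimately show ?thesis using that by blast
qed

text \<open>The quotient is holomorphic on all of \<Omega> and not only near \<mu>, so that factors
  can be multiplied, cancelled and divided out globally.\<close>

definition vanishes_to :: "complex set \<Rightarrow> complex \<Rightarrow> nat \<Rightarrow> (complex \<Rightarrow> complex) \<Rightarrow> bool" where
  "vanishes_to \<Omega> \<mu> n f \<longleftrightarrow> (\<exists>h. h holomorphic_on \<Omega> \<and> (\<forall>z\<in>\<Omega>. f z = (z - \<mu>) ^ n * h z))"

lemma vanishes_toI:
  "h holomorphic_on \<Omega> \<Longrightarrow> (\<And>z. z \<in> \<Omega> \<Longrightarrow> f z = (z - \<mu>) ^ n * h z) \<Longrightarrow> vanishes_to \<Omega> \<mu> n f"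
  unfolding vanishes_to_def by blast

lemma vanishes_toE:
  assumes "vanishes_to \<Omega> \<mu> n f"
  obtains h where "h holomorphic_on \<Omega>" "\<And>z. z \<in> \<Omega> \<Longrightarrow> f z = (z - \<mu>) ^ n * h z"
  using assms unfolding vanishes_to_def by blast

lemma vanishes_to_0: "f holomorphic_on \<Omega> \<Longrightarrow> vanishes_to \<Omega> \<mu> 0 f"
  by (rule vanishes_toI[of f]) auto

lemma vanishes_to_mono:
  assumes "vanishes_to \<Omega> \<mu> n f" "m \<le> n"
  shows "vanishes_to \<Omega> \<mu> m f"
proof -
  obtain h where h: "h holomorphic_on \<Omega>" "\<And>z. z \<in> \<Omega> \<Longrightarrow> f z = (z - \<mu>) ^ n * h z"
    using assms vanishes_toE by blast
  show ?thesis
  proof (rule vanishes_toI)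
    show "(\<lambda>z. (z - \<mu>) ^ (n - m) * h z) holomorphic_on \<Omega>"
      by (intro holomorphic_intros h)
    show "f z = (z - \<mu>) ^ m * ((z - \<mu>) ^ (n - m) * h z)" if "z \<in> \<Omega>" for z
      using h(2)[OF that] \<open>m \<le> n\<close> by (simp flip: power_add mult.assoc)
  qed
qed

lemma vanishes_to_lincomb:
  assumes "vanishes_to \<Omega> \<mu> n f" "vanishes_to \<Omega> \<mu> n g"
  shows "vanishes_to \<Omega> \<mu> n (\<lambda>z. f z + c * g z)"
proof -
  from assms obtain h k where
    h: "h holomorphic_on \<Omega>" "\<And>z. z \<in> \<Omega> \<Longrightarrow> f z = (z - \<mu>) ^ n * h z" and
    k: "k holomorphic_on \<Omega>" "\<And>z. z \<in> \<Omega> \<Longrightarrow> g z = (z - \<mu>) ^ n * k z"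
    by (meson vanishes_toE)
  show ?thesis
    by (rule vanishes_toI[of "\<lambda>z. h z + c * k z"])
      (auto intro!: holomorphic_intros h k simp: h(2) k(2) algebra_simps)
qed

lemma higher_deriv_linear_power_mult:
  assumes "open \<Omega>" "\<mu> \<in> \<Omega>" "h holomorphic_on \<Omega>" "j \<le> n"
  shows "(deriv ^^ j) (\<lambda>z. (z - \<mu>) ^ n * h z) \<mu> = (if j = n then fact n * h \<mu> else 0)"
proof -
  have pw: "(deriv ^^ i) (\<lambda>w. (w - \<mu>) ^ n) \<mu> = (if i = n then fact n else 0)" if "i \<le> n" for i
    using that by (auto simp: higher_deriv_power pochhammer_fact)
  have "(deriv ^^ j) (\<lambda>z. (z - \<mu>) ^ n * h z) \<mu> =
     (\<Sum>i=0..j. of_nat (j choose i) * (deriv ^^ i) (\<lambda>w. (w - \<mu>) ^ n) \<mu> * (deriv ^^ (j - i)) h \<mu>)"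
    using assms by (intro higher_deriv_mult[of _ \<Omega>] holomorphic_intros) auto
  also have "\<dots> = (\<Sum>i=0..j. if i = n then of_nat (j choose i) * fact n * (deriv ^^ (j - i)) h \<mu> else 0)"
    using assms(4) by (intro sum.cong refl) (auto simp: pw)
  also have "\<dots> = (if j = n then fact n * h \<mu> else 0)"
    using assms(4) by (auto simp: sum.delta)
  finally show ?thesis .
qed

text \<open>For the converse, once (z - \<mu>)^n has been split off, the n-th derivative at \<mu> is
  n! times the value of the quotient there; its vanishing releases one more factor.\<close>

lemma vanishes_to_iff_deriv:
  assumes "open \<Omega>" "\<mu> \<in> \<Omega>" "f holomorphic_on \<Omega>"
  shows "vanishes_to \<Omega> \<mu> n f \<longleftrightarrow> (\<forall>j<n. (deriv ^^ j) f \<mu> = 0)"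
proof
  assume "vanishes_to \<Omega> \<mu> n f"
  then obtain h where h: "h holomorphic_on \<Omega>" "\<And>z. z \<in> \<Omega> \<Longrightarrow> f z = (z - \<mu>) ^ n * h z"
    using vanishes_toE by blast
  have "(deriv ^^ j) f \<mu> = (deriv ^^ j) (\<lambda>z. (z - \<mu>) ^ n * h z) \<mu>" for j
    using h assms by (intro higher_deriv_transform_within_open[of _ \<Omega>] holomorphic_intros) auto
  then show "\<forall>j<n. (deriv ^^ j) f \<mu> = 0"
    using higher_deriv_linear_power_mult[OF assms(1,2) h(1)] by simp
next
  assume "\<forall>j<n. (deriv ^^ j) f \<mu> = 0"
  then show "vanishes_to \<Omega> \<mu> n f"
  proof (induction n)
    case 0
    then show ?case using assms by (simp add: vanishes_to_0)
  next
    case (Suc n)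
    have "vanishes_to \<Omega> \<mu> n f" using Suc by simp
    then obtain h where h: "h holomorphic_on \<Omega>" "\<And>z. z \<in> \<Omega> \<Longrightarrow> f z = (z - \<mu>) ^ n * h z"
      using vanishes_toE by blast
    have "(deriv ^^ n) f \<mu> = (deriv ^^ n) (\<lambda>z. (z - \<mu>) ^ n * h z) \<mu>"
      using h assms by (intro higher_deriv_transform_within_open[of _ \<Omega>] holomorphic_intros) auto
    then have "h \<mu> = 0"
      using higher_deriv_linear_power_mult[OF assms(1,2) h(1), of n n] Suc.prems by simp
    then obtain k where "k holomorphic_on \<Omega>" "\<And>z. z \<in> \<Omega> \<Longrightarrow> h z = (z - \<mu>) * k z"
      using divide_linear_factor[OF assms(1) h(1)] by blast
    with h(2) show ?case by (intro vanishes_toI[of k]) auto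
  qed
qed

lemma zmult_eqI:
  assumes "open \<Omega>" "\<mu> \<in> \<Omega>" "h holomorphic_on \<Omega>" "h \<mu> \<noteq> 0"
    and eq: "\<And>z. z \<in> \<Omega> \<Longrightarrow> f z = (z - \<mu>) ^ k * h z"
  shows "zmult f \<mu> = enat k"
proof -
  have "zorder f \<mu> = int k"
    using assms by (intro zorder_eqI[of \<Omega> \<mu> h]) (auto simp: mult.commute)
  moreover have "f \<noteq> 0"
  proof
    assume "f = 0"
    then have "h \<mu> = 0"
      using assms by (intro linear_factor_cancel[of \<Omega> h "\<lambda>_. 0" \<mu> k \<mu>])
        (auto intro!: holomorphic_on_imp_continuous_on)
    with assms show False by simp
  qed
  ultimately show ?thesis
    using eq[OF assms(2)] assms(4) by (auto simp: zmult_def zero_enat_def)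
qed

lemma holomorphic_order_factor:
  assumes "open \<Omega>" "connected \<Omega>" "\<mu> \<in> \<Omega>" "f holomorphic_on \<Omega>" "w \<in> \<Omega>" "f w \<noteq> 0"
  obtains k h where "h holomorphic_on \<Omega>" "\<And>z. z \<in> \<Omega> \<Longrightarrow> f z = (z - \<mu>) ^ k * h z" "h \<mu> \<noteq> 0"
proof -
  have "\<exists>n. (deriv ^^ n) f \<mu> \<noteq> 0"
    using holomorphic_fun_eq_0_on_connected[OF assms(4,1,2) _ assms(3,5)] assms(6) by blast
  define k where "k = (LEAST n. (deriv ^^ n) f \<mu> \<noteq> 0)"
  have k: "(deriv ^^ k) f \<mu> \<noteq> 0" "\<And>j. j < k \<Longrightarrow> (deriv ^^ j) f \<mu> = 0"
    using LeastI_ex[OF \<open>\<exists>n. _\<close>] not_less_Least unfolding k_def by blast+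
  then obtain h where h: "h holomorphic_on \<Omega>" "\<And>z. z \<in> \<Omega> \<Longrightarrow> f z = (z - \<mu>) ^ k * h z"
    using vanishes_to_iff_deriv[OF assms(1,3,4), of k] using vanishes_toE by blast
  have "(deriv ^^ k) f \<mu> = (deriv ^^ k) (\<lambda>z. (z - \<mu>) ^ k * h z) \<mu>"
    using h assms by (intro higher_deriv_transform_within_open[of _ \<Omega>] holomorphic_intros) auto
  then have "h \<mu> \<noteq> 0"
    using higher_deriv_linear_power_mult[OF assms(1,3) h(1), of k k] k by auto
  with h show ?thesis by (intro that)
qed

lemma Hol_nonzeroE:
  assumes "f \<in> Hol \<Omega>" "f \<noteq> 0"
  obtains w where "w \<in> \<Omega>" "f w \<noteq> 0"
  using assms by (auto simp: Hol_def fun_eq_iff)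

lemma Hol_eqI:
  assumes "f \<in> Hol \<Omega>" "g \<in> Hol \<Omega>" "\<And>z. z \<in> \<Omega> \<Longrightarrow> f z = g z"
  shows "f = g"
proof
  fix z show "f z = g z" using assms by (cases "z \<in> \<Omega>") (auto simp: Hol_def)
qed

lemma le_zmult_iff:
  assumes "open \<Omega>" "connected \<Omega>" "\<mu> \<in> \<Omega>" "f \<in> Hol \<Omega>"
  shows "enat n \<le> zmult f \<mu> \<longleftrightarrow> vanishes_to \<Omega> \<mu> n f"
proof (cases "f = 0")
  case True
  then show ?thesis by (auto simp: zmult_def intro!: vanishes_toI[of "\<lambda>_. 0"])
next
  case False
  then obtain w where "w \<in> \<Omega>" "f w \<noteq> 0" using assms(4) Hol_nonzeroE by blast
  moreover have holf: "f holomorphic_on \<Omega>" using assms by (simp add: Hol_def)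
  ultimately obtain k h where h: "h holomorphic_on \<Omega>" "\<And>z. z \<in> \<Omega> \<Longrightarrow> f z = (z - \<mu>) ^ k * h z" "h \<mu> \<noteq> 0"
    using holomorphic_order_factor[OF assms(1-3)] by metis
  have zm: "zmult f \<mu> = enat k"
    by (rule zmult_eqI[of \<Omega> \<mu> h]) (use assms h in auto)
  show ?thesis
  proof
    assume "enat n \<le> zmult f \<mu>"
    then show "vanishes_to \<Omega> \<mu> n f"
      using vanishes_to_mono[OF vanishes_toI[OF h(1,2)], of n] zm by simp
  next
    assume "vanishes_to \<Omega> \<mu> n f"
    then obtain h' where h': "h' holomorphic_on \<Omega>" "\<And>z. z \<in> \<Omega> \<Longrightarrow> f z = (z - \<mu>) ^ n * h' z"
      using vanishes_toE by blast
    have "n \<le> k"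
    proof (rule ccontr)
      assume "\<not> n \<le> k"
      then have "n = k + Suc (n - k - 1)" by simp
      then have "(z - \<mu>) ^ k * h z = (z - \<mu>) ^ k * ((z - \<mu>) ^ Suc (n - k - 1) * h' z)" if "z \<in> \<Omega>" for z
        using h(2)[OF that] h'(2)[OF that] by (metis mult.assoc power_add)
      then have "h \<mu> = (\<mu> - \<mu>) ^ Suc (n - k - 1) * h' \<mu>"
        using assms(1,3) by (intro linear_factor_cancel[where b = "\<lambda>z. (z - \<mu>) ^ Suc (n - k - 1) * h' z"])
          (auto intro!: holomorphic_on_imp_continuous_on holomorphic_intros h h')
      with h show False by simp
    qed
    with zm show "enat n \<le> zmult f \<mu>" by simp
  qed
qed

text \<open>By the fundamental theorem of algebra, divisibility and congruence arguments need to
  treat only one root at a time. Multiple roots are met as repeated single ones.\<close>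

lemma complex_poly_root_induct [consumes 1, case_names const root]:
  fixes p :: "complex poly"
  assumes "p \<noteq> 0"
    and "\<And>c. c \<noteq> 0 \<Longrightarrow> P [:c:]"
    and "\<And>p \<mu>. p \<noteq> 0 \<Longrightarrow> P p \<Longrightarrow> P ([:-\<mu>, 1:] * p)"
  shows "P p"
  using assms(1)
proof (induction "degree p" arbitrary: p)
  case 0
  then show ?case by (metis assms(2) degree_eq_zeroE pCons_0_0)
next
  case (Suc n)
  obtain \<mu> where "poly p \<mu> = 0"
    using alg_closed_imp_poly_has_root[of p] Suc.hyps(2) by auto
  then obtain q where q: "p = [:-\<mu>, 1:] * q"
    by (metis dvd_def poly_eq_0_iff_dvd)
  with Suc.prems have "q \<noteq> 0" by auto
  then have "degree p = Suc (degree q)" unfolding q by (subst degree_mult_eq) auto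
  then have "P q" using Suc \<open>q \<noteq> 0\<close> by auto
  then show ?case using assms(3) q \<open>q \<noteq> 0\<close> by blast
qed

text \<open>Induction on the number of distinct zeros in \<open>K\<close>: removing a zero with its
  full order leaves strictly fewer. The point \<open>w\<close> keeps the cofactor from being
  identically zero, so all orders are finite.\<close>

lemma zero_factorization:
  assumes "open \<Omega>" "connected \<Omega>" "f holomorphic_on \<Omega>" "w \<in> \<Omega>" "f w \<noteq> 0" "compact K" "K \<subseteq> \<Omega>"
  obtains P h where "P \<noteq> 0" "h holomorphic_on \<Omega>" "\<And>z. z \<in> \<Omega> \<Longrightarrow> f z = poly P z * h z"
    "\<And>z. z \<in> K \<Longrightarrow> h z \<noteq> 0"
proof -
  define N where "N = card {z\<in>K. f z = 0}"
  have "\<exists>P h. P \<noteq> 0 \<and> h holomorphic_on \<Omega> \<and> (\<forall>z\<in>\<Omega>. f z = poly P z * h z) \<and> (\<forall>z\<in>K. h z \<noteq> 0)"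
    using N_def assms(3,5)
  proof (induction N arbitrary: f rule: less_induct)
    case (less N)
    have fin: "finite {z\<in>K. f z = 0}"
    proof (cases "f constant_on \<Omega>")
      case True
      then have "{z\<in>K. f z = 0} = {}"
        using assms(4,7) less.prems(3) unfolding constant_on_def by (auto; metis subsetD)
      then show ?thesis by (metis finite.emptyI)
    next
      case False
      then show ?thesis
        using holomorphic_compact_finite_zeros[of f \<Omega> K] less.prems assms by blast
    qed
    show ?case
    proof (cases "{z\<in>K. f z = 0} = {}")
      case True
      then show ?thesis
        by (intro exI[of _ 1] exI[of _ f]) (use less.prems in auto)
    next
      case False
      then obtain \<mu> where \<mu>: "\<mu> \<in> K" "f \<mu> = 0" by auto
      then have "\<mu> \<in> \<Omega>" using assms by auto
      then obtain k h where h: "h holomorphic_on \<Omega>" "\<And>z. z \<in> \<Omega> \<Longrightarrow> f z = (z - \<mu>) ^ k * h z" "h \<mu> \<noteq> 0"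
        using holomorphic_order_factor[OF assms(1,2) _ less.prems(2) assms(4) less.prems(3)] by metis
      have sub: "{z\<in>K. h z = 0} \<subset> {z\<in>K. f z = 0}"
        using h \<mu> assms(7) by (auto simp: subset_iff)
      have "card {z\<in>K. h z = 0} < N"
        using psubset_card_mono[OF fin sub] less.prems(1) by simp
      moreover have "h w \<noteq> 0" using h(2)[OF assms(4)] less.prems(3) by auto
      ultimately obtain P k' where "P \<noteq> 0" "k' holomorphic_on \<Omega>" "\<forall>z\<in>\<Omega>. h z = poly P z * k' z"
        "\<forall>z\<in>K. k' z \<noteq> 0"
        using less.IH[OF _ refl h(1)] by blast
      then show ?thesis
        by (intro exI[of _ "[:-\<mu>, 1:] ^ k * P"] exI[of _ k']) (auto simp: h(2) poly_power)
    qed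
  qed
  then show ?thesis using that by blast
qed

section \<open>Interpolation inside an invariant subspace\<close>

text \<open>Kept abstract since it is used twice: for subspaces of H(\<Omega>), with
  \<open>a\<close> the minimal orders, and for spaces of polynomials on the whole plane, with
  \<open>Q\<close> as \<open>g\<close> and \<open>a\<close> equal to 0. The exact order
  \<open>a \<mu>\<close> has to be attained only at zeros of \<open>g\<close>, the only points where
  interpolation has to correct a value.\<close>

locale shift_invariant =
  fixes \<Omega> :: "complex set" and g :: "complex \<Rightarrow> complex" and S :: "(complex \<Rightarrow> complex) set"
    and a :: "complex \<Rightarrow> nat"
  assumes \<Omega>: "open \<Omega>" "0 \<in> \<Omega>"
    and g: "g holomorphic_on \<Omega>" "g 0 = 1"
    and S_hol: "s \<in> S \<Longrightarrow> s holomorphic_on \<Omega>"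
    and S_zero: "(\<lambda>_. 0) \<in> S"
    and S_lincomb: "s \<in> S \<Longrightarrow> t \<in> S \<Longrightarrow> (\<lambda>z. s z + c * t z) \<in> S"
    and S_shift: "s \<in> S \<Longrightarrow> \<exists>t\<in>S. \<forall>z\<in>\<Omega>. z * t z = s z - s 0 * g z"
    and order_ge: "\<mu> \<in> \<Omega> \<Longrightarrow> s \<in> S \<Longrightarrow> vanishes_to \<Omega> \<mu> (a \<mu>) s"
    and order_attained: "\<mu> \<in> \<Omega> \<Longrightarrow> g \<mu> = 0 \<Longrightarrow> \<exists>s\<in>S. \<exists>h. h holomorphic_on \<Omega> \<and> h \<mu> \<noteq> 0 \<and>
           (\<forall>z\<in>\<Omega>. s z = (z - \<mu>) ^ a \<mu> * h z)"
begin

text \<open>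
  The operator \<open>s \<mapsto> s - \<lambda> D s\<close> multiplies \<open>s\<close> by \<open>(z - \<lambda>) / z\<close> modulo \<open>g\<close>, and \<open>z\<close> is a unit
  modulo every divisor of \<open>g\<close>.
\<close>

lemma insert_factor:
  assumes "A \<noteq> 0" "\<mu> \<in> \<Omega>" "\<gamma> holomorphic_on \<Omega>"
    and "\<And>z. z \<in> \<Omega> \<Longrightarrow> g z = (z - \<mu>) ^ Suc (a \<mu>) * poly A z * \<gamma> z"
  shows "\<exists>s\<in>S. \<exists>h. h holomorphic_on \<Omega> \<and> h \<mu> \<noteq> 0 \<and> (\<forall>z\<in>\<Omega>. s z = (z - \<mu>) ^ a \<mu> * poly A z * h z)"
  using assms
proof (induction A arbitrary: \<gamma> rule: complex_poly_root_induct)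
  case (const c)
  have "g \<mu> = 0" using const.prems(3)[OF \<open>\<mu> \<in> \<Omega>\<close>] by simp
  then obtain s h where sh: "s \<in> S" "h holomorphic_on \<Omega>" "h \<mu> \<noteq> 0" "\<forall>z\<in>\<Omega>. s z = (z - \<mu>) ^ a \<mu> * h z"
    using order_attained[OF \<open>\<mu> \<in> \<Omega>\<close>] by blast
  have "(\<lambda>z. h z / c) holomorphic_on \<Omega>" by (intro holomorphic_intros sh const)
  with sh const show ?case
    by (intro bexI[of _ s] exI[of _ "\<lambda>z. h z / c"]) auto
next
  case (root A \<nu>)
  have hol': "(\<lambda>z. (z - \<nu>) * \<gamma> z) holomorphic_on \<Omega>"
    by (intro holomorphic_intros root)
  obtain s h where sh: "s \<in> S" "h holomorphic_on \<Omega>" "h \<mu> \<noteq> 0"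
    "\<forall>z\<in>\<Omega>. s z = (z - \<mu>) ^ a \<mu> * poly A z * h z"
    using root.IH[OF \<open>\<mu> \<in> \<Omega>\<close> hol'] root.prems(3) by (auto simp: algebra_simps)
  obtain t where t: "t \<in> S" "\<forall>z\<in>\<Omega>. z * t z = s z - s 0 * g z"
    using S_shift[OF sh(1)] by blast
  define u where "u = (\<lambda>z. s z + (-\<nu>) * t z)"
  have "u \<in> S" unfolding u_def by (rule S_lincomb) fact+
  define B where "B = (\<lambda>z. (z - \<mu>) ^ a \<mu> * poly ([:-\<nu>, 1:] * A) z)"
  define k where "k = (\<lambda>z. h z + \<nu> * s 0 * ((z - \<mu>) * \<gamma> z))"
  have k_hol: "k holomorphic_on \<Omega>"
    unfolding k_def by (intro holomorphic_intros sh root)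
  have zu: "z * u z = B z * k z" if "z \<in> \<Omega>" for z
  proof -
    have "z * u z = z * s z - \<nu> * (z * t z)" by (simp add: u_def algebra_simps)
    also have "z * t z = s z - s 0 * g z" using t that by simp
    also have "z * s z - \<nu> * (s z - s 0 * g z) = (z - \<nu>) * s z + \<nu> * s 0 * g z" by (simp add: algebra_simps)
    also have "\<dots> = B z * k z"
      unfolding root.prems(3)[OF that] using sh(4) that by (simp add: B_def k_def algebra_simps)
    finally show ?thesis .
  qed
  \<comment> \<open>\<open>B\<close> divides \<open>g\<close> and g(0) = 1, so the zero of
    \<open>z * u z\<close> at 0 must come from \<open>k\<close>; dividing by z leaves the factor
    \<open>B\<close> intact.\<close>
  have "B 0 \<noteq> 0" using root.prems(3)[OF \<Omega>(2)] g by (auto simp: B_def)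
  then have "k 0 = 0" using zu[OF \<Omega>(2)] by auto
  then obtain q where q: "q holomorphic_on \<Omega>" "\<And>z. z \<in> \<Omega> \<Longrightarrow> k z = (z - 0) * q z"
    using divide_linear_factor[OF \<Omega>(1) k_hol, of 0] by blast
  have B_hol: "B holomorphic_on \<Omega>" unfolding B_def by (intro holomorphic_intros)
  have "u z = B z * q z" if "z \<in> \<Omega>" for z
    by (rule linear_factor_cancel[of \<Omega> u "\<lambda>z. B z * q z" 0 1])
      (use zu q that \<Omega> S_hol[OF \<open>u \<in> S\<close>] B_hol in
        \<open>auto intro!: holomorphic_on_imp_continuous_on holomorphic_on_mult\<close>)
  \<comment> \<open>Here the exponent \<open>Suc (a \<mu>)\<close> of the hypothesis pays off: the
    term of \<open>k\<close> coming from \<open>g\<close> carries a spare factor z - \<mu>, hence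
    \<open>k \<mu> = h \<mu>\<close>.\<close>
  moreover have "q \<mu> \<noteq> 0"
    using q(2)[OF \<open>\<mu> \<in> \<Omega>\<close>] sh(3) by (auto simp: k_def)
  ultimately show ?case
    using \<open>u \<in> S\<close> q(1) unfolding B_def by blast
qed

text \<open>The divisor is built up root by root. If f - s = G k and k does not vanish at the next
  root \<mu>, a multiple of the element supplied by \<open>insert_factor\<close> is added to s: it
  is divisible by G and its cofactor is nonzero at \<mu>, so it can cancel k(\<mu>).\<close>

lemma interpolate:
  assumes "G \<noteq> 0" "\<gamma> holomorphic_on \<Omega>" "\<And>z. z \<in> \<Omega> \<Longrightarrow> g z = poly G z * \<gamma> z"
    and f: "f holomorphic_on \<Omega>" "\<And>\<mu>. \<mu> \<in> \<Omega> \<Longrightarrow> vanishes_to \<Omega> \<mu> (a \<mu>) f"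
  shows "\<exists>s\<in>S. \<exists>k. k holomorphic_on \<Omega> \<and> (\<forall>z\<in>\<Omega>. f z - s z = poly G z * k z)"
  using assms(1-3)
proof (induction G arbitrary: \<gamma> rule: complex_poly_root_induct)
  case (const c)
  have "(\<lambda>z. f z / c) holomorphic_on \<Omega>" by (intro holomorphic_intros f const)
  then show ?case
    by (intro bexI[of _ "\<lambda>_. 0"] exI[of _ "\<lambda>z. f z / c"]) (use S_zero const in auto)
next
  case (root G \<mu>)
  have hol': "(\<lambda>z. (z - \<mu>) * \<gamma> z) holomorphic_on \<Omega>"
    by (intro holomorphic_intros root)
  obtain s k where sk: "s \<in> S" "k holomorphic_on \<Omega>" "\<forall>z\<in>\<Omega>. f z - s z = poly G z * k z"
    using root.IH[OF hol'] root.prems(2) by (auto simp: algebra_simps)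
  \<comment> \<open>It suffices to make the cofactor vanish at the new root; a root off \<Omega>
    needs no correction.\<close>
  have goal_if: ?case if k': "s' \<in> S" "k' holomorphic_on \<Omega>" "\<forall>z\<in>\<Omega>. f z - s' z = poly G z * k' z"
    "\<mu> \<in> \<Omega> \<longrightarrow> k' \<mu> = 0" for s' k'
  proof -
    obtain q where q: "q holomorphic_on \<Omega>" "\<And>z. z \<in> \<Omega> \<Longrightarrow> k' z = (z - \<mu>) * q z"
      using divide_linear_factor[OF \<Omega>(1) k'(2) mp[OF k'(4)]] by metis
    with k' show ?thesis
      by (intro bexI[of _ s'] exI[of _ q]) (auto simp: algebra_simps)
  qed
  show ?case
  proof (cases "\<mu> \<in> \<Omega> \<and> k \<mu> \<noteq> 0")
    case False
    then show ?thesis using goal_if[OF sk] by blast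
  next
    case True
    then have \<mu>: "\<mu> \<in> \<Omega>" "k \<mu> \<noteq> 0" by auto
    \<comment> \<open>Both f and s vanish to order \<open>a \<mu>\<close> at \<mu>. Had G a smaller
      order there, the cofactor k would have to vanish at \<mu>, contrary to this case.\<close>
    have "a \<mu> \<le> order \<mu> G"
    proof (rule ccontr)
      assume less: "\<not> a \<mu> \<le> order \<mu> G"
      obtain A where A: "G = [:-\<mu>, 1:] ^ order \<mu> G * A" "\<not> [:-\<mu>, 1:] dvd A"
        using order_decomp[OF \<open>G \<noteq> 0\<close>] by blast
      have "vanishes_to \<Omega> \<mu> (a \<mu>) (\<lambda>z. f z + (-1) * s z)"
        by (intro vanishes_to_lincomb f order_ge sk \<mu>)
      then have "vanishes_to \<Omega> \<mu> (a \<mu>) (\<lambda>z. f z - s z)" by simp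
      then obtain x where x: "x holomorphic_on \<Omega>" "\<And>z. z \<in> \<Omega> \<Longrightarrow> f z - s z = (z - \<mu>) ^ a \<mu> * x z"
        using vanishes_toE by blast
      define d where "d = a \<mu> - order \<mu> G - 1"
      have d: "a \<mu> = order \<mu> G + Suc d" using less by (simp add: d_def)
      have "(z - \<mu>) ^ order \<mu> G * (poly A z * k z) = (z - \<mu>) ^ order \<mu> G * ((z - \<mu>) ^ Suc d * x z)"
        if "z \<in> \<Omega>" for z
      proof -
        have "poly G z = (z - \<mu>) ^ order \<mu> G * poly A z"
          by (subst A(1)) (simp add: poly_power)
        then show ?thesis using sk(3) x(2)[OF that] that unfolding d power_add by (simp add: mult.assoc)
      qed
      then have "poly A \<mu> * k \<mu> = (\<mu> - \<mu>) ^ Suc d * x \<mu>"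
        by (intro linear_factor_cancel[of \<Omega> "\<lambda>z. poly A z * k z" "\<lambda>z. (z - \<mu>) ^ Suc d * x z" \<mu> "order \<mu> G"])
          (use \<Omega> \<mu> in \<open>auto intro!: holomorphic_on_imp_continuous_on holomorphic_intros sk x\<close>)
      with \<mu> A(2) show False by (simp add: poly_eq_0_iff_dvd)
    qed
    then have "[:-\<mu>, 1:] ^ a \<mu> dvd G" by (simp add: order_divides)
    then obtain A where A: "G = [:-\<mu>, 1:] ^ a \<mu> * A" by (rule dvdE)
    have "A \<noteq> 0" using A \<open>G \<noteq> 0\<close> by auto
    have "g z = (z - \<mu>) ^ Suc (a \<mu>) * poly A z * \<gamma> z" if "z \<in> \<Omega>" for z
      using root.prems(2)[OF that] by (simp add: A poly_power algebra_simps)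
    then obtain t h where th: "t \<in> S" "h holomorphic_on \<Omega>" "h \<mu> \<noteq> 0"
      "\<forall>z\<in>\<Omega>. t z = (z - \<mu>) ^ a \<mu> * poly A z * h z"
      using insert_factor[OF \<open>A \<noteq> 0\<close> \<mu>(1) root.prems(1)] by blast
    define c where "c = k \<mu> / h \<mu>"
    have "(\<lambda>z. s z + c * t z) \<in> S" using S_lincomb sk th by blast
    moreover have "(\<lambda>z. k z - c * h z) holomorphic_on \<Omega>" by (intro holomorphic_intros sk th)
    moreover have "\<forall>z\<in>\<Omega>. f z - (s z + c * t z) = poly G z * (k z - c * h z)"
    proof
      fix z assume z: "z \<in> \<Omega>"
      have e: "t z = poly G z * h z" "f z - s z = poly G z * k z"
        using th(4) sk(3) z by (auto simp: A poly_power)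
      have "f z - (s z + c * t z) = (f z - s z) - c * t z" by simp
      then show "f z - (s z + c * t z) = poly G z * (k z - c * h z)"
        by (simp only: e right_diff_distrib mult.left_commute)
    qed
    ultimately show ?thesis using goal_if \<mu> th(3) by (auto simp: c_def)
  qed
qed

end

section \<open>Separation in a semi-inner product space\<close>

locale semi_inner =
  fixes V :: "'v::ab_group_add set" and sc :: "complex \<Rightarrow> 'v \<Rightarrow> 'v" and ip :: "'v \<Rightarrow> 'v \<Rightarrow> complex"
  assumes V_add: "a \<in> V \<Longrightarrow> b \<in> V \<Longrightarrow> a + b \<in> V"
    and V_sc: "a \<in> V \<Longrightarrow> sc k a \<in> V"
    and sc_minus: "sc (-k) a = - sc k a" "sc 1 a = a"
    and ip_add: "a \<in> V \<Longrightarrow> b \<in> V \<Longrightarrow> c \<in> V \<Longrightarrow> ip (a + b) c = ip a c + ip b c"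
    and ip_sc: "a \<in> V \<Longrightarrow> b \<in> V \<Longrightarrow> ip (sc k a) b = k * ip a b"
    and ip_cnj: "a \<in> V \<Longrightarrow> b \<in> V \<Longrightarrow> ip b a = cnj (ip a b)"
    and ip_nonneg: "a \<in> V \<Longrightarrow> Re (ip a a) \<ge> 0"
begin

definition sq :: "'v \<Rightarrow> real" where "sq a = Re (ip a a)"

lemma V_diff: "a \<in> V \<Longrightarrow> b \<in> V \<Longrightarrow> a - b \<in> V"
  using V_add[of a "- b"] V_sc[of b "-1"] sc_minus(1)[of 1 b] sc_minus(2)[of b] by simp

lemma ip_add_right: "a \<in> V \<Longrightarrow> b \<in> V \<Longrightarrow> c \<in> V \<Longrightarrow> ip c (a + b) = ip c a + ip c b"
  by (metis V_add complex_cnj_add ip_add ip_cnj)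

lemma ip_sc_right: "a \<in> V \<Longrightarrow> b \<in> V \<Longrightarrow> ip b (sc k a) = cnj k * ip b a"
  by (metis V_sc complex_cnj_mult ip_cnj ip_sc)

lemma ip_diff: "a \<in> V \<Longrightarrow> b \<in> V \<Longrightarrow> c \<in> V \<Longrightarrow> ip (a - b) c = ip a c - ip b c"
  using ip_add[of "a - b" b c] V_diff[of a b] by simp

lemma ip_diff_right: "a \<in> V \<Longrightarrow> b \<in> V \<Longrightarrow> c \<in> V \<Longrightarrow> ip c (a - b) = ip c a - ip c b"
  using ip_add_right[of "a - b" b c] V_diff[of a b] by simp

lemma sq_nonneg: "a \<in> V \<Longrightarrow> sq a \<ge> 0"
  by (simp add: sq_def ip_nonneg)

lemma ip_self: "a \<in> V \<Longrightarrow> ip a a = of_real (sq a)"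
  using ip_cnj[of a a] by (simp add: sq_def complex_eq_iff)

lemma sq_diff_sc:
  assumes "a \<in> V" "b \<in> V"
  shows "sq (a - sc k b) = sq a - 2 * Re (cnj k * ip a b) + (cmod k)\<^sup>2 * sq b"
proof -
  have "ip (a - sc k b) (a - sc k b) = ip a a - cnj k * ip a b - k * ip b a + k * cnj k * ip b b"
    using assms by (simp add: ip_diff ip_diff_right ip_sc ip_sc_right V_sc V_diff algebra_simps)
  also have "\<dots> = of_real (sq a) - (cnj k * ip a b + cnj (cnj k * ip a b)) + of_real ((cmod k)\<^sup>2 * sq b)"
    using assms by (simp add: ip_self ip_cnj[of a b] complex_norm_square del: of_real_power)
  also have "\<dots> = of_real (sq a - 2 * Re (cnj k * ip a b) + (cmod k)\<^sup>2 * sq b)"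
    by (simp add: complex_add_cnj del: complex_cnj_mult)
  finally show ?thesis by (simp only: sq_def Re_complex_of_real)
qed

text \<open>Restrict the quadratic \<open>sq (a - sc k b)\<close> to k = t c with c =
  \<open>ip a b\<close> and t real. Its minimum, at t = 1 / \<open>sq b\<close>, cannot fall below
  \<delta>. With \<delta> = 0 this is the Cauchy-Schwarz inequality; with \<delta> the infimum of
  squared distances it gives approximate orthogonality.\<close>

lemma ip_bound_of_minimal:
  assumes "a \<in> V" "b \<in> V" "\<And>k. \<delta> \<le> sq (a - sc k b)"
  shows "(cmod (ip a b))\<^sup>2 \<le> sq b * (sq a - \<delta>)"
proof -
  define c where "c = ip a b"
  have ineq: "\<delta> \<le> sq a - 2 * t * (cmod c)\<^sup>2 + t\<^sup>2 * (cmod c)\<^sup>2 * sq b" for t :: real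
  proof -
    have "cnj (of_real t * c) * c = of_real (t * (cmod c)\<^sup>2)"
      by (simp add: complex_norm_square mult_ac del: of_real_power)
    then have "Re (cnj (of_real t * c) * c) = t * (cmod c)\<^sup>2" by (metis Re_complex_of_real)
    moreover have "(cmod (of_real t * c))\<^sup>2 = t\<^sup>2 * (cmod c)\<^sup>2"
      by (simp add: norm_mult power_mult_distrib)
    ultimately show ?thesis
      using assms(3)[of "of_real t * c"] sq_diff_sc[OF assms(1,2), of "of_real t * c"]
      unfolding c_def[symmetric] by simp
  qed
  show ?thesis
  proof (cases "sq b = 0")
    case True
    have "cmod c = 0"
    proof (rule ccontr)
      assume "cmod c \<noteq> 0"
      \<comment> \<open>For \<open>sq b = 0\<close> the bound is affine in t; this t brings it down
        to \<delta> - 1.\<close>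
      then show False
        using ineq[of "(sq a - \<delta> + 1) / (2 * (cmod c)\<^sup>2)"] True by (simp add: field_simps)
    qed
    with True show ?thesis by (simp add: c_def)
  next
    case False
    then have pos: "sq b > 0" using sq_nonneg[OF assms(2)] by simp
    have "\<delta> \<le> sq a - (cmod c)\<^sup>2 / sq b"
      using ineq[of "1 / sq b"] pos by (simp add: power2_eq_square field_simps)
    then show ?thesis using pos by (simp add: c_def field_simps)
  qed
qed

lemma cauchy_schwarz:
  assumes "a \<in> V" "b \<in> V"
  shows "cmod (ip a b) \<le> sqrt (sq a) * sqrt (sq b)"
proof -
  have "(cmod (ip a b))\<^sup>2 \<le> sq b * (sq a - 0)"
    using assms by (intro ip_bound_of_minimal sq_nonneg V_diff V_sc) auto
  then have "cmod (ip a b) \<le> sqrt (sq b * sq a)" by (simp add: real_le_rsqrt)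
  then show ?thesis by (simp add: real_sqrt_mult mult.commute)
qed

lemma sq_diff_le:
  assumes "a \<in> V" "b \<in> V"
  shows "sq (a - b) \<le> 2 * sq a + 2 * sq b"
proof -
  have "sq (a - b) = sq a - 2 * Re (ip a b) + sq b" "sq (a + b) = sq a + 2 * Re (ip a b) + sq b"
    using sq_diff_sc[OF assms, of 1] sq_diff_sc[OF assms, of "-1"] by (simp_all add: sc_minus)
  moreover have "sq (a + b) \<ge> 0" using assms by (intro sq_nonneg V_add)
  ultimately show ?thesis by linarith
qed

text \<open>
  The functional is \<open>a \<mapsto> lim ip a (x - s k)\<close> for a sequence \<open>s k\<close> in \<open>S\<close> minimizing the distance
  to \<open>x\<close>; no completeness is needed since only scalars converge.
\<close>

theorem separating_functional:
  assumes "S \<subseteq> V" "S \<noteq> {}" and S_add: "\<And>a b. a \<in> S \<Longrightarrow> b \<in> S \<Longrightarrow> a + b \<in> S"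
    and S_sc: "\<And>k a. a \<in> S \<Longrightarrow> sc k a \<in> S"
    and "x \<in> V" "\<epsilon> > 0" and far: "\<And>s. s \<in> S \<Longrightarrow> \<epsilon> \<le> sq (x - s)"
  obtains F C where "\<And>a b. a \<in> V \<Longrightarrow> b \<in> V \<Longrightarrow> F (a + b) = F a + F b"
    "\<And>k a. a \<in> V \<Longrightarrow> F (sc k a) = k * F a" "\<And>s. s \<in> S \<Longrightarrow> F s = 0" "F x \<noteq> (0::complex)"
    "\<And>a. a \<in> V \<Longrightarrow> cmod (F a) \<le> C * sqrt (sq a)" "C \<ge> 0"
proof -
  define \<delta> where "\<delta> = Inf ((\<lambda>s. sq (x - s)) ` S)"
  define e where "e = (\<lambda>k::nat. 1 / (real k + 1))"
  have e_pos: "e k > 0" "e k \<le> 1" for k by (auto simp: e_def)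
  have e_lim: "(\<lambda>k. sqrt (e k)) \<longlonglongrightarrow> 0" "e \<longlonglongrightarrow> 0"
  proof -
    show "e \<longlonglongrightarrow> 0" unfolding e_def
      using LIMSEQ_inverse_real_of_nat by (simp add: inverse_eq_divide add.commute)
    then show "(\<lambda>k. sqrt (e k)) \<longlonglongrightarrow> 0" using tendsto_real_sqrt by fastforce
  qed
  have bdd: "bdd_below ((\<lambda>s. sq (x - s)) ` S)" using far by (intro bdd_belowI[of _ \<epsilon>]) auto
  have \<delta>_le: "\<delta> \<le> sq (x - s)" if "s \<in> S" for s
    unfolding \<delta>_def using that bdd by (intro cInf_lower) auto
  have "\<delta> \<ge> \<epsilon>" unfolding \<delta>_def using far assms(2) by (intro cInf_greatest) auto
  have "\<exists>s\<in>S. sq (x - s) < \<delta> + e k" for k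
    using cInf_lessD[of "(\<lambda>s. sq (x - s)) ` S" "\<delta> + e k"] assms(2) e_pos by (auto simp: \<delta>_def)
  then obtain s where s: "\<And>k. s k \<in> S" "\<And>k. sq (x - s k) < \<delta> + e k" by metis
  define z where "z = (\<lambda>k. x - s k)"
  have sV: "s k \<in> V" for k using s assms by auto
  have zV: "z k \<in> V" for k using sV assms by (simp add: z_def V_diff)
  have S_diff: "a - b \<in> S" if "a \<in> S" "b \<in> S" for a b
    using S_add[OF that(1) S_sc[OF that(2), of "-1"]] by (simp add: sc_minus)
  \<comment> \<open>Changing \<open>s k\<close> by an element of \<open>S\<close> stays in
    \<open>S\<close>, so it cannot improve the squared distance by more than
    \<open>e k\<close>.\<close>
  have orth: "cmod (ip (z k) a) \<le> sqrt (sq a) * sqrt (e k)" if "a \<in> S" for a k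
  proof -
    have "\<delta> \<le> sq (z k - sc c a)" for c
      using \<delta>_le[of "s k + sc c a"] S_add[OF s(1) S_sc[OF that]] by (simp add: z_def diff_diff_eq)
    then have "(cmod (ip (z k) a))\<^sup>2 \<le> sq a * (sq (z k) - \<delta>)"
      using that assms(1) zV by (intro ip_bound_of_minimal) auto
    also have "\<dots> \<le> sq a * e k"
      using s(2)[of k] that assms(1) by (intro mult_left_mono sq_nonneg) (auto simp: z_def)
    finally show ?thesis by (simp add: real_le_rsqrt flip: real_sqrt_mult)
  qed
  \<comment> \<open>The difference d = z k - z l lies in \<open>S\<close> itself. Testing the
    near-orthogonality of z k and z l against d bounds \<open>sq d\<close> by its own square root
    times the errors.\<close>
  have close: "sqrt (sq (z k - z l)) \<le> sqrt (e k) + sqrt (e l)" for k l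
  proof -
    define d where "d = z k - z l"
    have "d = s l - s k" by (simp add: d_def z_def)
    then have dS: "d \<in> S" using S_diff s by auto
    then have dV: "d \<in> V" using assms by auto
    have "sq d = Re (ip (z k) d - ip (z l) d)"
      using ip_diff[OF zV zV dV, of k l] by (simp add: sq_def flip: d_def)
    also have "\<dots> \<le> cmod (ip (z k) d) + cmod (ip (z l) d)"
      by (meson complex_Re_le_cmod norm_triangle_ineq4 order_trans)
    also have "\<dots> \<le> sqrt (sq d) * (sqrt (e k) + sqrt (e l))"
      using orth[OF dS, of k] orth[OF dS, of l] by (simp add: algebra_simps)
    finally have "sqrt (sq d) * sqrt (sq d) \<le> sqrt (sq d) * (sqrt (e k) + sqrt (e l))"
      using sq_nonneg[OF dV] by simp
    moreover have "0 \<le> sqrt (e k) + sqrt (e l)"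
      using e_pos by (intro add_nonneg_nonneg) (auto simp: less_imp_le)
    ultimately show ?thesis
      unfolding d_def[symmetric] using sq_nonneg[OF dV]
      by (cases "sq d = 0") (auto simp del: real_sqrt_mult_self simp: mult_le_cancel_left)
  qed
  have conv: "convergent (\<lambda>k. ip a (z k))" if "a \<in> V" for a
  proof -
    have bound: "dist (ip a (z k)) (ip a (z l)) \<le> sqrt (sq a) * (sqrt (e k) + sqrt (e l))" for k l
    proof -
      have "dist (ip a (z k)) (ip a (z l)) = cmod (ip a (z k - z l))"
        using ip_diff_right[OF zV zV that] by (simp add: dist_norm)
      also have "\<dots> \<le> sqrt (sq a) * sqrt (sq (z k - z l))"
        using that zV V_diff by (intro cauchy_schwarz) auto
      also have "\<dots> \<le> sqrt (sq a) * (sqrt (e k) + sqrt (e l))"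
        using close sq_nonneg[OF that] by (intro mult_left_mono) auto
      finally show ?thesis .
    qed
    have "Cauchy (\<lambda>k. ip a (z k))"
    proof (rule metric_CauchyI)
      fix \<eta> :: real assume "\<eta> > 0"
      have "(\<lambda>k. 2 * sqrt (sq a) * sqrt (e k)) \<longlonglongrightarrow> 2 * sqrt (sq a) * 0"
        by (intro tendsto_intros e_lim)
      then have "\<forall>\<^sub>F k in sequentially. 2 * sqrt (sq a) * sqrt (e k) < \<eta>"
        using \<open>\<eta> > 0\<close> by (simp add: order_tendstoD(2))
      then obtain M where M: "\<And>k. k \<ge> M \<Longrightarrow> 2 * sqrt (sq a) * sqrt (e k) < \<eta>"
        by (auto simp: eventually_sequentially)
      have "dist (ip a (z m)) (ip a (z n)) < \<eta>" if "m \<ge> M" "n \<ge> M" for m n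
        using bound[of m n] M[OF that(1)] M[OF that(2)] by (simp add: algebra_simps)
      then show "\<exists>M. \<forall>m\<ge>M. \<forall>n\<ge>M. dist (ip a (z m)) (ip a (z n)) < \<eta>" by blast
    qed
    then show ?thesis by (simp add: Cauchy_convergent_iff)
  qed
  define F where "F = (\<lambda>a. lim (\<lambda>k. ip a (z k)))"
  have F: "(\<lambda>k. ip a (z k)) \<longlonglongrightarrow> F a" if "a \<in> V" for a
    using conv[OF that] by (simp add: F_def convergent_LIMSEQ_iff)
  show ?thesis
  proof
    show "F (a + b) = F a + F b" if "a \<in> V" "b \<in> V" for a b
    proof -
      have "(\<lambda>k. ip (a + b) (z k)) \<longlonglongrightarrow> F a + F b"
        using tendsto_add[OF F[OF that(1)] F[OF that(2)]] by (simp add: ip_add that zV)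
      then show ?thesis using F[OF V_add[OF that]] LIMSEQ_unique by blast
    qed
    show "F (sc k a) = k * F a" if "a \<in> V" for k a
    proof -
      have "(\<lambda>n. ip (sc k a) (z n)) \<longlonglongrightarrow> k * F a"
        using tendsto_mult_left[OF F[OF that], of k] by (simp add: ip_sc that zV)
      then show ?thesis using F[OF V_sc[OF that]] LIMSEQ_unique by blast
    qed
    show "F a = 0" if "a \<in> S" for a
    proof -
      have aV: "a \<in> V" using that assms by auto
      have "(\<lambda>k. ip a (z k)) \<longlonglongrightarrow> 0"
      proof (rule Lim_null_comparison)
        show "\<forall>\<^sub>F k in sequentially. norm (ip a (z k)) \<le> sqrt (sq a) * sqrt (e k)"
          using orth[OF that] by (intro always_eventually allI) (simp add: ip_cnj[OF zV aV])
        show "(\<lambda>k. sqrt (sq a) * sqrt (e k)) \<longlonglongrightarrow> 0" using tendsto_mult_left[OF e_lim(1)] by fastforce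
      qed
      then show ?thesis using F[OF aV] LIMSEQ_unique by blast
    qed
    show "F x \<noteq> 0"
    proof -
      \<comment> \<open>\<open>ip x (z k)\<close> is \<open>ip (s k) (z k)\<close> plus
        \<open>sq (z k)\<close>. The second tends to \<delta>; the first tends to 0 because the
        \<open>s k = x - z k\<close> are bounded, with this \<open>R\<close>.\<close>
      define R where "R = 2 * sq x + 2 * (\<delta> + 1)"
      have z_le: "sq (z k) \<le> \<delta> + 1" for k using s(2)[of k] e_pos[of k] by (simp add: z_def)
      have R: "sq (s k) \<le> R" for k
        using sq_diff_le[OF assms(5) zV, of k] z_le[of k] by (simp add: z_def R_def)
      have "(\<lambda>k. ip (s k) (z k)) \<longlonglongrightarrow> 0"
      proof (rule Lim_null_comparison)
        show "\<forall>\<^sub>F k in sequentially. norm (ip (s k) (z k)) \<le> sqrt R * sqrt (e k)"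
        proof (intro always_eventually allI)
          fix k
          have "norm (ip (s k) (z k)) \<le> sqrt (sq (s k)) * sqrt (e k)"
            using orth[OF s(1), of k k] by (simp add: ip_cnj[OF zV sV])
          also have "\<dots> \<le> sqrt R * sqrt (e k)"
            using R e_pos[of k] by (intro mult_right_mono) auto
          finally show "norm (ip (s k) (z k)) \<le> sqrt R * sqrt (e k)" .
        qed
        show "(\<lambda>k. sqrt R * sqrt (e k)) \<longlonglongrightarrow> 0" using tendsto_mult_left[OF e_lim(1)] by fastforce
      qed
      moreover have "(\<lambda>k. of_real (sq (z k)) :: complex) \<longlonglongrightarrow> of_real \<delta>"
      proof (intro tendsto_of_real)
        have "(\<lambda>k. \<delta> + e k) \<longlonglongrightarrow> \<delta> + 0" by (intro tendsto_intros e_lim)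
        moreover have "\<delta> \<le> sq (z k)" "sq (z k) \<le> \<delta> + e k" for k
          using s(2)[of k] \<delta>_le[OF s(1), of k] by (simp_all add: z_def)
        ultimately show "(\<lambda>k. sq (z k)) \<longlonglongrightarrow> \<delta>"
          using real_tendsto_sandwich[of "\<lambda>_. \<delta>" "\<lambda>k. sq (z k)" sequentially "\<lambda>k. \<delta> + e k" \<delta>] by simp
      qed
      ultimately have "(\<lambda>k. ip (s k) (z k) + of_real (sq (z k))) \<longlonglongrightarrow> 0 + of_real \<delta>"
        by (rule tendsto_add)
      moreover have "ip (s k) (z k) + of_real (sq (z k)) = ip x (z k)" for k
      proof -
        have "ip (z k) (z k) = ip x (z k) - ip (s k) (z k)"
          using ip_diff[OF assms(5) sV zV, of k k] by (simp add: z_def)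
        then show ?thesis using ip_self[OF zV, of k] by simp
      qed
      ultimately have "F x = of_real \<delta>" using F[OF assms(5)] LIMSEQ_unique by simp
      then show ?thesis using \<open>\<delta> \<ge> \<epsilon>\<close> \<open>\<epsilon> > 0\<close> by simp
    qed
    show "cmod (F a) \<le> sqrt (\<delta> + 1) * sqrt (sq a)" if "a \<in> V" for a
    proof (rule tendsto_upperbound[OF tendsto_norm[OF F[OF that]]])
      show "\<forall>\<^sub>F k in sequentially. norm (ip a (z k)) \<le> sqrt (\<delta> + 1) * sqrt (sq a)"
      proof (intro always_eventually allI)
        fix k
        have "norm (ip a (z k)) \<le> sqrt (sq a) * sqrt (sq (z k))" using that zV by (intro cauchy_schwarz)
        also have "\<dots> \<le> sqrt (sq a) * sqrt (\<delta> + 1)"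
          using s(2)[of k] e_pos[of k] sq_nonneg[OF that] by (intro mult_left_mono) (auto simp: z_def)
        finally show "norm (ip a (z k)) \<le> sqrt (\<delta> + 1) * sqrt (sq a)" by (simp add: mult.commute)
      qed
    qed simp
    show "sqrt (\<delta> + 1) \<ge> 0" using \<open>\<delta> \<ge> \<epsilon>\<close> \<open>\<epsilon> > 0\<close> by simp
  qed
qed

end

section \<open>Closure properties of the representatives of H(\<Omega>)\<close>

lemma Hol_subspace: "f \<in> Hol \<Omega> \<Longrightarrow> g \<in> Hol \<Omega> \<Longrightarrow> f + g \<in> Hol \<Omega>"
  "f \<in> Hol \<Omega> \<Longrightarrow> cscale c f \<in> Hol \<Omega>" "0 \<in> Hol \<Omega>"
  by (auto simp: Hol_def cscale_def plus_fun_def zero_fun_def intro!: holomorphic_intros)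

lemma Hol_minus: "f \<in> Hol \<Omega> \<Longrightarrow> g \<in> Hol \<Omega> \<Longrightarrow> f - g \<in> Hol \<Omega>"
  by (auto simp: Hol_def fun_diff_def intro!: holomorphic_intros)

lemma Hol_times: "f \<in> Hol \<Omega> \<Longrightarrow> g holomorphic_on \<Omega> \<Longrightarrow> (\<lambda>z. f z * g z) \<in> Hol \<Omega>"
  by (auto simp: Hol_def intro!: holomorphic_intros)

lemma Hol_holomorphic: "f \<in> Hol \<Omega> \<Longrightarrow> f holomorphic_on \<Omega>"
  by (simp add: Hol_def)

lemma Hol_sum: "(\<And>i. i \<in> I \<Longrightarrow> f i \<in> Hol \<Omega>) \<Longrightarrow> (\<lambda>z. \<Sum>i\<in>I. c i * f i z) \<in> Hol \<Omega>"
  by (auto simp: Hol_def intro!: holomorphic_intros)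

section \<open>Taylor coefficients on the disc\<close>

definition taylor :: "(complex \<Rightarrow> complex) \<Rightarrow> nat \<Rightarrow> complex" where
  "taylor H n = (deriv ^^ n) H 0 / fact n"

lemma taylor_sums:
  "H holomorphic_on ball 0 r \<Longrightarrow> cmod w < r \<Longrightarrow> (\<lambda>n. taylor H n * w ^ n) sums H w"
  using holomorphic_power_series[of H 0 r w] by (simp add: taylor_def)

lemma taylor_cong:
  assumes "H holomorphic_on ball 0 r" "r > 0" "\<And>w. cmod w < r \<Longrightarrow> H w = G w"
  shows "taylor H = taylor G"
proof -
  have "G holomorphic_on ball 0 r" using assms holomorphic_cong[of "ball 0 r" "ball 0 r" H G] by auto
  then show ?thesis
    unfolding taylor_def using assms
    by (auto simp: fun_eq_iff intro!: higher_deriv_transform_within_open[of H "ball 0 r" G])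
qed

lemma taylor_add:
  assumes "H holomorphic_on ball 0 r" "G holomorphic_on ball 0 r" "r > 0"
  shows "taylor (\<lambda>w. H w + G w) n = taylor H n + taylor G n"
  using higher_deriv_add[OF assms(1,2), of 0 n] assms(3) by (simp add: taylor_def add_divide_distrib)

lemma taylor_cmult:
  assumes "H holomorphic_on ball 0 r" "r > 0"
  shows "taylor (\<lambda>w. c * H w) n = c * taylor H n"
  using higher_deriv_cmult[OF assms(1), of 0 n c] assms(2) by (simp add: taylor_def)

lemma taylor_power: "taylor (\<lambda>w. w ^ n) m = (if m = n then 1 else 0)"
proof -
  have "(deriv ^^ m) (\<lambda>w::complex. w ^ n) 0 = pochhammer (of_nat (Suc n - m)) m * 0 ^ (n - m)"
    using higher_deriv_power[of m 0 n 0] by simp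
  also have "\<dots> = (if m = n then fact n else 0)"
    by (cases m n rule: linorder_cases) (auto simp: pochhammer_fact pochhammer_0_left)
  finally show ?thesis by (simp add: taylor_def)
qed

lemma taylor_bound:
  assumes "H holomorphic_on ball 0 r" "0 < s" "s < r"
  obtains M where "M \<ge> 0" "\<And>n. cmod (taylor H n) \<le> M / s ^ n"
proof -
  have sub: "cball 0 s \<subseteq> ball (0::complex) r" using assms by auto
  then have cont: "continuous_on (cball 0 s) H"
    using assms(1) holomorphic_on_imp_continuous_on holomorphic_on_subset by blast
  then have "compact (H ` cball 0 s)" by (intro compact_continuous_image) auto
  then obtain M where M: "M > 0" "\<And>x. x \<in> cball 0 s \<Longrightarrow> cmod (H x) \<le> M"
    using compact_imp_bounded bounded_pos by (metis imageI)
  have "norm ((deriv ^^ n) H 0) \<le> fact n * M / s ^ n" for n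
    using assms cont sub M by (intro Cauchy_inequality) (auto intro: holomorphic_on_subset)
  then have "cmod (taylor H n) \<le> M / s ^ n" for n
    by (simp add: taylor_def norm_divide field_simps)
  then show ?thesis using that[of M] M(1) by simp
qed

lemma taylor_uniform:
  assumes "H holomorphic_on ball 0 r" "0 \<le> s" "s < r" "\<epsilon> > 0"
  obtains N where "\<And>w. cmod w \<le> s \<Longrightarrow> cmod (H w - (\<Sum>n<N. taylor H n * w ^ n)) < \<epsilon>"
proof -
  define t where "t = (s + r) / 2"
  have t: "0 < t" "s < t" "t < r" using assms by (auto simp: t_def)
  obtain M where M: "M \<ge> 0" "\<And>n. cmod (taylor H n) \<le> M / t ^ n"
    using taylor_bound[OF assms(1) t(1,3)] by blast
  have "uniform_limit (cball 0 s) (\<lambda>n x. \<Sum>i<n. taylor H i * x ^ i) (\<lambda>x. \<Sum>i. taylor H i * x ^ i) sequentially"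
  proof (rule Weierstrass_m_test)
    show "norm (taylor H n * x ^ n) \<le> M * (s / t) ^ n" if "x \<in> cball 0 s" for n x
    proof -
      have "norm (taylor H n * x ^ n) \<le> (M / t ^ n) * s ^ n"
        unfolding norm_mult norm_power using that M t assms
        by (intro mult_mono power_mono) (auto simp: divide_nonneg_pos)
      then show ?thesis by (simp add: power_divide)
    qed
    show "summable (\<lambda>n. M * (s / t) ^ n)" using t assms by (intro summable_mult summable_geometric) auto
  qed
  then have "\<forall>\<^sub>F n in sequentially. \<forall>x\<in>cball 0 s.
      dist (\<Sum>i<n. taylor H i * x ^ i) (\<Sum>i. taylor H i * x ^ i) < \<epsilon>"
    using assms(4) by (rule uniform_limitD)
  then obtain N where N: "\<forall>x\<in>cball 0 s. dist (\<Sum>i<N. taylor H i * x ^ i) (\<Sum>i. taylor H i * x ^ i) < \<epsilon>"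
    by (auto simp: eventually_sequentially)
  show ?thesis
  proof
    fix w :: complex assume w: "cmod w \<le> s"
    then have "(\<Sum>i. taylor H i * w ^ i) = H w"
      using taylor_sums[OF assms(1), of w] assms(3) by (simp add: sums_iff)
    moreover have "w \<in> cball 0 s" using w by simp
    ultimately show "cmod (H w - (\<Sum>n<N. taylor H n * w ^ n)) < \<epsilon>"
      using N by (metis dist_norm norm_minus_commute)
  qed
qed

section \<open>Separation of closed subspaces of \<open>H(\<Omega>)\<close>\<close>

text \<open>A Riemann map with its inverse. In the coordinate w = \<phi>(z) elements of H(\<Omega>)
  are power series on the unit disc, and every compact subset of \<Omega> lies in some disc |w|
  \<le> r with r < 1.\<close>

locale disc_chart =
  fixes \<Omega> :: "complex set" and \<phi> \<psi> :: "complex \<Rightarrow> complex"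
  assumes open_dom: "open \<Omega>" and connected_dom: "connected \<Omega>"
    and \<phi>_hol: "\<phi> holomorphic_on \<Omega>" and \<psi>_hol: "\<psi> holomorphic_on ball 0 1"
    and \<phi>_in: "z \<in> \<Omega> \<Longrightarrow> cmod (\<phi> z) < 1" and \<psi>_\<phi>: "z \<in> \<Omega> \<Longrightarrow> \<psi> (\<phi> z) = z"
    and \<psi>_in: "cmod w < 1 \<Longrightarrow> \<psi> w \<in> \<Omega>" and \<phi>_\<psi>: "cmod w < 1 \<Longrightarrow> \<phi> (\<psi> w) = w"
begin

lemma comp_\<psi>_hol: "f holomorphic_on \<Omega> \<Longrightarrow> (\<lambda>w. f (\<psi> w)) holomorphic_on ball 0 1"
  using holomorphic_on_compose_gen[OF \<psi>_hol, of f \<Omega>] \<psi>_in by (auto simp: o_def image_subset_iff)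

definition monom_on :: "nat \<Rightarrow> complex \<Rightarrow> complex" where
  "monom_on n = (\<lambda>z. if z \<in> \<Omega> then \<phi> z ^ n else 0)"

lemma monom_on_Hol: "monom_on n \<in> Hol \<Omega>"
proof -
  have "(\<lambda>z. \<phi> z ^ n) holomorphic_on \<Omega>" by (intro holomorphic_intros \<phi>_hol)
  then have "monom_on n holomorphic_on \<Omega>"
    by (rule holomorphic_transform) (simp add: monom_on_def)
  then show ?thesis by (auto simp: Hol_def monom_on_def)
qed

lemma monom_on_\<psi>: "cmod w < 1 \<Longrightarrow> monom_on n (\<psi> w) = w ^ n"
  by (simp add: monom_on_def \<psi>_in \<phi>_\<psi>)

text \<open>Taylor polynomials in w become polynomials in \<phi>, which live on all of \<Omega>. The
  function to be approximated needs to be holomorphic only on a smaller disc, as is the case for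
  quotients by a function that may vanish near the boundary.\<close>

lemma runge:
  assumes "H holomorphic_on ball 0 r" "0 \<le> s" "s < r" "r \<le> 1" "\<epsilon> > 0"
  obtains q where "q \<in> Hol \<Omega>" "\<And>w. cmod w \<le> s \<Longrightarrow> cmod (H w - q (\<psi> w)) < \<epsilon>"
proof -
  obtain N where N: "\<And>w. cmod w \<le> s \<Longrightarrow> cmod (H w - (\<Sum>n<N. taylor H n * w ^ n)) < \<epsilon>"
    using taylor_uniform assms by metis
  show ?thesis
  proof
    show "(\<lambda>z. \<Sum>n<N. taylor H n * monom_on n z) \<in> Hol \<Omega>" by (intro Hol_sum monom_on_Hol)
    show "cmod (H w - (\<Sum>n<N. taylor H n * monom_on n (\<psi> w))) < \<epsilon>" if "cmod w \<le> s" for w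
      using N[OF that] that assms by (simp add: monom_on_\<psi>)
  qed
qed

definition coef :: "(complex \<Rightarrow> complex) \<Rightarrow> nat \<Rightarrow> complex" where
  "coef f = taylor (\<lambda>w. f (\<psi> w))"

lemma coef_sums: "f \<in> Hol \<Omega> \<Longrightarrow> cmod w < 1 \<Longrightarrow> (\<lambda>n. coef f n * w ^ n) sums f (\<psi> w)"
  unfolding coef_def by (rule taylor_sums[OF comp_\<psi>_hol]) (auto simp: Hol_def)

lemma coef_bound:
  assumes "f \<in> Hol \<Omega>" "0 < s" "s < 1"
  obtains M where "M \<ge> 0" "\<And>n. cmod (coef f n) \<le> M / s ^ n"
  using taylor_bound[OF comp_\<psi>_hol[OF Hol_holomorphic[OF assms(1)]] assms(2,3)] unfolding coef_def by metis

lemma coef_add: "f \<in> Hol \<Omega> \<Longrightarrow> g \<in> Hol \<Omega> \<Longrightarrow> coef (f + g) n = coef f n + coef g n"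
  unfolding coef_def plus_fun_apply by (rule taylor_add[of _ 1]) (auto intro: comp_\<psi>_hol Hol_holomorphic)

lemma coef_scale: "f \<in> Hol \<Omega> \<Longrightarrow> coef (cscale c f) n = c * coef f n"
  unfolding coef_def cscale_def by (rule taylor_cmult[of _ 1]) (auto intro: comp_\<psi>_hol Hol_holomorphic)

lemma coef_diff: "f \<in> Hol \<Omega> \<Longrightarrow> g \<in> Hol \<Omega> \<Longrightarrow> coef (f - g) n = coef f n - coef g n"
  using coef_add[of "f - g" g n] Hol_minus[of f \<Omega> g] by simp

lemma coef_monom: "coef (monom_on n) m = (if m = n then 1 else 0)"
proof -
  have "taylor (\<lambda>w. w ^ n) = taylor (\<lambda>w. monom_on n (\<psi> w))"
    by (rule taylor_cong[of _ 1]) (auto intro!: holomorphic_intros simp: monom_on_\<psi>)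
  then show ?thesis using taylor_power[of n m] by (simp add: coef_def)
qed

text \<open>The inner product of the Hardy space of the disc of radius \<rho>, that is, the mean of
  f times the conjugate of g over the circle |w| = \<rho>, written in Taylor coefficients.\<close>

definition ipr :: "real \<Rightarrow> (complex \<Rightarrow> complex) \<Rightarrow> (complex \<Rightarrow> complex) \<Rightarrow> complex" where
  "ipr \<rho> f g = (\<Sum>n. coef f n * cnj (coef g n) * of_real (\<rho> ^ (2 * n)))"

lemma ipr_summable:
  assumes "f \<in> Hol \<Omega>" "g \<in> Hol \<Omega>" "0 < \<rho>" "\<rho> < 1"
  shows "summable (\<lambda>n. norm (coef f n * cnj (coef g n) * of_real (\<rho> ^ (2 * n))))"
proof -
  define s where "s = (\<rho> + 1) / 2"
  have s: "0 < s" "\<rho> < s" "s < 1" using assms by (auto simp: s_def)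
  obtain M where M: "M \<ge> 0" "\<And>n. cmod (coef f n) \<le> M / s ^ n" using coef_bound[OF assms(1) s(1,3)] by blast
  obtain L where L: "L \<ge> 0" "\<And>n. cmod (coef g n) \<le> L / s ^ n" using coef_bound[OF assms(2) s(1,3)] by blast
  show ?thesis
  proof (rule summable_comparison_test')
    show "summable (\<lambda>n. M * L * ((\<rho> / s)\<^sup>2) ^ n)"
      using s assms by (intro summable_mult summable_geometric) (auto simp: abs_square_less_1)
    show "norm (norm (coef f n * cnj (coef g n) * of_real (\<rho> ^ (2 * n)))) \<le> M * L * ((\<rho> / s)\<^sup>2) ^ n" for n
    proof -
      have "norm (coef f n * cnj (coef g n) * of_real (\<rho> ^ (2 * n))) \<le> (M / s ^ n) * (L / s ^ n) * \<rho> ^ (2 * n)"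
        unfolding norm_mult using M L assms s by (intro mult_mono) (auto simp: norm_power)
      also have "\<dots> = M * L * ((\<rho> / s)\<^sup>2) ^ n"
        by (simp add: power_mult power_divide power2_eq_square power_mult_distrib)
      finally show ?thesis by simp
    qed
  qed
qed

lemma ipr_sums:
  assumes "f \<in> Hol \<Omega>" "g \<in> Hol \<Omega>" "0 < \<rho>" "\<rho> < 1"
  shows "(\<lambda>n. coef f n * cnj (coef g n) * of_real (\<rho> ^ (2 * n))) sums ipr \<rho> f g"
  unfolding ipr_def using summable_norm_cancel[OF ipr_summable[OF assms]] by (rule summable_sums)

lemma ipr_self_sums:
  assumes "f \<in> Hol \<Omega>" "0 < \<rho>" "\<rho> < 1"
  shows "(\<lambda>n. (cmod (coef f n) * \<rho> ^ n)\<^sup>2) sums Re (ipr \<rho> f f)"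
proof -
  have "Re (coef f n * cnj (coef f n) * of_real (\<rho> ^ (2 * n))) = (cmod (coef f n) * \<rho> ^ n)\<^sup>2" for n
    by (simp add: power_mult_distrib flip: complex_norm_square power_mult of_real_power of_real_mult)
      (simp add: mult.commute)
  then show ?thesis using sums_Re[OF ipr_sums[OF assms(1) assms]] by simp
qed

lemma semi_inner_ipr:
  assumes "0 < \<rho>" "\<rho> < 1"
  shows "semi_inner (Hol \<Omega>) cscale (ipr \<rho>)"
proof
  fix a b c :: "complex \<Rightarrow> complex" and k :: complex
  show "cscale (- k) a = - cscale k a" "cscale 1 a = a" by (auto simp: cscale_def)
  show "a + b \<in> Hol \<Omega>" if "a \<in> Hol \<Omega>" "b \<in> Hol \<Omega>" using that by (rule Hol_subspace)
  show "cscale k a \<in> Hol \<Omega>" if "a \<in> Hol \<Omega>" using that by (rule Hol_subspace)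
  show "ipr \<rho> (a + b) c = ipr \<rho> a c + ipr \<rho> b c" if "a \<in> Hol \<Omega>" "b \<in> Hol \<Omega>" "c \<in> Hol \<Omega>"
  proof -
    have "(\<lambda>n. coef (a + b) n * cnj (coef c n) * of_real (\<rho> ^ (2 * n))) sums (ipr \<rho> a c + ipr \<rho> b c)"
      using sums_add[OF ipr_sums[OF that(1,3) assms] ipr_sums[OF that(2,3) assms]] that
      by (simp add: coef_add ring_distribs)
    then show ?thesis
      using sums_unique2[OF ipr_sums[OF Hol_subspace(1)[OF that(1,2)] that(3) assms]] by simp
  qed
  show "ipr \<rho> (cscale k a) b = k * ipr \<rho> a b" if "a \<in> Hol \<Omega>" "b \<in> Hol \<Omega>"
  proof -
    have "(\<lambda>n. coef (cscale k a) n * cnj (coef b n) * of_real (\<rho> ^ (2 * n))) sums (k * ipr \<rho> a b)"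
      using sums_mult[OF ipr_sums[OF that assms], of k] that by (simp add: coef_scale mult.assoc)
    then show ?thesis
      using sums_unique2[OF ipr_sums[OF Hol_subspace(2)[OF that(1)] that(2) assms]] by simp
  qed
  show "ipr \<rho> b a = cnj (ipr \<rho> a b)" if "a \<in> Hol \<Omega>" "b \<in> Hol \<Omega>"
  proof -
    have "(\<lambda>n. cnj (coef a n * cnj (coef b n) * of_real (\<rho> ^ (2 * n)))) sums cnj (ipr \<rho> a b)"
      using ipr_sums[OF that assms] by (subst sums_cnj)
    then show ?thesis
      using sums_unique2[OF ipr_sums[OF that(2,1) assms]] by (simp add: mult_ac)
  qed
  show "0 \<le> Re (ipr \<rho> a a)" if "a \<in> Hol \<Omega>"
    using ipr_self_sums[OF that assms] suminf_nonneg[of "\<lambda>n. (cmod (coef a n) * \<rho> ^ n)\<^sup>2"]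
    by (simp add: sums_iff)
qed


lemma coef_le_norm:
  assumes "f \<in> Hol \<Omega>" "0 < \<rho>" "\<rho> < 1"
  shows "cmod (coef f n) * \<rho> ^ n \<le> sqrt (Re (ipr \<rho> f f))"
proof -
  have "(cmod (coef f n) * \<rho> ^ n)\<^sup>2 \<le> Re (ipr \<rho> f f)"
    using sum_le_suminf[of "\<lambda>n. (cmod (coef f n) * \<rho> ^ n)\<^sup>2" "{n}"] ipr_self_sums[OF assms]
    by (simp add: sums_iff)
  then show ?thesis by (rule real_le_rsqrt)
qed

text \<open>Each coefficient is at most the norm divided by \<rho>^n, so on |w| \<le> r the series
  is dominated by a geometric one. Hence the Hardy norm of radius \<rho> controls compact
  convergence on smaller discs.\<close>

lemma sup_le_norm:
  assumes "f \<in> Hol \<Omega>" "0 < \<rho>" "\<rho> < 1" "0 \<le> r" "r < \<rho>" "cmod w \<le> r"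
  shows "cmod (f (\<psi> w)) \<le> sqrt (Re (ipr \<rho> f f)) / (1 - r / \<rho>)"
proof -
  define P where "P = sqrt (Re (ipr \<rho> f f))"
  have "P \<ge> 0"
    using order_trans[OF norm_ge_zero[of "coef f 0"], of P] coef_le_norm[OF assms(1-3), of 0] by (simp add: P_def)
  have geo: "(\<lambda>n. P * (r / \<rho>) ^ n) sums (P * (1 / (1 - r / \<rho>)))"
    using assms by (intro sums_mult geometric_sums) auto
  have "norm (coef f n * w ^ n) \<le> P * (r / \<rho>) ^ n" for n
  proof -
    have "norm (coef f n * w ^ n) \<le> (P / \<rho> ^ n) * r ^ n"
      unfolding norm_mult norm_power using coef_le_norm[OF assms(1-3), of n] assms \<open>P \<ge> 0\<close>
      by (intro mult_mono power_mono) (auto simp: P_def field_simps)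
    then show ?thesis by (simp add: power_divide)
  qed
  then have "norm (\<Sum>n. coef f n * w ^ n) \<le> (\<Sum>n. P * (r / \<rho>) ^ n)"
    using geo by (intro norm_suminf_le) (auto simp: sums_iff)
  then show ?thesis
    using coef_sums[OF assms(1), of w] assms geo by (simp add: sums_iff P_def)
qed

text \<open>The tail of the power series, produced by subtracting one monomial at a time, so that a
  functional known only to be linear can be followed along the recursion.\<close>

primrec remainder :: "(complex \<Rightarrow> complex) \<Rightarrow> nat \<Rightarrow> (complex \<Rightarrow> complex)" where
  "remainder f 0 = f"
| "remainder f (Suc N) = remainder f N - cscale (coef f N) (monom_on N)"

lemma remainder_Hol: "f \<in> Hol \<Omega> \<Longrightarrow> remainder f N \<in> Hol \<Omega>"
  by (induction N) (auto intro!: Hol_minus Hol_subspace(2) monom_on_Hol)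

lemma coef_remainder: "f \<in> Hol \<Omega> \<Longrightarrow> coef (remainder f N) n = (if n < N then 0 else coef f n)"
  by (induction N)
    (auto simp: coef_diff coef_scale coef_monom remainder_Hol monom_on_Hol Hol_subspace less_Suc_eq)

lemma norm_remainder_tendsto:
  assumes "f \<in> Hol \<Omega>" "0 < \<rho>" "\<rho> < 1"
  shows "(\<lambda>N. Re (ipr \<rho> (remainder f N) (remainder f N))) \<longlonglongrightarrow> 0"
proof -
  define a where "a = (\<lambda>n. (cmod (coef f n) * \<rho> ^ n)\<^sup>2)"
  define q where "q = (\<lambda>N. Re (ipr \<rho> (remainder f N) (remainder f N)))"
  have a: "a sums Re (ipr \<rho> f f)" using ipr_self_sums[OF assms] by (simp add: a_def)
  have "Re (ipr \<rho> f f) - (\<Sum>n<N. a n) = q N" for N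
  proof -
    have "(\<lambda>n. if n < N then 0 else a n) sums q N"
    proof -
      have "(cmod (coef (remainder f N) n) * \<rho> ^ n)\<^sup>2 = (if n < N then 0 else a n)" for n
        by (simp add: a_def coef_remainder[OF assms(1)])
      then show ?thesis
        using ipr_self_sums[OF remainder_Hol[OF assms(1)] assms(2,3), of N] by (simp add: q_def)
    qed
    moreover have "(\<lambda>n. if n \<in> {..<N} then a n else 0) sums (\<Sum>n<N. a n)"
      by (rule sums_If_finite_set) simp
    ultimately have "(\<lambda>n. (if n < N then 0 else a n) + (if n \<in> {..<N} then a n else 0)) sums (q N + (\<Sum>n<N. a n))"
      by (rule sums_add)
    moreover have "(if n < N then 0 else a n) + (if n \<in> {..<N} then a n else 0) = a n" for n by simp
    ultimately have "a sums (q N + (\<Sum>n<N. a n))" by simp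
    then show ?thesis using sums_unique2[OF a] by simp
  qed
  moreover have "(\<lambda>N. Re (ipr \<rho> f f) - (\<Sum>n<N. a n)) \<longlonglongrightarrow> Re (ipr \<rho> f f) - Re (ipr \<rho> f f)"
    using a unfolding sums_def by (intro tendsto_intros)
  ultimately show ?thesis by (simp add: q_def)
qed

lemma compact_subset_disc:
  assumes "compact K" "K \<subseteq> \<Omega>"
  obtains r where "0 \<le> r" "r < 1" "\<And>z. z \<in> K \<Longrightarrow> cmod (\<phi> z) \<le> r"
proof (cases "K = {}")
  case True
  then show ?thesis using that[of 0] by auto
next
  case False
  have "continuous_on K (\<lambda>z. cmod (\<phi> z))"
    using assms(2) \<phi>_hol by (intro continuous_intros) (meson holomorphic_on_imp_continuous_on continuous_on_subset)
  then obtain z where z: "z \<in> K" "\<And>y. y \<in> K \<Longrightarrow> cmod (\<phi> y) \<le> cmod (\<phi> z)"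
    using continuous_attains_sup[OF assms(1) False] by blast
  show ?thesis using that[of "cmod (\<phi> z)"] z \<phi>_in assms(2) by auto
qed

text \<open>Some supremum neighbourhood of x avoids \<open>S\<close>, hence x has positive distance
  from \<open>S\<close> in a Hardy norm. The resulting functional is bounded in that norm, so it is
  determined by its values \<open>b n\<close> on the monomials in \<phi>, whose norms are
  \<rho>^n.\<close>

lemma separate_point:
  assumes "closedin (Hol_topology \<Omega>) S" "S \<subseteq> Hol \<Omega>" "cfun.subspace S" "x \<in> Hol \<Omega>" "x \<notin> S"
  obtains \<rho> b C L where "0 < \<rho>" "\<rho> < 1" "C \<ge> 0" "\<And>n. cmod (b n) \<le> C * \<rho> ^ n"
    "\<And>s. s \<in> S \<Longrightarrow> (\<lambda>n. coef s n * b n) sums 0" "L \<noteq> 0" "(\<lambda>n. coef x n * b n) sums L"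
proof -
  have "openin (Hol_topology \<Omega>) (Hol \<Omega> - S)"
    using assms(1) unfolding closedin_def topspace_Hol_topology by auto
  then obtain K \<epsilon> where K: "compact K" "K \<subseteq> \<Omega>" "\<epsilon> > 0" "compact_nbhd \<Omega> x K \<epsilon> \<subseteq> Hol \<Omega> - S"
    using assms(4,5) unfolding openin_Hol_topology by blast
  obtain r where r: "0 \<le> r" "r < 1" "\<And>z. z \<in> K \<Longrightarrow> cmod (\<phi> z) \<le> r"
    using compact_subset_disc[OF K(1,2)] by blast
  define \<rho> where "\<rho> = (r + 1) / 2"
  have \<rho>: "0 < \<rho>" "\<rho> < 1" "r < \<rho>" using r by (auto simp: \<rho>_def)
  interpret semi_inner "Hol \<Omega>" cscale "ipr \<rho>" by (rule semi_inner_ipr[OF \<rho>(1,2)])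
  define c where "c = 1 - r / \<rho>"
  have "c > 0" using \<rho> r by (simp add: c_def)
  \<comment> \<open>Every s in \<open>S\<close> is off by at least \<epsilon> at some point of
    \<open>K\<close>; \<open>c\<close> is the inverse of the constant in \<open>sup_le_norm\<close>,
    so the norm of x - s is at least \<epsilon> c.\<close>
  have far: "(\<epsilon> * c)\<^sup>2 \<le> sq (x - s)" if "s \<in> S" for s
  proof -
    have "s \<in> Hol \<Omega>" using that assms(2) by auto
    moreover have "s \<notin> compact_nbhd \<Omega> x K \<epsilon>" using that K by auto
    ultimately obtain z where z: "z \<in> K" "\<epsilon> \<le> cmod (x z - s z)"
      by (auto simp: compact_nbhd_def dist_norm norm_minus_commute not_less)
    have xs: "x - s \<in> Hol \<Omega>" using assms(4) \<open>s \<in> Hol \<Omega>\<close> by (rule Hol_minus)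
    have "cmod ((x - s) (\<psi> (\<phi> z))) \<le> sqrt (sq (x - s)) / c"
      unfolding sq_def c_def using sup_le_norm[OF xs \<rho>(1,2) r(1) \<rho>(3) r(3)[OF z(1)]] .
    moreover have "\<psi> (\<phi> z) = z" using \<psi>_\<phi> z K by blast
    ultimately have "\<epsilon> \<le> sqrt (sq (x - s)) / c" using z(2) by simp
    then have "\<epsilon> * c \<le> sqrt (sq (x - s))"
      using \<open>c > 0\<close> by (simp add: pos_le_divide_eq)
    then have "(\<epsilon> * c)\<^sup>2 \<le> (sqrt (sq (x - s)))\<^sup>2"
      using K(3) \<open>c > 0\<close> by (intro power_mono) auto
    then show ?thesis using sq_nonneg[OF xs] by simp
  qed
  have pos: "(\<epsilon> * c)\<^sup>2 > 0" using K(3) \<open>c > 0\<close> by simp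
  have "S \<noteq> {}" using cfun.subspace_0[OF assms(3)] by blast
  obtain F C where F: "\<And>a b. a \<in> Hol \<Omega> \<Longrightarrow> b \<in> Hol \<Omega> \<Longrightarrow> F (a + b) = F a + F b"
    "\<And>k a. a \<in> Hol \<Omega> \<Longrightarrow> F (cscale k a) = k * F a" "\<And>s. s \<in> S \<Longrightarrow> F s = 0" "F x \<noteq> 0"
    "\<And>a. a \<in> Hol \<Omega> \<Longrightarrow> cmod (F a) \<le> C * sqrt (sq a)" "C \<ge> 0"
    using separating_functional[OF assms(2) \<open>S \<noteq> {}\<close> cfun.subspace_add[OF assms(3)]
        cfun.subspace_scale[OF assms(3)] assms(4) pos far] by blast
  have F_diff: "F (f - g) = F f - F g" if "f \<in> Hol \<Omega>" "g \<in> Hol \<Omega>" for f g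
    using F(1)[OF Hol_minus[OF that] that(2)] by simp
  define b where "b = (\<lambda>n. F (monom_on n))"
  have split: "F f = (\<Sum>n<N. coef f n * b n) + F (remainder f N)" if "f \<in> Hol \<Omega>" for f N
  proof (induction N)
    case (Suc N)
    have "F (remainder f (Suc N)) = F (remainder f N) - coef f N * b N"
      unfolding remainder.simps b_def
      using F_diff[OF remainder_Hol[OF that] Hol_subspace(2)[OF monom_on_Hol]] F(2)[OF monom_on_Hol] by simp
    with Suc show ?case by (simp del: remainder.simps)
  qed simp
  have sums: "(\<lambda>n. coef f n * b n) sums F f" if "f \<in> Hol \<Omega>" for f
  proof -
    have "(\<lambda>N. F (remainder f N)) \<longlonglongrightarrow> 0"
    proof (rule Lim_null_comparison)
      show "\<forall>\<^sub>F N in sequentially. norm (F (remainder f N)) \<le> C * sqrt (sq (remainder f N))"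
        using F(5) remainder_Hol[OF that] by (intro always_eventually allI) auto
      have "(\<lambda>N. C * sqrt (sq (remainder f N))) \<longlonglongrightarrow> C * sqrt 0"
        unfolding sq_def using norm_remainder_tendsto[OF that \<rho>(1,2)] by (intro tendsto_intros)
      then show "(\<lambda>N. C * sqrt (sq (remainder f N))) \<longlonglongrightarrow> 0" by simp
    qed
    then have "(\<lambda>N. F f - F (remainder f N)) \<longlonglongrightarrow> F f - 0" by (intro tendsto_intros)
    moreover have "F f - F (remainder f N) = (\<Sum>n<N. coef f n * b n)" for N
      using split[OF that, of N] by simp
    ultimately show ?thesis unfolding sums_def by simp
  qed
  have sq_monom: "sqrt (sq (monom_on n)) = \<rho> ^ n" for n
  proof -
    have "(\<lambda>m. (cmod (coef (monom_on n) m) * \<rho> ^ m)\<^sup>2) = (\<lambda>m. if m = n then (\<rho> ^ n)\<^sup>2 else 0)"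
      by (auto simp: coef_monom)
    then have "sq (monom_on n) = (\<rho> ^ n)\<^sup>2"
      using sums_unique2[OF ipr_self_sums[OF monom_on_Hol \<rho>(1,2), of n]] sums_single[of n "\<lambda>_. (\<rho> ^ n)\<^sup>2"]
      by (simp add: sq_def)
    then show ?thesis using \<rho> by simp
  qed
  show ?thesis
  proof
    show "cmod (b n) \<le> C * \<rho> ^ n" for n
      using F(5)[OF monom_on_Hol, of n] by (simp add: b_def sq_monom)
    show "(\<lambda>n. coef s n * b n) sums 0" if "s \<in> S" for s
      using sums[of s] F(3)[OF that] that assms(2) by auto
  qed (use \<rho> F sums[OF assms(4)] in auto)
qed

text \<open>
  \<open>\<Sum>n. coef f n * b n\<close> is, up to \<open>2 pi i\<close>, the integral of \<open>f \<circ> \<psi>\<close> against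
  \<open>\<Sum>n. b n / w ^ Suc n\<close> over every circle on which the latter converges.
\<close>

lemma contour_representation:
  assumes "0 < \<rho>" "C \<ge> 0" "\<And>n. cmod (b n) \<le> C * \<rho> ^ n"
  obtains \<kappa> where "\<And>\<tau>. \<rho> < \<tau> \<Longrightarrow> continuous_on (sphere 0 \<tau>) \<kappa>"
    "\<And>\<tau> f L. \<rho> < \<tau> \<Longrightarrow> \<tau> < 1 \<Longrightarrow> f \<in> Hol \<Omega> \<Longrightarrow> (\<lambda>n. coef f n * b n) sums L \<Longrightarrow>
       contour_integral (circlepath 0 \<tau>) (\<lambda>w. f (\<psi> w) * \<kappa> w) = 2 * pi * \<i> * L"
proof -
  define \<kappa> where "\<kappa> = (\<lambda>w. \<Sum>n. b n / w ^ Suc n)"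
  have unif: "uniform_limit (sphere 0 \<tau>) (\<lambda>N w. \<Sum>n<N. b n / w ^ Suc n) \<kappa> sequentially" if "\<rho> < \<tau>" for \<tau>
    unfolding \<kappa>_def
  proof (rule Weierstrass_m_test)
    show "norm (b n / w ^ Suc n) \<le> C / \<tau> * (\<rho> / \<tau>) ^ n" if "w \<in> sphere 0 \<tau>" for n w
    proof -
      have "norm (b n / w ^ Suc n) \<le> C * \<rho> ^ n / \<tau> ^ Suc n"
        unfolding norm_divide norm_power using that assms \<open>\<rho> < \<tau>\<close> by (auto intro!: divide_right_mono)
      then show ?thesis by (simp add: power_divide)
    qed
    show "summable (\<lambda>n. C / \<tau> * (\<rho> / \<tau>) ^ n)"
      using that assms by (intro summable_mult summable_geometric) auto
  qed
  have cont: "continuous_on (sphere 0 \<tau>) (\<lambda>w. b n / w ^ Suc n)" if "\<rho> < \<tau>" for n \<tau>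
    using that assms by (intro continuous_intros) auto
  show ?thesis
  proof
    show "continuous_on (sphere 0 \<tau>) \<kappa>" if "\<rho> < \<tau>" for \<tau>
      using cont[OF that] by (intro uniform_limit_theorem[OF _ unif[OF that]] always_eventually allI continuous_on_sum) auto
    fix \<tau> f L
    assume \<tau>: "\<rho> < \<tau>" "\<tau> < 1" and f: "f \<in> Hol \<Omega>" and L: "(\<lambda>n. coef f n * b n) sums L"
    have hol: "(\<lambda>w. f (\<psi> w)) holomorphic_on ball 0 1" using f by (intro comp_\<psi>_hol Hol_holomorphic)
    have sub: "cball 0 \<tau> \<subseteq> ball (0::complex) 1" using \<tau> by auto
    have contf: "continuous_on (cball 0 \<tau>) (\<lambda>w. f (\<psi> w))"
      using hol sub holomorphic_on_imp_continuous_on continuous_on_subset by blast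
    have tm: "((\<lambda>w. f (\<psi> w) * (b n / w ^ Suc n)) has_contour_integral (2 * pi * \<i> * (coef f n * b n))) (circlepath 0 \<tau>)" for n
    proof -
      have "((\<lambda>u. f (\<psi> u) / (u - 0) ^ Suc n) has_contour_integral
         (2 * pi * \<i> / fact n * (deriv ^^ n) (\<lambda>w. f (\<psi> w)) 0)) (circlepath 0 \<tau>)"
        using contf hol sub \<tau> assms(1)
        by (intro Cauchy_has_contour_integral_higher_derivative_circlepath) (auto intro: holomorphic_on_subset)
      from has_contour_integral_lmul[OF this, of "b n"] show ?thesis
        by (simp add: coef_def taylor_def mult_ac)
    qed
    have ul: "uniform_limit (sphere 0 \<tau>) (\<lambda>N w. f (\<psi> w) * (\<Sum>n<N. b n / w ^ Suc n)) (\<lambda>w. f (\<psi> w) * \<kappa> w) sequentially"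
    proof (rule uniform_lim_mult[OF uniform_limit_const unif[OF \<tau>(1)]])
      show "bounded ((\<lambda>w. f (\<psi> w)) ` sphere 0 \<tau>)"
        using contf by (intro compact_imp_bounded compact_continuous_image) (auto intro: continuous_on_subset)
      have "continuous_on (sphere 0 \<tau>) \<kappa>"
        using cont[OF \<tau>(1)] by (intro uniform_limit_theorem[OF _ unif[OF \<tau>(1)]] always_eventually allI continuous_on_sum) auto
      then show "bounded (\<kappa> ` sphere 0 \<tau>)" by (intro compact_imp_bounded compact_continuous_image) auto
    qed
    have part: "((\<lambda>w. f (\<psi> w) * (\<Sum>n<N. b n / w ^ Suc n)) has_contour_integral
        (\<Sum>n<N. 2 * pi * \<i> * (coef f n * b n))) (circlepath 0 \<tau>)" for N
      unfolding sum_distrib_left by (intro has_contour_integral_sum tm) auto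
    have "(\<lambda>N. contour_integral (circlepath 0 \<tau>) (\<lambda>w. f (\<psi> w) * (\<Sum>n<N. b n / w ^ Suc n)))
       \<longlonglongrightarrow> contour_integral (circlepath 0 \<tau>) (\<lambda>w. f (\<psi> w) * \<kappa> w)"
      using part \<tau> assms(1)
      by (intro contour_integral_uniform_limit_circlepath(2)[OF _ ul] always_eventually allI)
        (auto simp: contour_integrable_on_def)
    moreover have "(\<lambda>N. \<Sum>n<N. 2 * pi * \<i> * (coef f n * b n)) \<longlonglongrightarrow> 2 * pi * \<i> * L"
      using sums_mult[OF L, of "2 * pi * \<i>"] by (simp add: sums_def)
    ultimately show "contour_integral (circlepath 0 \<tau>) (\<lambda>w. f (\<psi> w) * \<kappa> w) = 2 * pi * \<i> * L"
      using contour_integral_unique[OF part] LIMSEQ_unique by simp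
  qed
qed

end

section \<open>Cauchy transforms\<close>

text \<open>The Cauchy transform of the measure \<open>k w\<close> dw carried to the curve P(|w| =
  \<tau>). Integrating in w avoids any discussion of the image curve or of its winding
  numbers.\<close>

definition cauchy_tr :: "real \<Rightarrow> (complex \<Rightarrow> complex) \<Rightarrow> (complex \<Rightarrow> complex) \<Rightarrow> complex \<Rightarrow> complex" where
  "cauchy_tr \<tau> P k z = contour_integral (circlepath 0 \<tau>) (\<lambda>w. k w / (P w - z))"

lemma cauchy_tr_holomorphic:
  assumes "\<tau> > 0" "continuous_on (sphere 0 \<tau>) k" "continuous_on (sphere 0 \<tau>) P"
    and "open U" "U \<inter> P ` sphere 0 \<tau> = {}"
  shows "cauchy_tr \<tau> P k holomorphic_on U"
proof (rule holomorphic_onI)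
  fix z assume "z \<in> U"
  then obtain e where e: "e > 0" "ball z e \<subseteq> U" using assms(4) openE by blast
  define c where "c = circlepath 0 \<tau>"
  have "path_image c = sphere 0 \<tau>"
    unfolding c_def using assms(1) by (intro path_image_circlepath_nonneg) simp
  then have c2: "c t \<in> sphere 0 \<tau>" if "t \<in> {0..1}" for t
    using that by (metis imageI path_image_def)
  have "continuous_on {0..1} c"
    unfolding c_def path_def[symmetric] by (rule path_circlepath)
  note c = this c2
  have kc: "continuous_on {0..1} (\<lambda>t. k (c t))" and Pc: "continuous_on {0..1} (\<lambda>t. P (c t))"
    using continuous_on_compose2[OF assms(2) c(1)] continuous_on_compose2[OF assms(3) c(1)] c2 by blast+
  \<comment> \<open>The velocity of \<open>circlepath\<close>: it turns the contour integral into an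
    ordinary one, where differentiation under the integral sign applies.\<close>
  define d where "d = (\<lambda>t. 2 * pi * \<i> * \<tau> * exp (2 * of_real pi * \<i> * of_real t) :: complex)"
  have dcont: "continuous_on A d" for A unfolding d_def by (intro continuous_intros)
  have ne: "P (c t) - x \<noteq> 0" if "x \<in> ball z e" "t \<in> {0..1}" for x t
  proof
    assume "P (c t) - x = 0"
    then have "x \<in> P ` sphere 0 \<tau>" using c2[OF that(2)] by force
    with that(1) e(2) assms(5) show False by blast
  qed
  have eq: "cauchy_tr \<tau> P k x = integral (cbox 0 1) (\<lambda>t. k (c t) / (P (c t) - x) * d t)" for x
    unfolding cauchy_tr_def contour_integral_integral vector_derivative_circlepath
    by (simp add: c_def d_def mult_ac)
  have "(\<lambda>x. integral (cbox 0 1) (\<lambda>t. k (c t) / (P (c t) - x) * d t)) holomorphic_on ball z e"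
  proof (rule leibniz_rule_holomorphic[where fx = "\<lambda>x t. k (c t) / (P (c t) - x)\<^sup>2 * d t"])
    show "((\<lambda>x. k (c t) / (P (c t) - x) * d t) has_field_derivative
        k (c t) / (P (c t) - x)\<^sup>2 * d t) (at x within ball z e)"
      if "x \<in> ball z e" "t \<in> cbox 0 1" for x t
      using ne[OF that(1), of t] that(2)
      by (auto intro!: derivative_eq_intros simp: power2_eq_square)
    show "(\<lambda>t. k (c t) / (P (c t) - x) * d t) integrable_on cbox 0 1" if "x \<in> ball z e" for x
      using ne[OF that] kc Pc dcont by (intro integrable_continuous continuous_intros) auto
    have f: "continuous_on (ball z e \<times> {0..1}) (\<lambda>y. k (c (snd y)))"
      "continuous_on (ball z e \<times> {0..1}) (\<lambda>y. P (c (snd y)))"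
      by (rule continuous_on_compose2[OF kc continuous_on_snd[OF continuous_on_id]]
          continuous_on_compose2[OF Pc continuous_on_snd[OF continuous_on_id]], force)+
    have "continuous_on (ball z e \<times> {0..1}) (\<lambda>y. d (snd y))"
      by (rule continuous_on_compose2[OF dcont[of UNIV] continuous_on_snd[OF continuous_on_id]]) simp
    then show "continuous_on (ball z e \<times> cbox 0 1) (\<lambda>(x, t). k (c t) / (P (c t) - x)\<^sup>2 * d t)"
      unfolding case_prod_unfold using f ne by (auto intro!: continuous_intros)
  qed auto
  then have "cauchy_tr \<tau> P k holomorphic_on ball z e" by (simp add: eq[abs_def] fun_eq_iff)
  then show "cauchy_tr \<tau> P k field_differentiable at z within U"
    using e(1) by (metis centre_in_ball field_differentiable_at_within holomorphic_on_imp_differentiable_at open_ball)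
qed

lemma cauchy_tr_integrable:
  assumes "\<tau> > 0" "continuous_on (sphere 0 \<tau>) k" "continuous_on (sphere 0 \<tau>) P" "z \<notin> P ` sphere 0 \<tau>"
  shows "(\<lambda>w. k w / (P w - z)) contour_integrable_on circlepath 0 \<tau>"
  using assms by (intro contour_integrable_continuous_circlepath continuous_intros) auto

lemma cauchy_tr_tendsto_0:
  assumes "\<tau> > 0" "continuous_on (sphere 0 \<tau>) k" "continuous_on (sphere 0 \<tau>) P"
  shows "(cauchy_tr \<tau> P k \<longlongrightarrow> 0) at_infinity"
proof -
  have "bounded (k ` sphere 0 \<tau>)" "bounded (P ` sphere 0 \<tau>)"
    using assms by (auto intro!: compact_imp_bounded compact_continuous_image)
  then obtain M R where M: "M > 0" "\<And>w. w \<in> sphere 0 \<tau> \<Longrightarrow> cmod (k w) \<le> M"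
    and R: "R > 0" "\<And>w. w \<in> sphere 0 \<tau> \<Longrightarrow> cmod (P w) \<le> R"
    unfolding bounded_pos by auto
  have bound: "cmod (cauchy_tr \<tau> P k z) \<le> M / (cmod z - R) * (2 * pi * \<tau>)" if "cmod z > R" for z
  proof (rule has_contour_integral_bound_circlepath)
    have "z \<notin> P ` sphere 0 \<tau>" using R(2) that by force
    then show "((\<lambda>w. k w / (P w - z)) has_contour_integral cauchy_tr \<tau> P k z) (circlepath 0 \<tau>)"
      unfolding cauchy_tr_def using cauchy_tr_integrable[OF assms] by (simp add: has_contour_integral_integral)
    fix w assume "cmod (w - 0) = \<tau>"
    then have w: "w \<in> sphere 0 \<tau>" by simp
    have "cmod z - R \<le> cmod (P w - z)"
      using R(2)[OF w] norm_triangle_ineq2[of z "P w"] by (simp add: norm_minus_commute)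
    then show "cmod (k w / (P w - z)) \<le> M / (cmod z - R)"
      unfolding norm_divide using M(2)[OF w] M(1) that by (intro frac_le) auto
  qed (use M that assms in auto)
  have "((\<lambda>z. M / (cmod z - R) * (2 * pi * \<tau>)) \<longlongrightarrow> 0 * (2 * pi * \<tau>)) at_infinity"
  proof (intro tendsto_mult tendsto_const real_tendsto_divide_at_top[OF tendsto_const])
    show "LIM z at_infinity. cmod z - R :> at_top"
      using filterlim_tendsto_add_at_top[OF tendsto_const[of "-R"] filterlim_norm_at_top] by simp
  qed
  then have "((\<lambda>z. M / (cmod z - R) * (2 * pi * \<tau>)) \<longlongrightarrow> 0) at_infinity" by simp
  moreover have "\<forall>\<^sub>F z in at_infinity. norm (cauchy_tr \<tau> P k z) \<le> M / (cmod z - R) * (2 * pi * \<tau>)"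
    unfolding eventually_at_infinity
  proof (intro exI[of _ "R + 1"] allI impI)
    fix z :: complex assume "R + 1 \<le> norm z"
    then have "cmod z > R" by simp
    then show "norm (cauchy_tr \<tau> P k z) \<le> M / (cmod z - R) * (2 * pi * \<tau>)" by (rule bound)
  qed
  ultimately show ?thesis by (rule Lim_null_comparison[rotated])
qed

context disc_chart
begin

definition disc :: "real \<Rightarrow> complex set" where "disc \<tau> = \<psi> ` cball 0 \<tau>"

lemma mem_disc: "\<tau> < 1 \<Longrightarrow> z \<in> disc \<tau> \<longleftrightarrow> z \<in> \<Omega> \<and> cmod (\<phi> z) \<le> \<tau>"
  unfolding disc_def using \<psi>_in \<phi>_\<psi> \<psi>_\<phi> by (auto simp: image_iff) (metis mem_cball_0)

lemma \<psi>_cont: "A \<subseteq> ball 0 1 \<Longrightarrow> continuous_on A \<psi>"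
  using \<psi>_hol holomorphic_on_imp_continuous_on continuous_on_subset by blast

lemma \<psi>_cont_sphere: "\<tau> < 1 \<Longrightarrow> continuous_on (sphere 0 \<tau>) \<psi>"
  by (rule \<psi>_cont) auto

lemma compact_disc: "\<tau> < 1 \<Longrightarrow> compact (disc \<tau>)"
  unfolding disc_def by (intro compact_continuous_image \<psi>_cont) auto

lemma open_inner: "open {z \<in> \<Omega>. cmod (\<phi> z) < \<tau>}"
proof -
  have "open (\<Omega> \<inter> \<phi> -` ball 0 \<tau>)"
    by (intro continuous_open_preimage holomorphic_on_imp_continuous_on \<phi>_hol open_dom open_ball)
  then show ?thesis by (simp add: Int_def vimage_def)
qed

lemma open_outer: "\<tau> < 1 \<Longrightarrow> open (- disc \<tau>)"
  using compact_disc compact_imp_closed by blast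

text \<open>\<phi> maps \<open>disc \<tau>\<close> homeomorphically onto a closed disc, and a
  homeomorphic image of a compact convex set does not separate the plane. This lets identities near
  infinity propagate up to the boundary of \<Omega>.\<close>

lemma connected_outer:
  assumes "\<tau> < 1"
  shows "connected (- disc \<tau>)"
proof -
  have "homeomorphism (disc \<tau>) (cball 0 \<tau>) \<phi> \<psi>"
    unfolding homeomorphism_def
  proof (intro conjI ballI)
    show "continuous_on (disc \<tau>) \<phi>"
      using \<phi>_hol holomorphic_on_imp_continuous_on continuous_on_subset mem_disc[OF assms] by (metis subsetI)
    show "continuous_on (cball 0 \<tau>) \<psi>" using assms by (intro \<psi>_cont) auto
    show "\<phi> ` disc \<tau> = cball 0 \<tau>"
      unfolding disc_def image_image using assms \<phi>_\<psi> by (force simp: image_iff)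
    show "\<psi> ` cball 0 \<tau> = disc \<tau>" by (simp add: disc_def)
  qed (use assms \<phi>_\<psi> \<psi>_\<phi> mem_disc[OF assms] in auto)
  then have "disc \<tau> homeomorphic cball (0::complex) \<tau>" unfolding homeomorphic_def by blast
  then show ?thesis
    by (rule connected_complement_homeomorphic_convex_compact) auto
qed

end

section \<open>Growth at infinity and rational quotients\<close>

lemma poly_growth:
  fixes p :: "complex poly"
  obtains C where "C \<ge> 0" "\<And>z. cmod z \<ge> 1 \<Longrightarrow> cmod (poly p z) \<le> C * cmod z ^ degree p"
proof -
  have "\<exists>C\<ge>0. \<forall>z. cmod z \<ge> 1 \<longrightarrow> cmod (poly p z) \<le> C * cmod z ^ degree p"
  proof (intro exI[of _ "\<Sum>i\<le>degree p. cmod (coeff p i)"] conjI allI impI sum_nonneg)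
    fix z :: complex assume z: "1 \<le> cmod z"
    have "cmod (poly p z) \<le> (\<Sum>i\<le>degree p. cmod (coeff p i * z ^ i))"
      unfolding poly_altdef by (rule norm_sum)
    also have "\<dots> \<le> (\<Sum>i\<le>degree p. cmod (coeff p i) * cmod z ^ degree p)"
      using z by (intro sum_mono) (auto simp: norm_mult norm_power intro!: mult_left_mono power_increasing)
    finally show "cmod (poly p z) \<le> (\<Sum>i\<le>degree p. cmod (coeff p i)) * cmod z ^ degree p"
      by (simp add: sum_distrib_right)
  qed auto
  then show ?thesis using that by blast
qed

text \<open>In the coordinate u = 1/z the singularity at infinity is removable. B is not identically
  zero, so it has a zero of finite order j there, which bounds 1/B by a constant times
  |z|^j.\<close>

lemma inverse_growth_at_infinity:
  assumes "B holomorphic_on {z. R0 < cmod z}" "(B \<longlongrightarrow> 0) at_infinity" "R0 > 0" "cmod z0 > R0" "B z0 \<noteq> 0"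
  obtains R c j where "R > R0" "c > 0" "\<And>z. cmod z \<ge> R \<Longrightarrow> B z \<noteq> 0 \<and> 1 / cmod (B z) \<le> c * cmod z ^ j"
proof -
  define h where "h = (\<lambda>u. if u = 0 then 0 else B (inverse u))"
  define U where "U = ball (0::complex) (1 / R0)"
  have "h holomorphic_on U"
  proof (rule no_isolated_singularity[of _ _ "{0}"])
    have inv: "cmod (inverse u) > R0" if "u \<in> U" "u \<noteq> 0" for u
      using that assms(3) by (simp add: U_def norm_inverse norm_divide field_simps)
    have "(\<lambda>u. B (inverse u)) holomorphic_on U - {0}"
      by (rule holomorphic_on_compose_gen[OF _ assms(1), unfolded o_def])
        (use inv in \<open>auto intro!: holomorphic_intros\<close>)
    then show hol: "h holomorphic_on U - {0}"
      by (rule holomorphic_transform) (auto simp: h_def)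
    have "(h \<longlongrightarrow> h 0) (at 0)"
    proof -
      have "((\<lambda>u. B (inverse u)) \<longlongrightarrow> 0) (at 0)"
        by (rule filterlim_compose[OF assms(2) filterlim_inverse_at_infinity])
      moreover have "\<forall>\<^sub>F u in at 0. B (inverse u) = h u"
        by (auto simp: h_def eventually_at_filter)
      ultimately show ?thesis by (simp add: h_def tendsto_cong)
    qed
    then have "isCont h 0" by (simp add: isCont_def)
    moreover have "isCont h u" if "u \<in> U - {0}" for u
    proof -
      have "open (U - {0})" by (simp add: U_def open_delete)
      then show ?thesis
        using holomorphic_on_imp_continuous_on[OF hol] that continuous_on_eq_continuous_at by blast
    qed
    ultimately show "continuous_on U h"
      by (metis DiffI continuous_at_imp_continuous_on singletonD)
  qed (auto simp: U_def)
  moreover have "inverse z0 \<in> U" "h (inverse z0) \<noteq> 0" "0 \<in> U"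
  proof -
    have "z0 \<noteq> 0" using assms by auto
    then show "inverse z0 \<in> U" "h (inverse z0) \<noteq> 0" "0 \<in> U"
      using assms(3-5) by (auto simp: U_def h_def norm_inverse norm_divide inverse_eq_divide divide_simps)
  qed
  ultimately obtain j p where p: "p holomorphic_on U" "\<And>u. u \<in> U \<Longrightarrow> h u = (u - 0) ^ j * p u" "p 0 \<noteq> 0"
    using holomorphic_order_factor[of U 0 h "inverse z0"] unfolding U_def by (metis connected_ball open_ball)
  have "isCont p 0"
    using holomorphic_on_imp_continuous_on[OF p(1)] \<open>0 \<in> U\<close> unfolding U_def
    by (simp add: continuous_on_eq_continuous_at)
  then have "((\<lambda>u. cmod (p u)) \<longlongrightarrow> cmod (p 0)) (at 0)"
    by (intro tendsto_norm) (simp add: isCont_def)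
  then have "\<forall>\<^sub>F u in at 0. cmod (p 0) / 2 < cmod (p u)"
    using p(3) by (intro order_tendstoD(1)) auto
  then obtain d where d: "d > 0" "\<And>u. u \<noteq> 0 \<Longrightarrow> cmod u < d \<Longrightarrow> cmod (p 0) / 2 < cmod (p u)"
    unfolding eventually_at by (auto simp: dist_norm)
  define R where "R = max R0 (1 / d) + 1"
  have R: "R > R0" "R > 1 / d" "R > 0" using assms(3) by (auto simp: R_def)
  show ?thesis
  proof (rule that[of R "2 / cmod (p 0)" j])
    show "R > R0" by (rule R)
    show "2 / cmod (p 0) > 0" using p(3) by simp
    fix z assume z: "cmod z \<ge> R"
    then have z0: "z \<noteq> 0" using R by auto
    define u where "u = inverse z"
    have u: "u \<noteq> 0" "u \<in> U" "cmod u < d"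
    proof -
      have "cmod u = 1 / cmod z" by (simp add: u_def norm_inverse norm_divide inverse_eq_divide)
      moreover have "1 / cmod z < 1 / R0" using z R assms(3) by (intro divide_strict_left_mono mult_pos_pos) auto
      moreover have "1 / cmod z < 1 / (1 / d)" using z R d(1) by (intro divide_strict_left_mono mult_pos_pos) auto
      ultimately show "u \<noteq> 0" "u \<in> U" "cmod u < d" using z0 by (auto simp: U_def u_def)
    qed
    have Bz: "B z = p u / z ^ j" using p(2)[OF u(2)] u z0 by (simp add: h_def u_def power_inverse field_simps)
    have pu: "cmod (p u) > cmod (p 0) / 2" using d(2) u by blast
    then have "p u \<noteq> 0" by auto
    have "1 / cmod (B z) = cmod z ^ j / cmod (p u)" unfolding Bz by (simp add: norm_divide norm_power)
    also have "\<dots> \<le> cmod z ^ j / (cmod (p 0) / 2)"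
      using pu p(3) \<open>p u \<noteq> 0\<close> by (intro divide_left_mono mult_pos_pos) auto
    finally show "B z \<noteq> 0 \<and> 1 / cmod (B z) \<le> 2 / cmod (p 0) * cmod z ^ j"
      using \<open>p u \<noteq> 0\<close> z0 by (simp add: Bz field_simps)
  qed
qed

context disc_chart
begin

text \<open>With g = P1 \<gamma> and B = P2 \<nu>, the functions P2 f / \<gamma> in the interior and
  P1 A / \<nu> outside agree where both are defined, since g A = f B. They glue to an entire
  function of polynomial growth. P1, P2 and the growth exponent come from g and B alone, whence the
  common denominator and degree bound.\<close>

lemma rational_of_cauchy_quotient:
  assumes \<tau>: "0 < \<tau>" "\<tau> < 1"
    and B: "B holomorphic_on - disc \<tau>" "(B \<longlongrightarrow> 0) at_infinity" "z1 \<notin> disc \<tau>" "B z1 \<noteq> 0"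
    and g: "g holomorphic_on \<Omega>" "w \<in> \<Omega>" "g w \<noteq> 0"
  obtains Q M where "Q \<noteq> 0"
    "\<And>f A. f holomorphic_on \<Omega> \<Longrightarrow> A holomorphic_on - disc \<tau> \<Longrightarrow> (A \<longlongrightarrow> 0) at_infinity \<Longrightarrow>
       (\<And>z. z \<in> \<Omega> - disc \<tau> \<Longrightarrow> g z * A z = f z * B z) \<Longrightarrow>
       \<exists>E. degree E \<le> M \<and> (\<forall>z\<in>\<Omega>. f z * poly Q z = g z * poly E z)"
proof -
  obtain R0 where R0: "R0 > 0" "\<And>z. z \<in> disc \<tau> \<Longrightarrow> cmod z \<le> R0"
    using compact_imp_bounded[OF compact_disc[OF \<tau>(2)]] unfolding bounded_pos by blast
  have far_sub: "{z. R0 < cmod z} \<subseteq> - disc \<tau>" using R0(2) by (auto simp: not_le dest!: R0(2))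
  have far_open: "open {z::complex. R0 < cmod z}" by (intro open_Collect_less continuous_intros)
  have "\<exists>z0. R0 < cmod z0 \<and> B z0 \<noteq> 0"
  \<comment> \<open>If B vanished near infinity, it would vanish on the whole connected complement
    of \<open>disc \<tau>\<close>, contrary to B(z1) \<noteq> 0.\<close>
  proof (rule ccontr)
    assume none: "\<not> ?thesis"
    have "B z1 = (\<lambda>_. 0) z1"
    proof (rule analytic_continuation_open[OF far_open open_outer[OF \<tau>(2)] _ connected_outer[OF \<tau>(2)] far_sub B(1)])
      show "{z. R0 < cmod z} \<noteq> ({}::complex set)"
        using R0(1) by (auto intro!: exI[of _ "of_real (R0 + 1)"] simp del: of_real_add)
    qed (use none B(3) in auto)
    with B(4) show False by simp
  qed
  then obtain z0 where z0: "cmod z0 > R0" "B z0 \<noteq> 0" by blast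
  obtain R c j where R: "R > R0" "c > 0" "\<And>z. cmod z \<ge> R \<Longrightarrow> B z \<noteq> 0 \<and> 1 / cmod (B z) \<le> c * cmod z ^ j"
    using inverse_growth_at_infinity[OF holomorphic_on_subset[OF B(1) far_sub] B(2) R0(1) z0] by blast
  \<comment> \<open>With \<tau> < \<tau>2 < \<tau>1 < 1 the interior |\<phi>| < \<tau>1 and the
    complement of \<open>disc \<tau>2\<close> are open, cover the plane, and overlap only where both
    formulas are available.\<close>
  define \<tau>2 where "\<tau>2 = (2 * \<tau> + 1) / 3"
  define \<tau>1 where "\<tau>1 = (\<tau> + 2) / 3"
  have \<tau>12: "\<tau> < \<tau>2" "\<tau>2 < \<tau>1" "\<tau>1 < 1" "\<tau>2 < 1" using \<tau> by (auto simp: \<tau>1_def \<tau>2_def)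
  \<comment> \<open>Only the zeros of B in this compact set must be extracted: beyond radius
    \<open>R\<close> there are none, and points with |\<phi>| < \<tau>2 belong to the interior
    formula.\<close>
  define L where "L = cball 0 R - {z \<in> \<Omega>. cmod (\<phi> z) < \<tau>2}"
  have "compact L" unfolding L_def by (intro compact_diff compact_cball open_inner)
  moreover have "L \<subseteq> - disc \<tau>" using \<tau>12(1) by (auto simp: L_def mem_disc[OF \<tau>(2)])
  moreover have "z1 \<in> - disc \<tau>" using B(3) by simp
  ultimately obtain P2 \<nu> where P2: "P2 \<noteq> 0" "\<nu> holomorphic_on - disc \<tau>"
    "\<And>z. z \<in> - disc \<tau> \<Longrightarrow> B z = poly P2 z * \<nu> z" "\<And>z. z \<in> L \<Longrightarrow> \<nu> z \<noteq> 0"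
    using zero_factorization[OF open_outer[OF \<tau>(2)] connected_outer[OF \<tau>(2)] B(1) _ B(4)] by metis
  have "disc \<tau>1 \<subseteq> \<Omega>" using mem_disc[OF \<tau>12(3)] by auto
  then obtain P1 \<gamma> where P1: "P1 \<noteq> 0" "\<gamma> holomorphic_on \<Omega>"
    "\<And>z. z \<in> \<Omega> \<Longrightarrow> g z = poly P1 z * \<gamma> z" "\<And>z. z \<in> disc \<tau>1 \<Longrightarrow> \<gamma> z \<noteq> 0"
    using zero_factorization[OF open_dom connected_dom g compact_disc[OF \<tau>12(3)]] by metis
  obtain C1 where C1: "C1 \<ge> 0" "\<And>z. cmod z \<ge> 1 \<Longrightarrow> cmod (poly P1 z) \<le> C1 * cmod z ^ degree P1"
    using poly_growth by blast
  obtain C2 where C2: "C2 \<ge> 0" "\<And>z. cmod z \<ge> 1 \<Longrightarrow> cmod (poly P2 z) \<le> C2 * cmod z ^ degree P2"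
    using poly_growth by blast
  \<comment> \<open>Far out E = P1 A P2 / B with |A| < 1 and 1/B of order at most j, so the three
    exponents add up.\<close>
  define M where "M = degree P1 + degree P2 + j"
  define U1 where "U1 = {z \<in> \<Omega>. cmod (\<phi> z) < \<tau>1}"
  define U2 where "U2 = - disc \<tau>2"
  have op: "open U1" "open U2" unfolding U1_def U2_def using open_inner open_outer \<tau>12(4) by auto
  have cover: "U1 \<union> U2 = UNIV" using \<tau>12 by (auto simp: U1_def U2_def mem_disc)
  have U1: "U1 \<subseteq> \<Omega>" "\<And>z. z \<in> U1 \<Longrightarrow> \<gamma> z \<noteq> 0" using P1(4) \<tau>12 by (auto simp: U1_def mem_disc)
  have U2: "U2 \<subseteq> - disc \<tau>" using \<tau>12 by (auto simp: U2_def mem_disc)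
  have \<nu>: "\<nu> z \<noteq> 0" if "z \<in> U2" for z
  proof (cases "cmod z \<le> R")
    case True
    then show ?thesis using P2(4) that \<tau>12 by (auto simp: L_def U2_def mem_disc)
  next
    case False
    then have "B z \<noteq> 0" using R(3)[of z] by simp
    then show ?thesis using P2(3) that U2 by auto
  qed
  have key: "\<exists>E. degree E \<le> M \<and> (\<forall>z\<in>\<Omega>. f z * poly (P1 * P2) z = g z * poly E z)"
    if f: "f holomorphic_on \<Omega>" and A: "A holomorphic_on - disc \<tau>" "(A \<longlongrightarrow> 0) at_infinity"
      and eq: "\<And>z. z \<in> \<Omega> - disc \<tau> \<Longrightarrow> g z * A z = f z * B z" for f A
  proof -
    define E where "E = (\<lambda>z. if z \<in> U1 then poly P2 z * f z / \<gamma> z else poly P1 z * A z / \<nu> z)"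
    have E1: "E z = poly P2 z * f z / \<gamma> z" if "z \<in> U1" for z using that by (simp add: E_def)
    have E2: "E z = poly P1 z * A z / \<nu> z" if "z \<in> U2" for z
    proof (cases "z \<in> U1")
      case True
      then have z: "z \<in> \<Omega>" "z \<in> - disc \<tau>" using U1 U2 that by auto
      then have "poly P1 z * \<gamma> z * A z = f z * (poly P2 z * \<nu> z)"
        using eq[of z] P1(3)[of z] P2(3)[of z] by auto
      then have "poly P2 z * f z / \<gamma> z = poly P1 z * A z / \<nu> z"
        using U1(2)[OF True] \<nu>[OF that] by (simp add: frac_eq_eq mult_ac)
      then show ?thesis using E1[OF True] by simp
    qed (simp add: E_def)
    have "E holomorphic_on U1"
    proof (rule holomorphic_transform)
      show "(\<lambda>z. poly P2 z * f z / \<gamma> z) holomorphic_on U1"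
        using U1 f P1(2) by (intro holomorphic_intros) (auto intro: holomorphic_on_subset)
    qed (simp add: E1)
    moreover have "E holomorphic_on U2"
    proof (rule holomorphic_transform)
      show "(\<lambda>z. poly P1 z * A z / \<nu> z) holomorphic_on U2"
        using U2 A P2(2) \<nu> by (intro holomorphic_intros) (auto intro: holomorphic_on_subset)
    qed (simp add: E2)
    ultimately have E_hol: "E holomorphic_on UNIV"
      using holomorphic_on_Un[OF _ _ op] cover by metis
    obtain b where b: "\<And>z. b \<le> cmod z \<Longrightarrow> cmod (A z) < 1"
      using A(2) unfolding Lim_at_infinity dist_norm by (metis diff_zero zero_less_one)
    obtain R2 where R2: "R2 > 0" "\<And>z. z \<in> disc \<tau>2 \<Longrightarrow> cmod z \<le> R2"
      using compact_imp_bounded[OF compact_disc[OF \<tau>12(4)]] unfolding bounded_pos by blast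
    define R3 where "R3 = Max {b, R, R2 + 1, 1}"
    have growth: "cmod (E z) \<le> (C1 * C2 * c) * cmod z ^ M" if z: "R3 \<le> cmod z" for z
    proof -
      have z': "b \<le> cmod z" "R \<le> cmod z" "R2 < cmod z" "1 \<le> cmod z" using z by (auto simp: R3_def)
      then have zU: "z \<in> U2" using R2(2)[of z] by (auto simp: U2_def)
      have Bz: "B z = poly P2 z * \<nu> z" using P2(3) zU U2 by auto
      have nz: "B z \<noteq> 0" "1 / cmod (B z) \<le> c * cmod z ^ j" using R(3)[OF z'(2)] by auto
      have "E z = poly P1 z * A z * (poly P2 z / B z)"
        using E2[OF zU] nz(1) by (simp add: Bz)
      then have "cmod (E z) = cmod (poly P1 z) * cmod (A z) * (cmod (poly P2 z) * (1 / cmod (B z)))"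
        by (simp add: norm_mult norm_divide)
      also have "\<dots> \<le> (C1 * cmod z ^ degree P1) * 1 * ((C2 * cmod z ^ degree P2) * (c * cmod z ^ j))"
        using C1(2)[OF z'(4)] C2(2)[OF z'(4)] b[OF z'(1)] nz C1(1) C2(1) R(2)
        by (intro mult_mono) (auto simp: less_imp_le)
      finally show ?thesis by (simp add: M_def power_add mult_ac)
    qed
    define Ep where "Ep = (\<Sum>k\<le>M. monom ((deriv ^^ k) E 0 / fact k) k)"
    have "E z = poly Ep z" for z
      using Liouville_polynomial[of E R3 "C1 * C2 * c" M z, OF E_hol growth] by (simp add: Ep_def poly_sum poly_monom)
    moreover have "degree Ep \<le> M"
      unfolding Ep_def by (intro degree_sum_le) (auto intro: order_trans[OF degree_monom_le])
    moreover have "f z * poly (P1 * P2) z = g z * poly Ep z" if "z \<in> \<Omega>" for z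
    proof (rule analytic_continuation_open[OF op(1) open_dom _ connected_dom U1(1) _ _ _ that])
      show "U1 \<noteq> {}" using \<psi>_in[of 0] \<phi>_\<psi>[of 0] \<tau>12 \<tau> by (auto simp: U1_def intro!: exI[of _ "\<psi> 0"])
      show "f x * poly (P1 * P2) x = g x * poly Ep x" if "x \<in> U1" for x
      proof -
        have "poly P2 x * f x = poly Ep x * \<gamma> x"
          using E1[OF that] U1(2)[OF that] \<open>\<And>z. E z = poly Ep z\<close> by (simp add: field_simps)
        then show ?thesis using P1(3)[of x] that U1(1) by (auto simp: mult_ac)
      qed
    qed (auto intro!: holomorphic_intros f g)
    ultimately show ?thesis by blast
  qed
  show ?thesis by (rule that[of "P1 * P2" M]) (use P1(1) P2(1) key in auto)
qed

end

text \<open>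
  A continuous functional \<open>J\<close> on \<open>H(\<Omega>)\<close> in its contour integral representations over all
  curves \<open>\<psi> (|w| = \<tau>)\<close> close to the boundary.
\<close>

locale contour_functional = disc_chart +
  fixes \<kappa> :: "complex \<Rightarrow> complex" and \<rho> :: real and J :: "(complex \<Rightarrow> complex) \<Rightarrow> complex"
  assumes \<rho>: "0 < \<rho>" "\<rho> < 1"
    and \<kappa>_cont: "\<rho> < \<tau> \<Longrightarrow> \<tau> < 1 \<Longrightarrow> continuous_on (sphere 0 \<tau>) \<kappa>"
    and J: "\<rho> < \<tau> \<Longrightarrow> \<tau> < 1 \<Longrightarrow> f \<in> Hol \<Omega> \<Longrightarrow>
      J f = contour_integral (circlepath 0 \<tau>) (\<lambda>w. f (\<psi> w) * \<kappa> w)"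
begin

abbreviation tr :: "real \<Rightarrow> (complex \<Rightarrow> complex) \<Rightarrow> complex \<Rightarrow> complex" where
  "tr \<tau> f \<equiv> cauchy_tr \<tau> \<psi> (\<lambda>w. f (\<psi> w) * \<kappa> w)"

lemma fk_cont:
  assumes "f holomorphic_on \<Omega>" "\<rho> < \<tau>" "\<tau> < 1"
  shows "continuous_on (sphere 0 \<tau>) (\<lambda>w. f (\<psi> w) * \<kappa> w)"
proof -
  have "continuous_on (sphere 0 \<tau>) (\<lambda>w. f (\<psi> w))"
    using comp_\<psi>_hol[OF assms(1)] assms(3)
    by (intro holomorphic_on_imp_continuous_on) (auto elim: holomorphic_on_subset)
  then show ?thesis by (intro continuous_intros \<kappa>_cont assms)
qed

lemma fk_integrable:
  assumes "f holomorphic_on \<Omega>" "\<rho> < \<tau>" "\<tau> < 1"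
  shows "(\<lambda>w. f (\<psi> w) * \<kappa> w) contour_integrable_on circlepath 0 \<tau>"
  using fk_cont[OF assms] assms \<rho> by (intro contour_integrable_continuous_circlepath) simp

lemma J_lincomb:
  assumes "f \<in> Hol \<Omega>" "h \<in> Hol \<Omega>"
  shows "J (\<lambda>z. c * f z + d * h z) = c * J f + d * J h"
proof -
  define \<tau> where "\<tau> = (\<rho> + 1) / 2"
  have \<tau>: "\<rho> < \<tau>" "\<tau> < 1" using \<rho> by (auto simp: \<tau>_def)
  have int: "(\<lambda>w. f (\<psi> w) * \<kappa> w) contour_integrable_on circlepath 0 \<tau>"
    "(\<lambda>w. h (\<psi> w) * \<kappa> w) contour_integrable_on circlepath 0 \<tau>"
    using assms \<tau> by (auto intro: fk_integrable Hol_holomorphic)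
  have "J (\<lambda>z. c * f z + d * h z) =
      contour_integral (circlepath 0 \<tau>) (\<lambda>w. c * (f (\<psi> w) * \<kappa> w) + d * (h (\<psi> w) * \<kappa> w))"
    using assms by (subst J[OF \<tau>]) (auto simp: Hol_def algebra_simps intro!: holomorphic_intros)
  also have "\<dots> = c * J f + d * J h"
    using int assms J[OF \<tau>] by (simp add: contour_integral_add contour_integral_lmul contour_integrable_lmul)
  finally show ?thesis .
qed

text \<open>\<open>dd (\<lambda>t. t * f t) g z / g z\<close> is the value at \<open>f\<close> of the resolvent \<open>(I - z D)\<^sup>-\<^sup>1\<close> of the Pommiez operator.\<close>

definition dd :: "(complex \<Rightarrow> complex) \<Rightarrow> (complex \<Rightarrow> complex) \<Rightarrow> complex \<Rightarrow> complex \<Rightarrow> complex" where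
  "dd a b z = (\<lambda>t. if t \<notin> \<Omega> then 0 else if t = z then deriv (\<lambda>t. a t * b z - a z * b t) z
      else (a t * b z - a z * b t) / (t - z))"

lemma dd_eq: "t \<in> \<Omega> \<Longrightarrow> (t - z) * dd a b z t = a t * b z - a z * b t"
  by (auto simp: dd_def)

lemma dd_Hol:
  assumes "a holomorphic_on \<Omega>" "b holomorphic_on \<Omega>" "z \<in> \<Omega>"
  shows "dd a b z \<in> Hol \<Omega>"
proof -
  let ?f = "\<lambda>t. a t * b z - a z * b t"
  have "(\<lambda>t. if t = z then deriv ?f z else (?f t - ?f z) / (t - z)) holomorphic_on \<Omega>"
    using assms open_dom by (intro pole_lemma holomorphic_intros) (auto simp: interior_open)
  then have "dd a b z holomorphic_on \<Omega>"
    by (rule holomorphic_transform) (simp add: dd_def mult.commute)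
  then show ?thesis by (simp add: Hol_def dd_def)
qed

text \<open>On the curve t never equals z, so the two terms of the numerator may be integrated
  separately although each alone has a pole at t = z. Points z on either side of the curve are
  covered: from inside this gives holomorphy in z, from outside the relation near the
  boundary.\<close>

lemma J_dd:
  assumes "a holomorphic_on \<Omega>" "b holomorphic_on \<Omega>" "z \<in> \<Omega>" "\<rho> < \<tau>" "\<tau> < 1" "cmod (\<phi> z) \<noteq> \<tau>"
  shows "J (dd a b z) = b z * tr \<tau> a z - a z * tr \<tau> b z"
proof -
  have ne: "\<psi> w \<noteq> z" if "w \<in> sphere 0 \<tau>" for w using that assms \<phi>_\<psi>[of w] by auto
  then have z: "z \<notin> \<psi> ` sphere 0 \<tau>" by blast
  have "\<tau> > 0" using \<rho> assms by simp
  note int = cauchy_tr_integrable[OF this fk_cont[OF assms(1,4,5)] \<psi>_cont_sphere[OF assms(5)] z]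
    cauchy_tr_integrable[OF this fk_cont[OF assms(2,4,5)] \<psi>_cont_sphere[OF assms(5)] z]
  have "J (dd a b z) = contour_integral (circlepath 0 \<tau>) (\<lambda>w. dd a b z (\<psi> w) * \<kappa> w)"
    using assms by (intro J dd_Hol)
  also have "\<dots> = contour_integral (circlepath 0 \<tau>) (\<lambda>w. b z * (a (\<psi> w) * \<kappa> w / (\<psi> w - z))
      - a z * (b (\<psi> w) * \<kappa> w / (\<psi> w - z)))"
  proof (rule contour_integral_eq)
    fix w assume "w \<in> path_image (circlepath 0 \<tau>)"
    then have w: "w \<in> sphere 0 \<tau>" using \<open>\<tau> > 0\<close> by simp
    then have "\<psi> w \<in> \<Omega>" using \<psi>_in assms(5) by simp
    then show "dd a b z (\<psi> w) * \<kappa> w = b z * (a (\<psi> w) * \<kappa> w / (\<psi> w - z)) - a z * (b (\<psi> w) * \<kappa> w / (\<psi> w - z))"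
      using ne[OF w] by (simp add: dd_def divide_simps) (simp add: algebra_simps)
  qed
  also have "\<dots> = b z * tr \<tau> a z - a z * tr \<tau> b z"
    unfolding contour_integral_diff[OF contour_integrable_lmul[OF int(1)] contour_integrable_lmul[OF int(2)]]
      contour_integral_lmul[OF int(1)] contour_integral_lmul[OF int(2)] cauchy_tr_def ..
  finally show ?thesis .
qed

lemma tr_holomorphic:
  assumes "f holomorphic_on \<Omega>" "\<rho> < \<tau>" "\<tau> < 1" "open U" "\<And>z. z \<in> U \<Longrightarrow> z \<in> \<Omega> \<Longrightarrow> cmod (\<phi> z) \<noteq> \<tau>"
  shows "tr \<tau> f holomorphic_on U"
proof (rule cauchy_tr_holomorphic)
  show "U \<inter> \<psi> ` sphere 0 \<tau> = {}" using assms(3,5) \<psi>_in \<phi>_\<psi> by (auto simp: image_iff) (metis)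
qed (use assms \<rho> fk_cont \<psi>_cont_sphere in auto)

text \<open>J has the same value for every admissible radius, so around each z a curve enclosing z
  can be chosen.\<close>

lemma J_dd_holomorphic:
  assumes "a holomorphic_on \<Omega>" "b holomorphic_on \<Omega>"
  shows "(\<lambda>z. J (dd a b z)) holomorphic_on \<Omega>"
proof (rule holomorphic_onI)
  fix z assume z: "z \<in> \<Omega>"
  define \<tau> where "\<tau> = (max \<rho> (cmod (\<phi> z)) + 1) / 2"
  have \<tau>: "\<rho> < \<tau>" "\<tau> < 1" "cmod (\<phi> z) < \<tau>" using \<rho> \<phi>_in[OF z] by (auto simp: \<tau>_def)
  define U where "U = {z \<in> \<Omega>. cmod (\<phi> z) < \<tau>}"
  have U: "open U" "z \<in> U" "U \<subseteq> \<Omega>" using open_inner \<tau> z by (auto simp: U_def)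
  have "(\<lambda>z. b z * tr \<tau> a z - a z * tr \<tau> b z) holomorphic_on U"
    using U assms \<tau> by (intro holomorphic_intros tr_holomorphic) (auto simp: U_def intro: holomorphic_on_subset)
  then have "(\<lambda>z. J (dd a b z)) holomorphic_on U"
    by (rule holomorphic_transform) (use assms \<tau> in \<open>auto simp: U_def J_dd\<close>)
  then show "(\<lambda>z. J (dd a b z)) field_differentiable at z within \<Omega>"
    using U field_differentiable_at_within holomorphic_on_imp_differentiable_at by blast
qed

definition one :: "complex \<Rightarrow> complex" where "one = (\<lambda>z. if z \<in> \<Omega> then 1 else 0)"

lemma one_hol: "one holomorphic_on \<Omega>"
  by (rule holomorphic_transform[of "\<lambda>_. 1"]) (auto simp: one_def)

text \<open>
  If the transform of the kernel vanishes near the boundary, then the transform of \<open>q\<close> continues to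
  an entire function vanishing at infinity, and \<open>J q\<close> is its residue there.
\<close>

lemma J_eq_0_of_tr_one:
  assumes "\<rho> < \<tau>" "\<tau> < 1" "\<And>z. z \<in> \<Omega> \<Longrightarrow> \<tau> < cmod (\<phi> z) \<Longrightarrow> tr \<tau> one z = 0" "q \<in> Hol \<Omega>"
  shows "J q = 0"
proof -
  note q = Hol_holomorphic[OF assms(4)]
  have \<tau>: "\<tau> > 0" using \<rho> assms by simp
  \<comment> \<open>Near the boundary \<open>J (dd q one z)\<close> is
    \<open>tr \<tau> q z - q z * tr \<tau> one z\<close>, and the last transform vanishes there by
    hypothesis; so the two branches agree.\<close>
  define E where "E = (\<lambda>z. if z \<in> \<Omega> then J (dd q one z) else tr \<tau> q z)"
  have E_out: "E z = tr \<tau> q z" if "z \<in> - disc \<tau>" for z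
    using that J_dd[OF q one_hol, of z \<tau>] assms(1-3)
    by (auto simp: E_def mem_disc[OF assms(2)] one_def)
  have "E holomorphic_on \<Omega>"
    by (rule holomorphic_transform[OF J_dd_holomorphic[OF q one_hol]]) (simp add: E_def)
  moreover have "E holomorphic_on - disc \<tau>"
  proof (rule holomorphic_transform)
    show "tr \<tau> q holomorphic_on - disc \<tau>"
      by (rule tr_holomorphic) (use q assms open_outer in \<open>auto simp: mem_disc\<close>)
  qed (simp add: E_out)
  moreover have "\<Omega> \<union> - disc \<tau> = UNIV" using mem_disc[OF assms(2)] by auto
  ultimately have E_hol: "E holomorphic_on UNIV"
    using holomorphic_on_Un[OF _ _ open_dom open_outer[OF assms(2)]] by metis
  obtain R where R: "R > 0" "\<And>z. z \<in> disc \<tau> \<Longrightarrow> cmod z \<le> R"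
    using compact_imp_bounded[OF compact_disc[OF assms(2)]] unfolding bounded_pos by blast
  then have out: "\<forall>\<^sub>F z in at_infinity. z \<in> - disc \<tau>"
    unfolding eventually_at_infinity by (intro exI[of _ "R + 1"]) force
  have "(E \<longlongrightarrow> 0) at_infinity"
  proof (rule Lim_transform_eventually)
    show "(tr \<tau> q \<longlongrightarrow> 0) at_infinity"
      using \<tau> fk_cont[OF q assms(1,2)] \<psi>_cont_sphere[OF assms(2)] by (rule cauchy_tr_tendsto_0)
    show "\<forall>\<^sub>F z in at_infinity. tr \<tau> q z = E z"
      using out by eventually_elim (simp add: E_out)
  qed
  then have E0: "E z = 0" for z by (rule Liouville_weak_0[OF E_hol])
  \<comment> \<open>From \<zeta> / (\<zeta> - z) = 1 + z / (\<zeta> - z), the transform of z q(z)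
    equals J q plus z times that of q. The latter is 0 outside, so the constant J q is a transform
    that tends to 0 at infinity.\<close>
  define q1 where "q1 = (\<lambda>z. z * q z)"
  have q1: "q1 holomorphic_on \<Omega>" unfolding q1_def by (intro holomorphic_intros q)
  have "tr \<tau> q1 z = J q" if "z \<in> - disc \<tau>" for z
  proof -
    have z: "z \<notin> \<psi> ` sphere 0 \<tau>" using that by (auto simp: disc_def)
    have int: "(\<lambda>w. q (\<psi> w) * \<kappa> w / (\<psi> w - z)) contour_integrable_on circlepath 0 \<tau>"
      by (rule cauchy_tr_integrable[OF \<tau> fk_cont[OF q assms(1,2)] \<psi>_cont_sphere[OF assms(2)] z])
    have "tr \<tau> q1 z = contour_integral (circlepath 0 \<tau>) (\<lambda>w. q (\<psi> w) * \<kappa> w + z * (q (\<psi> w) * \<kappa> w / (\<psi> w - z)))"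
      unfolding cauchy_tr_def
    proof (rule contour_integral_eq)
      fix w assume "w \<in> path_image (circlepath 0 \<tau>)"
      then have "\<psi> w \<noteq> z" using z \<tau> by auto
      then show "q1 (\<psi> w) * \<kappa> w / (\<psi> w - z) = q (\<psi> w) * \<kappa> w + z * (q (\<psi> w) * \<kappa> w / (\<psi> w - z))"
        by (simp add: q1_def field_simps)
    qed
    also have "\<dots> = J q + z * tr \<tau> q z"
      unfolding contour_integral_add[OF fk_integrable[OF q assms(1,2)] contour_integrable_lmul[OF int]]
        contour_integral_lmul[OF int]
      by (simp add: J[OF assms(1,2,4)] cauchy_tr_def)
    finally show ?thesis using E_out[OF that] E0[of z] by simp
  qed
  then have "\<forall>\<^sub>F z in at_infinity. tr \<tau> q1 z = J q" using out by (rule eventually_mono[rotated])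
  moreover have "(tr \<tau> q1 \<longlongrightarrow> 0) at_infinity"
    using \<tau> fk_cont[OF q1 assms(1,2)] \<psi>_cont_sphere[OF assms(2)] by (rule cauchy_tr_tendsto_0)
  ultimately have "((\<lambda>_::complex. J q) \<longlongrightarrow> 0) at_infinity" by (rule Lim_transform_eventually[rotated])
  then show ?thesis by (metis tendsto_const tendsto_unique trivial_limit_at_infinity)
qed

end

section \<open>The dichotomy for invariant subspaces\<close>

context
  fixes \<Omega> :: "complex set" and g :: "complex \<Rightarrow> complex" and S :: "(complex \<Rightarrow> complex) set"
  assumes inv: "closed_invariant_subspace \<Omega> g S"
begin

lemma inv_subset_Hol: "f \<in> S \<Longrightarrow> f \<in> Hol \<Omega>"
  using inv by (auto simp: closed_invariant_subspace_def)

lemma inv_subspace: "cfun.subspace S"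
  using inv by (simp add: closed_invariant_subspace_def)

lemma inv_closed: "closedin (Hol_topology \<Omega>) S"
  using inv by (simp add: closed_invariant_subspace_def)

lemma inv_zero: "(\<lambda>_. 0) \<in> S"
  using cfun.subspace_0[OF inv_subspace] by (simp add: zero_fun_def)

lemma inv_lincomb: "f \<in> S \<Longrightarrow> h \<in> S \<Longrightarrow> (\<lambda>z. f z + c * h z) \<in> S"
  using cfun.subspace_add[OF inv_subspace _ cfun.subspace_scale[OF inv_subspace], of f h c]
  by (simp add: plus_fun_def cscale_def)

lemma inv_pommiez: "f \<in> S \<Longrightarrow> pommiez \<Omega> g f \<in> S"
  using inv by (auto simp: closed_invariant_subspace_def)

end

lemma pommiez_eq: "g 0 = 1 \<Longrightarrow> z \<in> \<Omega> \<Longrightarrow> z * pommiez \<Omega> g f z = f z - f 0 * g z"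
  by (auto simp: pommiez_def)

section \<open>Closedness as approximation, and the ideal case\<close>

lemma mem_closedin_Hol:
  assumes "closedin (Hol_topology \<Omega>) S" "f \<in> Hol \<Omega>"
    and "\<And>K \<epsilon>. compact K \<Longrightarrow> K \<subseteq> \<Omega> \<Longrightarrow> \<epsilon> > 0 \<Longrightarrow> \<exists>s\<in>S. \<forall>z\<in>K. cmod (s z - f z) < \<epsilon>"
  shows "f \<in> S"
proof (rule ccontr)
  assume "f \<notin> S"
  have "openin (Hol_topology \<Omega>) (Hol \<Omega> - S)" "S \<subseteq> Hol \<Omega>"
    using assms(1) unfolding closedin_def topspace_Hol_topology by auto
  then obtain K \<epsilon> where K: "compact K" "K \<subseteq> \<Omega>" "\<epsilon> > 0" "compact_nbhd \<Omega> f K \<epsilon> \<subseteq> Hol \<Omega> - S"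
    using assms(2) \<open>f \<notin> S\<close> unfolding openin_Hol_topology by blast
  obtain s where "s \<in> S" "\<forall>z\<in>K. cmod (s z - f z) < \<epsilon>" using assms(3)[OF K(1-3)] by blast
  then have "s \<in> compact_nbhd \<Omega> f K \<epsilon>"
    using \<open>S \<subseteq> Hol \<Omega>\<close> by (auto simp: compact_nbhd_def dist_norm)
  with K \<open>s \<in> S\<close> show False by auto
qed

lemma closedin_HolI:
  assumes "\<And>f. f \<in> Hol \<Omega> \<Longrightarrow> (\<And>K \<epsilon>. compact K \<Longrightarrow> K \<subseteq> \<Omega> \<Longrightarrow> \<epsilon> > 0 \<Longrightarrow>
      \<exists>s\<in>S. \<forall>z\<in>K. cmod (s z - f z) < \<epsilon>) \<Longrightarrow> f \<in> S"
    and "S \<subseteq> Hol \<Omega>"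
  shows "closedin (Hol_topology \<Omega>) S"
  unfolding closedin_def topspace_Hol_topology openin_Hol_topology
proof (intro conjI ballI assms(2))
  show "Hol \<Omega> - S \<subseteq> Hol \<Omega>" by blast
  fix f assume f: "f \<in> Hol \<Omega> - S"
  then obtain K \<epsilon> where K: "compact K" "K \<subseteq> \<Omega>" "\<epsilon> > 0" "\<not> (\<exists>s\<in>S. \<forall>z\<in>K. cmod (s z - f z) < \<epsilon>)"
    using assms(1)[of f] by blast
  then have "compact_nbhd \<Omega> f K \<epsilon> \<subseteq> Hol \<Omega> - S"
    by (auto simp: compact_nbhd_def dist_norm)
  with K show "\<exists>K \<epsilon>. compact K \<and> K \<subseteq> \<Omega> \<and> \<epsilon> > 0 \<and> compact_nbhd \<Omega> f K \<epsilon> \<subseteq> Hol \<Omega> - S" by blast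
qed

lemma zmult_set_attained: "S \<noteq> {} \<Longrightarrow> \<exists>s\<in>S. zmult_set S \<mu> = zmult s \<mu>"
  using wellorder_InfI[of _ "(\<lambda>h. zmult h \<mu>) ` S"] unfolding zmult_set_def by blast

lemma zmult_finite:
  assumes "open \<Omega>" "connected \<Omega>" "f \<in> Hol \<Omega>" "f \<noteq> 0" "\<mu> \<in> \<Omega>"
  obtains h k where "h holomorphic_on \<Omega>" "h \<mu> \<noteq> 0" "\<And>z. z \<in> \<Omega> \<Longrightarrow> f z = (z - \<mu>) ^ k * h z"
    "zmult f \<mu> = enat k"
proof -
  obtain w where "w \<in> \<Omega>" "f w \<noteq> 0" using assms Hol_nonzeroE by blast
  then obtain k h where h: "h holomorphic_on \<Omega>" "\<And>z. z \<in> \<Omega> \<Longrightarrow> f z = (z - \<mu>) ^ k * h z" "h \<mu> \<noteq> 0"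
    using holomorphic_order_factor[OF assms(1,2,5)] assms(3) Hol_holomorphic by metis
  moreover have "zmult f \<mu> = enat k"
    by (rule zmult_eqI[of \<Omega> \<mu> h]) (use assms h in auto)
  ultimately show ?thesis using that by blast
qed

context disc_chart
begin

text \<open>Write g = P \<gamma> with \<gamma> zero-free on a disc around \<open>K\<close>.
  Interpolation gives s in \<open>S\<close> with f - s = P k, and P k = g (k / \<gamma>) is
  approximated on \<open>K\<close> by elements g q of \<open>S\<close>.\<close>

lemma mem_of_zmult_ge:
  assumes "0 \<in> \<Omega>" "g \<in> Hol \<Omega>" "g 0 = 1" and inv: "closed_invariant_subspace \<Omega> g S"
    and ideal: "\<And>q. q \<in> Hol \<Omega> \<Longrightarrow> (\<lambda>z. g z * q z) \<in> S"
    and f: "f \<in> Hol \<Omega>" "\<And>\<mu>. \<mu> \<in> \<Omega> \<Longrightarrow> zmult_set S \<mu> \<le> zmult f \<mu>"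
  shows "f \<in> S"
proof (rule mem_closedin_Hol[OF inv_closed[OF inv] f(1)])
  fix K and \<epsilon> :: real assume K: "compact K" "K \<subseteq> \<Omega>" and \<epsilon>: "\<epsilon> > 0"
  have "(\<lambda>z. if z \<in> \<Omega> then 1 else 0) holomorphic_on \<Omega>"
    by (rule holomorphic_transform[of "\<lambda>_. 1"]) auto
  then have "(\<lambda>z. if z \<in> \<Omega> then 1 else 0) \<in> Hol \<Omega>" by (simp add: Hol_def)
  from ideal[OF this] have "g \<in> S"
    by (rule back_subst[of "\<lambda>x. x \<in> S"]) (use assms(2) in \<open>auto simp: Hol_def\<close>)
  have "g \<noteq> 0" using assms(3) by auto
  \<comment> \<open>\<open>g\<close> lies in \<open>S\<close> and has finite order at every point,
    so the minimal orders are natural numbers.\<close>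
  define a where "a = (\<lambda>\<mu>. the_enat (zmult_set S \<mu>))"
  have a: "zmult_set S \<mu> = enat (a \<mu>)" if "\<mu> \<in> \<Omega>" for \<mu>
  proof -
    have "zmult_set S \<mu> \<le> zmult g \<mu>" unfolding zmult_set_def using \<open>g \<in> S\<close> by (rule INF_lower)
    moreover obtain k where "zmult g \<mu> = enat k"
      using zmult_finite[OF open_dom connected_dom assms(2) \<open>g \<noteq> 0\<close> \<open>\<mu> \<in> \<Omega>\<close>] by metis
    ultimately show ?thesis unfolding a_def by (cases "zmult_set S \<mu>") auto
  qed
  interpret shift_invariant \<Omega> g S a
  proof
    show "\<exists>t\<in>S. \<forall>z\<in>\<Omega>. z * t z = s z - s 0 * g z" if "s \<in> S" for s
      using inv_pommiez[OF inv that] pommiez_eq[of g] assms(3) by blast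
    show "vanishes_to \<Omega> \<mu> (a \<mu>) s" if "\<mu> \<in> \<Omega>" "s \<in> S" for \<mu> s
    proof -
      have "zmult_set S \<mu> \<le> zmult s \<mu>" unfolding zmult_set_def using that(2) by (rule INF_lower)
      then show ?thesis
        using le_zmult_iff[OF open_dom connected_dom that(1) inv_subset_Hol[OF inv that(2)]] a[OF that(1)] by simp
    qed
    show "\<exists>s\<in>S. \<exists>h. h holomorphic_on \<Omega> \<and> h \<mu> \<noteq> 0 \<and> (\<forall>z\<in>\<Omega>. s z = (z - \<mu>) ^ a \<mu> * h z)"
      if "\<mu> \<in> \<Omega>" for \<mu>
    proof -
      obtain s where s: "s \<in> S" "zmult_set S \<mu> = zmult s \<mu>"
        using zmult_set_attained[of S \<mu>] \<open>g \<in> S\<close> by blast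
      have "s \<noteq> 0" using s(2) a[OF that] by (auto simp: zmult_def)
      then obtain h k where "h holomorphic_on \<Omega>" "h \<mu> \<noteq> 0" "\<And>z. z \<in> \<Omega> \<Longrightarrow> s z = (z - \<mu>) ^ k * h z"
        "zmult s \<mu> = enat k"
        using zmult_finite[OF open_dom connected_dom inv_subset_Hol[OF inv s(1)] \<open>s \<noteq> 0\<close> \<open>\<mu> \<in> \<Omega>\<close>] by metis
      then show ?thesis using s a[OF that] by auto
    qed
  qed (use open_dom assms Hol_holomorphic inv_zero[OF inv] inv_lincomb[OF inv] inv_subset_Hol[OF inv] in auto)
  obtain r where r: "0 \<le> r" "r < 1" "\<And>z. z \<in> K \<Longrightarrow> cmod (\<phi> z) \<le> r"
    using compact_subset_disc[OF K] by blast
  define \<tau> where "\<tau> = (r + 1) / 2"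
  have \<tau>: "r < \<tau>" "\<tau> < 1" using r by (auto simp: \<tau>_def)
  have "disc \<tau> \<subseteq> \<Omega>" using mem_disc[OF \<tau>(2)] by auto
  have "g 0 \<noteq> 0" using assms by simp
  obtain P \<gamma> where P: "P \<noteq> 0" "\<gamma> holomorphic_on \<Omega>"
    "\<And>z. z \<in> \<Omega> \<Longrightarrow> g z = poly P z * \<gamma> z" "\<And>z. z \<in> disc \<tau> \<Longrightarrow> \<gamma> z \<noteq> 0"
    using zero_factorization[OF open_dom connected_dom Hol_holomorphic[OF assms(2)] assms(1) \<open>g 0 \<noteq> 0\<close>
        compact_disc[OF \<tau>(2)] \<open>disc \<tau> \<subseteq> \<Omega>\<close>] by blast
  have ord: "vanishes_to \<Omega> \<mu> (a \<mu>) f" if "\<mu> \<in> \<Omega>" for \<mu>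
    using le_zmult_iff[OF open_dom connected_dom that f(1)] f(2)[OF that] a[OF that] by simp
  have "\<exists>s\<in>S. \<exists>k. k holomorphic_on \<Omega> \<and> (\<forall>z\<in>\<Omega>. f z - s z = poly P z * k z)"
    by (rule interpolate[OF P(1-3) Hol_holomorphic[OF f(1)]]) (simp_all add: ord)
  then obtain s k where s: "s \<in> S" "k holomorphic_on \<Omega>" "\<And>z. z \<in> \<Omega> \<Longrightarrow> f z - s z = poly P z * k z"
    by blast
  have "continuous_on K g"
    using Hol_holomorphic[OF assms(2)] K(2) holomorphic_on_imp_continuous_on continuous_on_subset by blast
  then have "bounded (g ` K)" using K(1) by (intro compact_imp_bounded compact_continuous_image)
  then obtain M where M: "M > 0" "\<And>z. z \<in> K \<Longrightarrow> cmod (g z) \<le> M"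
    unfolding bounded_pos by auto
  define U where "U = {z \<in> \<Omega>. cmod (\<phi> z) < \<tau>}"
  \<comment> \<open>\<gamma> may have zeros outside \<open>disc \<tau>\<close>, so the quotient is
    at hand only on \<open>U\<close>; \<open>runge\<close> replaces it by an element of H(\<Omega>),
    with accuracy \<epsilon> / M to absorb the factor |g| \<le> M.\<close>
  have "(\<lambda>z. k z / \<gamma> z) holomorphic_on U"
    using s(2) P(2,4) by (intro holomorphic_intros) (auto simp: U_def mem_disc[OF \<tau>(2)] elim: holomorphic_on_subset)
  moreover have "\<psi> ` ball 0 \<tau> \<subseteq> U" using \<psi>_in \<phi>_\<psi> \<tau> by (auto simp: U_def)
  moreover have "\<psi> holomorphic_on ball 0 \<tau>" using \<psi>_hol \<tau> by (auto elim: holomorphic_on_subset)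
  ultimately have "(\<lambda>w. k (\<psi> w) / \<gamma> (\<psi> w)) holomorphic_on ball 0 \<tau>"
    using holomorphic_on_compose_gen[of \<psi> "ball 0 \<tau>" "\<lambda>z. k z / \<gamma> z" U] by (simp add: o_def)
  from runge[OF this r(1) \<tau>(1) less_imp_le[OF \<tau>(2)] divide_pos_pos[OF \<epsilon> M(1)]]
  obtain q where q: "q \<in> Hol \<Omega>" "\<And>w. cmod w \<le> r \<Longrightarrow> cmod (k (\<psi> w) / \<gamma> (\<psi> w) - q (\<psi> w)) < \<epsilon> / M"
    by blast
  show "\<exists>s\<in>S. \<forall>z\<in>K. cmod (s z - f z) < \<epsilon>"
  proof (intro bexI ballI)
    show "(\<lambda>z. s z + 1 * (g z * q z)) \<in> S" by (intro S_lincomb s ideal q)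
    fix z assume z: "z \<in> K"
    then have z\<Omega>: "z \<in> \<Omega>" using K by auto
    have "\<gamma> z \<noteq> 0" using P(4)[of z] r(3)[OF z] \<tau> z\<Omega> by (simp add: mem_disc)
    have "f z - (s z + 1 * (g z * q z)) = poly P z * k z - g z * q z"
      using s(3)[OF z\<Omega>] by (simp add: algebra_simps)
    also have "\<dots> = g z * (k z / \<gamma> z - q z)"
      using P(3)[OF z\<Omega>] \<open>\<gamma> z \<noteq> 0\<close> by (simp add: right_diff_distrib)
    finally have "cmod (s z + 1 * (g z * q z) - f z) = cmod (g z) * cmod (k z / \<gamma> z - q z)"
      by (metis norm_minus_commute norm_mult)
    also have "\<dots> \<le> M * cmod (k z / \<gamma> z - q z)" using M(2)[OF z] by (intro mult_right_mono) auto
    also have "\<dots> < M * (\<epsilon> / M)"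
      using q(2)[OF r(3)[OF z]] \<psi>_\<phi>[OF z\<Omega>] M(1) by (intro mult_strict_left_mono) auto
    finally show "cmod (s z + 1 * (g z * q z) - f z) < \<epsilon>" using M(1) by simp
  qed
qed

lemma separating_contour_functional:
  assumes "closedin (Hol_topology \<Omega>) S" "S \<subseteq> Hol \<Omega>" "cfun.subspace S" "x \<in> Hol \<Omega>" "x \<notin> S"
  obtains \<kappa> \<rho> J where "contour_functional \<Omega> \<phi> \<psi> \<kappa> \<rho> J" "\<And>s. s \<in> S \<Longrightarrow> J s = 0" "J x \<noteq> 0"
proof -
  obtain \<rho> b C L where b: "0 < \<rho>" "\<rho> < 1" "C \<ge> 0" "\<And>n. cmod (b n) \<le> C * \<rho> ^ n"
    "\<And>s. s \<in> S \<Longrightarrow> (\<lambda>n. coef s n * b n) sums 0" "L \<noteq> 0" "(\<lambda>n. coef x n * b n) sums L"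
    by (rule separate_point[OF assms], rule that, assumption+)
  obtain \<kappa> where \<kappa>: "\<And>\<tau>. \<rho> < \<tau> \<Longrightarrow> continuous_on (sphere 0 \<tau>) \<kappa>"
    "\<And>\<tau> f L. \<rho> < \<tau> \<Longrightarrow> \<tau> < 1 \<Longrightarrow> f \<in> Hol \<Omega> \<Longrightarrow> (\<lambda>n. coef f n * b n) sums L \<Longrightarrow>
       contour_integral (circlepath 0 \<tau>) (\<lambda>w. f (\<psi> w) * \<kappa> w) = 2 * pi * \<i> * L"
    using contour_representation[OF b(1,3,4)] by blast
  have sm: "summable (\<lambda>n. coef f n * b n)" if f: "f \<in> Hol \<Omega>" for f
  proof -
    define s where "s = (\<rho> + 1) / 2"
    have s: "0 < s" "s < 1" "\<rho> < s" using b by (auto simp: s_def)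
    obtain M where M: "M \<ge> 0" "\<And>n. cmod (coef f n) \<le> M / s ^ n" using coef_bound[OF f s(1,2)] by blast
    show ?thesis
    proof (rule summable_comparison_test')
      show "summable (\<lambda>n. M * C * (\<rho> / s) ^ n)" using s b by (intro summable_mult summable_geometric) auto
      show "norm (coef f n * b n) \<le> M * C * (\<rho> / s) ^ n" for n
      proof -
        have "norm (coef f n * b n) \<le> (M / s ^ n) * (C * \<rho> ^ n)"
          unfolding norm_mult using M b s by (intro mult_mono) auto
        then show ?thesis by (simp add: power_divide)
      qed
    qed
  qed
  \<comment> \<open>The factor is the 2 pi i of Cauchy's formula, which makes J equal to the contour
    integral itself.\<close>
  define J where "J = (\<lambda>f. 2 * pi * \<i> * (\<Sum>n. coef f n * b n))"
  show ?thesis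
  proof (rule that)
    show "contour_functional \<Omega> \<phi> \<psi> \<kappa> \<rho> J"
    proof
      show "J f = contour_integral (circlepath 0 \<tau>) (\<lambda>w. f (\<psi> w) * \<kappa> w)"
        if "\<rho> < \<tau>" "\<tau> < 1" "f \<in> Hol \<Omega>" for \<tau> f
        using \<kappa>(2)[OF that summable_sums[OF sm[OF that(3)]]] by (simp add: J_def)
    qed (use b \<kappa> in auto)
    show "J s = 0" if "s \<in> S" for s using b(5)[OF that] by (simp add: J_def sums_iff)
    show "J x \<noteq> 0" using b(6,7) by (simp add: J_def sums_iff)
  qed
qed

text \<open>
  For \<open>f \<in> S\<close> the function \<open>\<Phi> f z = J (dd (t f) g z)\<close> satisfies \<open>\<Phi> f z = z \<Phi> (D f) z\<close>, so it
  vanishes to infinite order at 0. This exhibits \<open>f / g\<close> as a quotient of Cauchy transforms that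
  are holomorphic off a compact subset of \<open>\<Omega>\<close>.
\<close>

lemma rational_of_not_ideal:
  assumes "0 \<in> \<Omega>" "g \<in> Hol \<Omega>" "g 0 = 1" and inv: "closed_invariant_subspace \<Omega> g S"
    and "q \<in> Hol \<Omega>" "(\<lambda>z. g z * q z) \<notin> S"
  obtains Q M where "Q \<noteq> 0"
    "\<And>f. f \<in> S \<Longrightarrow> \<exists>E. degree E \<le> M \<and> (\<forall>z\<in>\<Omega>. f z * poly Q z = g z * poly E z)"
proof -
  note g = Hol_holomorphic[OF assms(2)]
  have gq: "(\<lambda>z. g z * h z) \<in> Hol \<Omega>" if "h \<in> Hol \<Omega>" for h
    using that assms(2) by (intro Hol_times Hol_holomorphic)
  obtain \<kappa> \<rho> J where JS: "contour_functional \<Omega> \<phi> \<psi> \<kappa> \<rho> J" "\<And>s. s \<in> S \<Longrightarrow> J s = 0"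
    "J (\<lambda>z. g z * q z) \<noteq> 0"
    using separating_contour_functional[OF inv_closed[OF inv] _ inv_subspace[OF inv] gq[OF assms(5)] assms(6)]
      inv_subset_Hol[OF inv] by blast
  interpret contour_functional \<Omega> \<phi> \<psi> \<kappa> \<rho> J by (rule JS(1))
  interpret G: contour_functional \<Omega> \<phi> \<psi> "\<lambda>w. g (\<psi> w) * \<kappa> w" \<rho> "\<lambda>f. J (\<lambda>z. g z * f z)"
  proof
    show "continuous_on (sphere 0 \<tau>) (\<lambda>w. g (\<psi> w) * \<kappa> w)" if "\<rho> < \<tau>" "\<tau> < 1" for \<tau>
      by (rule fk_cont[OF g that])
    show "J (\<lambda>z. g z * f z) = contour_integral (circlepath 0 \<tau>) (\<lambda>w. f (\<psi> w) * (g (\<psi> w) * \<kappa> w))"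
      if "\<rho> < \<tau>" "\<tau> < 1" "f \<in> Hol \<Omega>" for \<tau> f
      using J[OF that(1,2) gq[OF that(3)]] by (simp add: mult_ac)
  qed (use \<rho> in auto)
  define t where "t = (\<lambda>f z. z * f z :: complex)"
  have t_hol: "t f holomorphic_on \<Omega>" if "f \<in> S" for f
    unfolding t_def using inv_subset_Hol[OF inv that] by (intro holomorphic_intros Hol_holomorphic)
  \<comment> \<open>The underlying identity is dd(t f) = g(z) f + z dd(t D f), the resolvent
    equation for D; J annihilates f.\<close>
  have step: "J (dd (t f) g z) = z * J (dd (t (pommiez \<Omega> g f)) g z)" if f: "f \<in> S" and z: "z \<in> \<Omega>" for f z
  proof -
    let ?D = "pommiez \<Omega> g f"
    have D: "?D \<in> S" by (rule inv_pommiez[OF inv f])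
    have fH: "f \<in> Hol \<Omega>" by (rule inv_subset_Hol[OF inv f])
    have ddH: "dd (t f) g z \<in> Hol \<Omega>" "dd (t ?D) g z \<in> Hol \<Omega>"
      using t_hol[OF f] t_hol[OF D] g z by (auto intro: dd_Hol)
    have "dd (t f) g z u = g z * f u + z * dd (t ?D) g z u" if u: "u \<in> \<Omega>" for u
    proof (rule linear_factor_cancel[OF open_dom _ _ _ u, of _ _ z 1])
      fix v assume v: "v \<in> \<Omega>"
      have "(v - z) * dd (t f) g z v = v * f v * g z - z * f z * g v"
        using dd_eq[OF v, of z "t f" g] by (simp add: t_def)
      moreover have "(v - z) * dd (t ?D) g z v = (f v - f 0 * g v) * g z - (f z - f 0 * g z) * g v"
        using dd_eq[OF v, of z "t ?D" g] pommiez_eq[of g, OF assms(3) v, of f] pommiez_eq[of g, OF assms(3) z, of f]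
        by (simp add: t_def)
      ultimately show "(v - z) ^ 1 * dd (t f) g z v = (v - z) ^ 1 * (g z * f v + z * dd (t ?D) g z v)"
        by (simp add: distrib_left mult.left_commute[of _ z]) (simp add: algebra_simps)
    qed (use ddH[THEN Hol_holomorphic] fH[THEN Hol_holomorphic] in
        \<open>auto intro!: holomorphic_on_imp_continuous_on holomorphic_on_add holomorphic_on_mult\<close>)
    then have "dd (t f) g z = (\<lambda>u. g z * f u + z * dd (t ?D) g z u)"
      using ddH fH by (intro Hol_eqI[of _ \<Omega>]) (auto simp: Hol_def intro!: holomorphic_intros g)
    then show ?thesis using J_lincomb[OF fH ddH(2), of "g z" z] JS(2)[OF f] by simp
  qed
  have \<Phi>_hol: "(\<lambda>z. J (dd (t f) g z)) holomorphic_on \<Omega>" if "f \<in> S" for f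
    using t_hol[OF that] g by (rule J_dd_holomorphic)
  have "vanishes_to \<Omega> 0 n (\<lambda>z. J (dd (t f) g z))" if "f \<in> S" for f n
    using that
  proof (induction n arbitrary: f)
    case 0
    then show ?case by (intro vanishes_to_0 \<Phi>_hol)
  next
    case (Suc n)
    obtain h where "h holomorphic_on \<Omega>" "\<And>z. z \<in> \<Omega> \<Longrightarrow> J (dd (t (pommiez \<Omega> g f)) g z) = (z - 0) ^ n * h z"
      using vanishes_toE[OF Suc.IH[OF inv_pommiez[OF inv Suc.prems]]] by blast
    then show ?case using step[OF Suc.prems] by (intro vanishes_toI[of h]) auto
  qed
  then have "(deriv ^^ n) (\<lambda>z. J (dd (t f) g z)) 0 = 0" if "f \<in> S" for f n
    using vanishes_to_iff_deriv[OF open_dom assms(1) \<Phi>_hol[OF that], of "Suc n"] that by auto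
  then have \<Phi>0: "J (dd (t f) g z) = 0" if "f \<in> S" "z \<in> \<Omega>" for f z
    using holomorphic_fun_eq_0_on_connected[OF \<Phi>_hol[OF that(1)] open_dom connected_dom _ assms(1) that(2)] that(1)
    by blast
  define \<tau> where "\<tau> = (\<rho> + 1) / 2"
  have \<tau>: "\<rho> < \<tau>" "\<tau> < 1" "0 < \<tau>" using \<rho> by (auto simp: \<tau>_def)
  have "\<exists>z\<in>\<Omega>. \<tau> < cmod (\<phi> z) \<and> tr \<tau> g z \<noteq> 0"
  proof (rule ccontr)
    assume none: "\<not> ?thesis"
    have "G.tr \<tau> one z = tr \<tau> g z" for z
      unfolding cauchy_tr_def
    proof (rule contour_integral_eq)
      fix w assume "w \<in> path_image (circlepath 0 \<tau>)"
      then have "\<psi> w \<in> \<Omega>" using \<psi>_in[of w] \<tau> by simp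
      then show "one (\<psi> w) * (g (\<psi> w) * \<kappa> w) / (\<psi> w - z) = g (\<psi> w) * \<kappa> w / (\<psi> w - z)"
        by (simp add: one_def)
    qed
    with none have "J (\<lambda>z. g z * q z) = 0"
      using G.J_eq_0_of_tr_one[OF \<tau>(1,2) _ assms(5)] by auto
    with JS(3) show False by simp
  qed
  then obtain z1 where z1: "z1 \<notin> disc \<tau>" "tr \<tau> g z1 \<noteq> 0" using mem_disc[OF \<tau>(2)] not_le by blast
  have tr_out: "tr \<tau> f holomorphic_on - disc \<tau>" "(tr \<tau> f \<longlongrightarrow> 0) at_infinity" if "f holomorphic_on \<Omega>" for f
  proof -
    show "tr \<tau> f holomorphic_on - disc \<tau>"
      by (rule tr_holomorphic) (use that \<tau> open_outer in \<open>auto simp: mem_disc\<close>)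
    show "(tr \<tau> f \<longlongrightarrow> 0) at_infinity"
      using \<tau>(3) fk_cont[OF that \<tau>(1,2)] \<psi>_cont_sphere[OF \<tau>(2)] by (rule cauchy_tr_tendsto_0)
  qed
  have g0: "g 0 \<noteq> 0" using assms by simp
  obtain Q M where Q: "Q \<noteq> 0"
    "\<And>f A. f holomorphic_on \<Omega> \<Longrightarrow> A holomorphic_on - disc \<tau> \<Longrightarrow> (A \<longlongrightarrow> 0) at_infinity \<Longrightarrow>
       (\<And>z. z \<in> \<Omega> - disc \<tau> \<Longrightarrow> g z * A z = f z * tr \<tau> g z) \<Longrightarrow>
       \<exists>E. degree E \<le> M \<and> (\<forall>z\<in>\<Omega>. f z * poly Q z = g z * poly E z)"
    using rational_of_cauchy_quotient[OF \<tau>(3,2) tr_out[OF g] z1 g assms(1) g0] by blast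
  show ?thesis
  proof (rule that)
    \<comment> \<open>The quotient statement was applied to t f, and the extra factor t passes into
      the denominator.\<close>
    show "pCons 0 Q \<noteq> 0" using Q by simp
    fix f assume f: "f \<in> S"
    have "g z * tr \<tau> (t f) z = t f z * tr \<tau> g z" if "z \<in> \<Omega> - disc \<tau>" for z
      using J_dd[OF t_hol[OF f] g _ \<tau>(1,2), of z] \<Phi>0[OF f, of z] that by (auto simp: mem_disc[OF \<tau>(2)])
    then obtain E where "degree E \<le> M" "\<forall>z\<in>\<Omega>. t f z * poly Q z = g z * poly E z"
      using Q(2)[OF t_hol[OF f] tr_out[OF t_hol[OF f]]] by blast
    then show "\<exists>E. degree E \<le> M \<and> (\<forall>z\<in>\<Omega>. f z * poly (pCons 0 Q) z = g z * poly E z)"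
      by (intro exI[of _ E]) (auto simp: t_def mult_ac)
  qed
qed

end

section \<open>Invariant spaces of polynomials\<close>

text \<open>A linear condition on coefficients which the zero polynomial satisfies for every n, and
  for n = 0 alone; thus n is the dimension of the space it cuts out.\<close>

definition deg_lt :: "nat \<Rightarrow> complex poly \<Rightarrow> bool" where
  "deg_lt n p \<longleftrightarrow> (\<forall>i\<ge>n. coeff p i = 0)"

lemma deg_lt_iff: "deg_lt n p \<longleftrightarrow> p = 0 \<or> degree p < n"
proof
  assume "deg_lt n p"
  then show "p = 0 \<or> degree p < n"
    by (metis deg_lt_def leading_coeff_0_iff not_le)
qed (auto simp: deg_lt_def coeff_eq_0)

lemma deg_lt_lincomb: "deg_lt n p \<Longrightarrow> deg_lt n q \<Longrightarrow> deg_lt n (p + smult c q)"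
  by (auto simp: deg_lt_def)

lemma deg_lt_mono: "deg_lt n p \<Longrightarrow> n \<le> m \<Longrightarrow> deg_lt m p"
  by (auto simp: deg_lt_def)

lemma deg_lt_mult: "deg_lt n p \<Longrightarrow> deg_lt (n + degree q) (p * q)"
  unfolding deg_lt_iff using degree_mult_le[of p q] by auto

lemma deg_lt_mult_cancel:
  assumes "deg_lt n (p * q)" "q \<noteq> 0"
  shows "deg_lt (n - degree q) p"
  using assms unfolding deg_lt_iff by (cases "p = 0") (auto simp: degree_mult_eq)

lemma root_factor: "poly p \<mu> = 0 \<Longrightarrow> \<exists>q. p = [:-\<mu>, 1:] * q" for p :: "complex poly"
  by (simp add: poly_eq_0_iff_dvd dvd_def)

lemma poly_dvd_of_function_multiple:
  fixes p q :: "complex poly"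
  assumes "q \<noteq> 0" "continuous_on UNIV k" "\<And>z. poly p z = poly q z * k z"
  shows "q dvd p"
  using assms(1,3)
proof (induction q arbitrary: p rule: complex_poly_root_induct)
  case (const c)
  then show ?case by (simp add: is_unit_triv unit_imp_dvd)
next
  case (root q \<mu>)
  have "poly p \<mu> = 0" using root.prems[of \<mu>] by simp
  then obtain p' where p': "p = [:-\<mu>, 1:] * p'" using root_factor by blast
  have "poly p' z = poly q z * k z" for z
    by (rule linear_factor_cancel[of UNIV "poly p'" "\<lambda>z. poly q z * k z" \<mu> 1])
      (use root.prems assms(2) in \<open>auto simp: p' algebra_simps intro!: continuous_intros\<close>)
  then have "q dvd p'" by (rule root.IH)
  then show ?case unfolding p' by (rule mult_dvd_mono[OF dvd_refl])
qed

text \<open>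
  \<open>V\<close> stands for the numerators of the elements of an invariant subspace with common
  denominator \<open>Q\<close>.
\<close>

locale numerator_space =
  fixes V :: "complex poly set" and Q :: "complex poly" and M :: nat
  assumes Q0: "poly Q 0 = 1"
    and V0: "0 \<in> V"
    and V_lincomb: "p \<in> V \<Longrightarrow> q \<in> V \<Longrightarrow> p + smult c q \<in> V"
    and V_shift: "p \<in> V \<Longrightarrow> \<exists>q\<in>V. pCons 0 q = p - smult (poly p 0) Q"
    and V_bounded: "p \<in> V \<Longrightarrow> degree p \<le> M"
    and V_no_root: "poly Q \<mu> = 0 \<Longrightarrow> \<exists>p\<in>V. poly p \<mu> \<noteq> 0"
begin

lemma Q_nz: "Q \<noteq> 0"
  using Q0 by auto

text \<open>Interpolation on the whole plane with \<open>Q\<close> in place of \<open>g\<close>: the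
  absence of common roots says that the minimal orders at the roots of \<open>Q\<close> are 0.
  Divisibility by an entire cofactor is then divisibility of polynomials.\<close>

lemma V_surj_mod: "\<exists>E\<in>V. Q dvd X - E"
proof -
  interpret shift_invariant UNIV "poly Q" "poly ` V" "\<lambda>_. 0"
  proof
    show "(\<lambda>_. 0) \<in> poly ` V" using V0 by (auto intro!: image_eqI[of _ _ 0])
    show "(\<lambda>z. s z + c * t z) \<in> poly ` V" if "s \<in> poly ` V" "t \<in> poly ` V" for s t c
    proof -
      from that obtain p q where "p \<in> V" "q \<in> V" "s = poly p" "t = poly q" by auto
      then show ?thesis by (intro image_eqI[of _ _ "p + smult c q"] V_lincomb) auto
    qed
    show "\<exists>t\<in>poly ` V. \<forall>z\<in>UNIV. z * t z = s z - s 0 * poly Q z" if "s \<in> poly ` V" for s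
    proof -
      from that obtain p where p: "p \<in> V" "s = poly p" by auto
      obtain q where q: "q \<in> V" "pCons 0 q = p - smult (poly p 0) Q" using V_shift[OF p(1)] by blast
      have "z * poly q z = poly p z - poly p 0 * poly Q z" for z
        using arg_cong[OF q(2), of "\<lambda>x. poly x z"] by simp
      then show ?thesis using q(1) p(2) by blast
    qed
    show "vanishes_to UNIV \<mu> 0 s" if "s \<in> poly ` V" for \<mu> s
      using that by (auto intro!: vanishes_to_0 holomorphic_intros)
    show "\<exists>s\<in>poly ` V. \<exists>h. h holomorphic_on UNIV \<and> h \<mu> \<noteq> 0 \<and> (\<forall>z\<in>UNIV. s z = (z - \<mu>) ^ 0 * h z)"
      if "poly Q \<mu> = 0" for \<mu>
    proof -
      from V_no_root[OF that] obtain p where "p \<in> V" "poly p \<mu> \<noteq> 0" by blast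
      then show ?thesis by (intro bexI[of _ "poly p"] exI[of _ "poly p"]) (auto intro!: holomorphic_intros)
    qed
  qed (auto simp: Q0 intro!: holomorphic_intros)
  have "\<exists>s\<in>poly ` V. \<exists>k. k holomorphic_on UNIV \<and> (\<forall>z\<in>UNIV. poly X z - s z = poly Q z * k z)"
    by (rule interpolate[of Q "\<lambda>_. 1"]) (auto simp: Q_nz intro!: holomorphic_intros vanishes_to_0)
  then obtain E k where E: "E \<in> V" "k holomorphic_on UNIV" "\<And>z. poly (X - E) z = poly Q z * k z"
    by auto
  then have "Q dvd X - E"
    using poly_dvd_of_function_multiple[OF Q_nz holomorphic_on_imp_continuous_on[OF E(2)] E(3)] by blast
  with E(1) show ?thesis by blast
qed

text \<open>
  The same device as in \<open>insert_factor\<close>: \<open>E - \<mu> D E\<close> acquires the factor \<open>t - \<mu>\<close>, and its degree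
  stays the same because it is at least the degree of \<open>Q\<close>.
\<close>

lemma kill_poles:
  assumes "A \<noteq> 0" "A dvd Q" "E \<in> V" "E \<noteq> 0" "degree Q \<le> degree E"
  shows "\<exists>E'\<in>V. A dvd E' \<and> E' \<noteq> 0 \<and> degree E' = degree E"
  using assms(1,2)
proof (induction A rule: complex_poly_root_induct)
  case (const c)
  then show ?case using assms by (intro bexI[of _ E]) (auto simp: is_unit_triv unit_imp_dvd)
next
  case (root A \<mu>)
  have "A dvd Q" using root.prems dvd_mult_right by blast
  then obtain E' where E': "E' \<in> V" "A dvd E'" "E' \<noteq> 0" "degree E' = degree E" using root.IH by blast
  obtain q where q: "q \<in> V" "pCons 0 q = E' - smult (poly E' 0) Q" using V_shift[OF E'(1)] by blast
  define E2 where "E2 = E' + smult (-\<mu>) q"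
  have E2V: "E2 \<in> V" unfolding E2_def by (intro V_lincomb E' q)
  define c where "c = \<mu> * poly E' 0"
  have eq: "pCons 0 E2 = [:-\<mu>, 1:] * E' + smult c Q"
  proof -
    have "pCons 0 E2 = pCons 0 E' - smult \<mu> (pCons 0 q)" by (simp add: E2_def)
    also have "\<dots> = [:-\<mu>, 1:] * E' + smult c Q" unfolding q(2) by (simp add: c_def smult_diff_right)
    finally show ?thesis .
  qed
  have "[:-\<mu>, 1:] * A dvd pCons 0 E2"
    unfolding eq using root.prems E'(2) by (intro dvd_add dvd_smult mult_dvd_mono) auto
  then obtain W where W: "pCons 0 E2 = [:-\<mu>, 1:] * A * W" by (rule dvdE)
  obtain Y where Y: "Q = [:-\<mu>, 1:] * A * Y" using root.prems by (rule dvdE)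
  \<comment> \<open>Divisors of \<open>Q\<close> do not vanish at 0, so the factor t of
    \<open>pCons 0 E2\<close> sits in the cofactor and can be cancelled.\<close>
  have "poly ([:-\<mu>, 1:] * A) 0 \<noteq> 0" using Q0 unfolding Y by auto
  moreover have "poly ([:-\<mu>, 1:] * A) 0 * poly W 0 = 0"
    using arg_cong[OF W, of "\<lambda>p. poly p 0"] by simp
  ultimately have "poly W 0 = 0" by simp
  then obtain W' where "W = pCons 0 W'" by (metis pCons_cases poly_0_coeff_0 coeff_pCons_0)
  then have "pCons 0 E2 = pCons 0 ([:-\<mu>, 1:] * A * W')" using W by (simp only: mult_pCons_right smult_0_left add_0_left)
  then have "E2 = [:-\<mu>, 1:] * A * W'" by (metis pCons_eq_iff)
  then have dvd: "[:-\<mu>, 1:] * A dvd E2" by (rule dvdI)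
  have deg: "degree ([:-\<mu>, 1:] * E') = Suc (degree E')" using E'(3) by (subst degree_mult_eq) auto
  \<comment> \<open>The correction c Q has degree at most that of E', one less than that of (t -
    \<mu>) E', so it cannot cancel the leading term.\<close>
  have "degree (smult c Q) < degree ([:-\<mu>, 1:] * E')"
    unfolding deg using assms(5) E'(4) by (intro le_less_trans[OF degree_smult_le]) simp
  then have degE2: "degree (pCons 0 E2) = Suc (degree E')"
    unfolding eq using deg by (simp only: degree_add_eq_left)
  then have "E2 \<noteq> 0" by auto
  then show ?case using degE2 E'(4) E2V dvd by auto
qed

text \<open>Since Q(0) = 1, the shift of Q s is Q times s without its constant term, divided by t.
  Iterating yields multiples of Q with cofactors of every degree up to that of s, and these
  span.\<close>

lemma multiples_of_Q:
  assumes "Q * s \<in> V" "s \<noteq> 0" "degree X \<le> degree s"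
  shows "Q * X \<in> V"
  using assms
proof (induction "degree s" arbitrary: s X)
  case 0
  then obtain a b where "s = [:a:]" "a \<noteq> 0" "X = [:b:]" by (metis degree_eq_zeroE le_zero_eq pCons_0_0)
  then show ?case using V_lincomb[OF V0 0(2), of "b / a"] by simp
next
  case (Suc n)
  obtain q where q: "q \<in> V" "pCons 0 q = Q * s - smult (poly (Q * s) 0) Q" using V_shift[OF Suc.prems(1)] by blast
  obtain c s' where s': "s = pCons c s'" by (cases s)
  have "pCons 0 q = pCons 0 (Q * s')" using q(2) by (simp add: s' Q0)
  then have "Q * s' \<in> V" using q(1) by simp
  moreover have "n = degree s'" "s' \<noteq> 0" using Suc.hyps(2) by (auto simp: s' split: if_splits)
  ultimately have IH: "Q * Y \<in> V" if "degree Y \<le> n" for Y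
    using Suc.hyps(1)[of s' Y] that by auto
  define a where "a = coeff X (Suc n) / coeff s (Suc n)"
  have "coeff s (Suc n) \<noteq> 0" using Suc.hyps(2) Suc.prems(2) by (metis leading_coeff_0_iff)
  have "degree (X - smult a s) \<le> n"
  proof (rule degree_le, intro allI impI)
    fix i assume "n < i"
    then show "coeff (X - smult a s) i = 0"
      using \<open>coeff s (Suc n) \<noteq> 0\<close> Suc.prems(3) Suc.hyps(2)
      by (cases "i = Suc n") (auto simp: a_def coeff_eq_0)
  qed
  from V_lincomb[OF IH[OF this] Suc.prems(1), of a] show ?case by (simp add: algebra_simps)
qed

text \<open>Correct X modulo \<open>Q\<close> by an element of \<open>V\<close>. What remains is a
  multiple of \<open>Q\<close> of degree at most the maximum attained in \<open>V\<close>, and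
  \<open>kill_poles\<close> turns an element of maximal degree into a multiple of \<open>Q\<close>
  from which it is generated.\<close>

lemma eq_deg_lt:
  assumes "V \<noteq> {0}"
  shows "\<exists>m>0. degree Q \<le> m \<and> V = {p. deg_lt m p}"
proof -
  obtain E0 where "E0 \<in> V - {0}" using assms V0 by auto
  then obtain E1 where E1: "E1 \<in> V" "E1 \<noteq> 0" and max: "\<And>E. E \<in> V \<Longrightarrow> E \<noteq> 0 \<Longrightarrow> degree E \<le> degree E1"
    using ex_has_greatest_nat[of "\<lambda>E. E \<in> V - {0}" E0 degree "Suc M"] V_bounded by (auto simp: less_Suc_eq_le)
  define m where "m = max (degree Q) (Suc (degree E1))"
  have "V = {p. deg_lt m p}"
  proof (intro equalityI subsetI)
    fix p assume "p \<in> V"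
    then show "p \<in> {p. deg_lt m p}" using max[of p] by (cases "p = 0") (auto simp: deg_lt_iff m_def)
  next
    fix X assume "X \<in> {p. deg_lt m p}"
    then have X: "X = 0 \<or> degree X < m" by (simp add: deg_lt_iff)
    obtain E s where E: "E \<in> V" "X - E = Q * s" using V_surj_mod[of X] unfolding dvd_def by blast
    have "Q * s \<in> V"
    proof (cases "s = 0")
      case True then show ?thesis using V0 by simp
    next
      case False
      have "degree E \<le> degree E1" using max[OF E(1)] by (cases "E = 0") auto
      then have "degree (X - E) \<le> max (degree X) (degree E1)"
        using degree_diff_le_max[of X E] by linarith
      then have le: "degree Q + degree s \<le> max (degree X) (degree E1)"
        using E(2) False Q_nz by (simp add: degree_mult_eq)
      \<comment> \<open>If m = degree Q, then X has degree below degree Q and cannot account for a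
        nonzero multiple of Q; otherwise m = degree E1 + 1 and degree X \<le> degree E1
        already.\<close>
      have "degree Q + degree s \<le> degree E1" using le X by (auto simp: m_def)
      then have "degree Q \<le> degree E1" by simp
      then obtain E' where E': "E' \<in> V" "Q dvd E'" "E' \<noteq> 0" "degree E' = degree E1"
        using kill_poles[OF Q_nz dvd_refl E1] by blast
      obtain s' where s': "E' = Q * s'" using E'(2) by (rule dvdE)
      with E' have "s' \<noteq> 0" by auto
      then have "degree s \<le> degree s'"
        using E'(4) \<open>degree Q + degree s \<le> degree E1\<close> Q_nz by (simp add: s' degree_mult_eq)
      then show ?thesis using multiples_of_Q[OF _ \<open>s' \<noteq> 0\<close>] E'(1) by (simp add: s')
    qed
    from V_lincomb[OF E(1) this, of 1] show "X \<in> V" by (simp flip: E(2))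
  qed
  then show ?thesis by (intro exI[of _ m]) (auto simp: m_def)
qed

end

section \<open>Fractions and numerators\<close>

lemma regularize_eqI:
  assumes "open \<Omega>" "f \<in> Hol \<Omega>" "finite F" "\<And>z. z \<in> \<Omega> - F \<Longrightarrow> h z = f z"
  shows "regularize \<Omega> h = f"
proof
  fix z
  show "regularize \<Omega> h z = f z"
  proof (cases "z \<in> \<Omega>")
    case True
    have "open (\<Omega> - (F - {z}))" using assms by (intro open_Diff finite_imp_closed) auto
    moreover have "z \<in> \<Omega> - (F - {z})" using True by auto
    ultimately have "\<forall>\<^sub>F w in at z. w \<in> \<Omega> - (F - {z}) - {z}" by (rule eventually_at_in_open)
    then have "\<forall>\<^sub>F w in at z. f w = h w"
      by (rule eventually_mono) (use assms(4) in auto)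
    moreover have "(f \<longlongrightarrow> f z) (at z)"
    proof -
      have "continuous_on \<Omega> f" by (intro holomorphic_on_imp_continuous_on Hol_holomorphic assms)
      then show ?thesis using True assms(1) by (simp add: continuous_on_eq_continuous_at isCont_def)
    qed
    ultimately have "(h \<longlongrightarrow> f z) (at z)" by (rule Lim_transform_eventually[rotated])
    then have "remove_sings h z = f z" by (rule remove_sings_eqI)
    then show ?thesis using True by (simp add: regularize_def)
  next
    case False
    then show ?thesis using assms(2) by (simp add: regularize_def Hol_def)
  qed
qed

lemma quot_poly_eqI:
  assumes "open \<Omega>" "\<gamma> \<in> Hol \<Omega>" "p \<noteq> 0" "\<And>z. z \<in> \<Omega> \<Longrightarrow> \<gamma> z * poly p z = g z"
  shows "quot_poly \<Omega> g p = \<gamma>"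
  unfolding quot_poly_def
proof (rule regularize_eqI[OF assms(1,2)])
  show "finite {z. poly p z = 0}" using assms(3) by (rule poly_roots_finite)
  show "g z / poly p z = \<gamma> z" if "z \<in> \<Omega> - {z. poly p z = 0}" for z
    using assms(4)[of z] that by (auto simp: field_simps)
qed

lemma quot_poly_mult:
  assumes "open \<Omega>" "g holomorphic_on \<Omega>" "quot_poly \<Omega> g p \<in> Hol \<Omega>" "p \<noteq> 0" "z \<in> \<Omega>"
  shows "quot_poly \<Omega> g p z * poly p z = g z"
proof (rule eq_off_finite[OF assms(1) _ _ poly_roots_finite[OF assms(4)] _ assms(5)])
  fix w assume w: "w \<in> \<Omega> - {z. poly p z = 0}"
  have "open (\<Omega> - {z. poly p z = 0})"
    using assms(1) finite_imp_closed[OF poly_roots_finite[OF assms(4)]] by (rule open_Diff)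
  moreover have "(\<lambda>z. g z / poly p z) holomorphic_on \<Omega> - {z. poly p z = 0}"
    using assms(2) by (intro holomorphic_intros) (auto intro: holomorphic_on_subset)
  ultimately have "(\<lambda>z. g z / poly p z) analytic_on {w}"
    using w analytic_at by blast
  then have "quot_poly \<Omega> g p w = g w / poly p w"
    using w by (simp add: quot_poly_def regularize_def)
  then show "quot_poly \<Omega> g p w * poly p w = g w" using w by simp
qed (use assms Hol_holomorphic[OF assms(3)] in \<open>auto intro!: holomorphic_on_imp_continuous_on holomorphic_intros\<close>)

text \<open>The divisor of v. It encodes a finite variety off \<Omega> by one polynomial, so that
  \<open>C_minus\<close> becomes the space of proper fractions with denominator v.\<close>

definition root_variety :: "complex poly \<Rightarrow> (complex \<times> nat) set" where
  "root_variety v = {(\<mu>, order \<mu> v) | \<mu>. poly v \<mu> = 0}"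

text \<open>The values at the roots of v depend on the convention for division by 0 and are left
  out. They do no harm later, since the functions get multiplied by g, which vanishes off
  \<Omega>.\<close>

lemma C_minus_fraction:
  assumes "v \<noteq> 0" "h \<in> C_minus (root_variety v)"
  shows "\<exists>u. deg_lt (degree v) u \<and> (\<forall>z. poly v z \<noteq> 0 \<longrightarrow> h z = poly u z / poly v z)"
proof -
  let ?T = "{h. \<exists>u. deg_lt (degree v) u \<and> (\<forall>z. poly v z \<noteq> 0 \<longrightarrow> h z = poly u z / poly v z)}"
  have "cfun.subspace ?T"
  proof (rule cfun.subspaceI)
    show "0 \<in> ?T" by (auto intro!: exI[of _ 0] simp: deg_lt_def)
    show "x + y \<in> ?T" if "x \<in> ?T" "y \<in> ?T" for x y
    proof -
      from that obtain u u' where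
        "deg_lt (degree v) u" "\<forall>z. poly v z \<noteq> 0 \<longrightarrow> x z = poly u z / poly v z"
        "deg_lt (degree v) u'" "\<forall>z. poly v z \<noteq> 0 \<longrightarrow> y z = poly u' z / poly v z" by auto
      then show ?thesis
        using deg_lt_lincomb[of "degree v" u u' 1] by (auto intro!: exI[of _ "u + u'"] simp: add_divide_distrib)
    qed
    show "cscale c x \<in> ?T" if "x \<in> ?T" for c x
    proof -
      from that obtain u where
        "deg_lt (degree v) u" "\<forall>z. poly v z \<noteq> 0 \<longrightarrow> x z = poly u z / poly v z" by auto
      then show ?thesis
        by (auto intro!: exI[of _ "smult c u"] simp: cscale_def deg_lt_def)
    qed
  qed
  moreover have "{q_fun \<mu> k | \<mu> n k. (\<mu>, n) \<in> root_variety v \<and> 1 \<le> k \<and> k \<le> n} \<subseteq> ?T"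
  proof clarify
    fix \<mu> n k assume \<mu>: "(\<mu>, n) \<in> root_variety v" "1 \<le> k" "k \<le> n"
    then have "k \<le> order \<mu> v" by (auto simp: root_variety_def)
    then have "[:-\<mu>, 1:] ^ k dvd v" by (simp add: order_divides)
    then obtain w where w: "v = [:-\<mu>, 1:] ^ k * w" by (rule dvdE)
    have "w \<noteq> 0" using w assms(1) by auto
    have "degree v = k + degree w"
      unfolding w using \<open>w \<noteq> 0\<close> by (subst degree_mult_eq) (auto simp: degree_linear_power)
    then have "deg_lt (degree v) w" using \<mu>(2) by (simp add: deg_lt_iff)
    moreover have "q_fun \<mu> k z = poly w z / poly v z" if "poly v z \<noteq> 0" for z
      using that by (auto simp: w q_fun_def poly_power)
    ultimately show "\<exists>u. deg_lt (degree v) u \<and> (\<forall>z. poly v z \<noteq> 0 \<longrightarrow> q_fun \<mu> k z = poly u z / poly v z)"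
      by blast
  qed
  ultimately have "C_minus (root_variety v) \<subseteq> ?T"
    unfolding C_minus_def by (intro cfun.span_minimal)
  with assms(2) show ?thesis by blast
qed

text \<open>With v = (t - \<mu>)^j w, subtracting c w from u for a suitable c creates a root at
  \<mu>; this splits off the term c / (t - \<mu>)^(j+1) and leaves a fraction with denominator
  v.\<close>

lemma partial_fractions:
  assumes "v \<noteq> 0" "deg_lt (degree v) u"
  shows "\<exists>h\<in>C_minus (root_variety v). \<forall>z. poly v z \<noteq> 0 \<longrightarrow> h z = poly u z / poly v z"
  using assms
proof (induction v arbitrary: u rule: complex_poly_root_induct)
  case (const c)
  then have "u = 0" by (simp add: deg_lt_iff)
  then show ?case by (intro bexI[of _ 0]) (auto simp: C_minus_def cfun.span_zero)
next
  case (root v \<mu>)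
  let ?v = "[:-\<mu>, 1:] * v"
  define j where "j = order \<mu> v"
  obtain w where w: "v = [:-\<mu>, 1:] ^ j * w" "\<not> [:-\<mu>, 1:] dvd w"
    using order_decomp[OF \<open>v \<noteq> 0\<close>] unfolding j_def by blast
  then have w\<mu>: "poly w \<mu> \<noteq> 0" by (simp add: poly_eq_0_iff_dvd)
  have "degree w \<le> degree v"
    using w(1) \<open>v \<noteq> 0\<close> by (metis degree_mult_right_le dvd_0_right dvd_triv_right mult.commute mult_zero_left)
  have degv: "degree ?v = Suc (degree v)" using \<open>v \<noteq> 0\<close> by (subst degree_mult_eq) auto
  define c where "c = poly u \<mu> / poly w \<mu>"
  have "poly (u - smult c w) \<mu> = 0" using w\<mu> by (simp add: c_def)
  then obtain u' where u': "u - smult c w = [:-\<mu>, 1:] * u'" using root_factor by blast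
  have "deg_lt (Suc (degree v)) w" using \<open>degree w \<le> degree v\<close> by (simp add: deg_lt_iff)
  then have "deg_lt (Suc (degree v)) (u - smult c w)"
    using deg_lt_lincomb[of "Suc (degree v)" u w "- c"] root.prems unfolding degv by simp
  then have "deg_lt (Suc (degree v)) (u' * [:-\<mu>, 1:])" by (simp only: u' mult.commute)
  from deg_lt_mult_cancel[OF this] have "deg_lt (degree v) u'" by simp
  then obtain h where h: "h \<in> C_minus (root_variety v)" "\<And>z. poly v z \<noteq> 0 \<Longrightarrow> h z = poly u' z / poly v z"
    using root.IH by blast
  have ord: "order \<nu> ?v = order \<nu> [:-\<mu>, 1:] + order \<nu> v" for \<nu>
    by (rule order_mult, rule no_zero_divisors) (use \<open>v \<noteq> 0\<close> in auto)
  have "order \<mu> ?v = Suc j" using ord[of \<mu>] order_power_n_n[of \<mu> 1] by (simp add: j_def)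
  moreover have "(\<mu>, order \<mu> ?v) \<in> root_variety ?v"
    unfolding root_variety_def by (intro CollectI exI[of _ \<mu>]) simp
  ultimately have "(\<mu>, Suc j) \<in> root_variety ?v" by (simp only:)
  then have "q_fun \<mu> (Suc j) \<in> C_minus (root_variety ?v)"
    unfolding C_minus_def by (intro cfun.span_base) force
  moreover have "C_minus (root_variety v) \<subseteq> C_minus (root_variety ?v)"
    unfolding C_minus_def
  proof (rule cfun.span_mono, clarify)
    fix \<nu> n k assume \<nu>: "(\<nu>, n) \<in> root_variety v" "1 \<le> k" "k \<le> n"
    then have "(\<nu>, order \<nu> ?v) \<in> root_variety ?v" "k \<le> order \<nu> ?v"
      using ord[of \<nu>] by (auto simp: root_variety_def)
    with \<nu> show "\<exists>\<mu>' n k'. q_fun \<nu> k = q_fun \<mu>' k' \<and> (\<mu>', n) \<in> root_variety ?v \<and> 1 \<le> k' \<and> k' \<le> n"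
      by blast
  qed
  ultimately have "h + cscale c (q_fun \<mu> (Suc j)) \<in> C_minus (root_variety ?v)"
    using h(1) unfolding C_minus_def by (intro cfun.span_add cfun.span_scale) auto
  moreover have "(h + cscale c (q_fun \<mu> (Suc j))) z = poly u z / poly ?v z" if "poly ?v z \<noteq> 0" for z
  proof -
    have nz: "z - \<mu> \<noteq> 0" "poly v z \<noteq> 0" "poly w z \<noteq> 0" using that w(1) by auto
    have uz: "poly u z = (z - \<mu>) * poly u' z + c * poly w z"
      using arg_cong[OF u', of "\<lambda>p. poly p z"] by (simp add: algebra_simps)
    have vz: "poly v z = (z - \<mu>) ^ j * poly w z" by (subst w(1)) (simp add: poly_power)
    have "(h + cscale c (q_fun \<mu> (Suc j))) z = poly u' z / poly v z + c / (z - \<mu>) ^ Suc j"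
      using h(2)[OF nz(2)] by (simp add: cscale_def q_fun_def)
    also have "c / (z - \<mu>) ^ Suc j = c * poly w z / ((z - \<mu>) * poly v z)"
      using nz by (simp add: vz)
    also have "poly u' z / poly v z + \<dots> = poly u z / ((z - \<mu>) * poly v z)"
      unfolding uz using nz by (simp add: add_divide_distrib)
    finally show ?thesis by (simp add: algebra_simps)
  qed
  ultimately show ?case by blast
qed

text \<open>Division by v with a remainder that is a multiple of p, possible because p is a unit
  modulo v. After division by p v it reads E / (p v) = r / p + u / v.\<close>

lemma split_numerator:
  assumes "v \<noteq> 0" "\<And>\<mu>. poly v \<mu> = 0 \<Longrightarrow> poly p \<mu> \<noteq> 0"
  shows "\<exists>r u. E = r * v + u * p \<and> deg_lt (degree v) u"
  using assms
proof (induction v arbitrary: E rule: complex_poly_root_induct)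
  case (const c)
  then show ?case by (intro exI[of _ "smult (1 / c) E"] exI[of _ 0]) (auto simp: deg_lt_def)
next
  case (root v \<mu>)
  have p\<mu>: "poly p \<mu> \<noteq> 0" using root.prems[of \<mu>] by simp
  define c where "c = poly E \<mu> / poly p \<mu>"
  have "poly (E - smult c p) \<mu> = 0" using p\<mu> by (simp add: c_def)
  then obtain E' where E': "E - smult c p = [:-\<mu>, 1:] * E'" using root_factor by blast
  have "poly p \<nu> \<noteq> 0" if "poly v \<nu> = 0" for \<nu> using root.prems[of \<nu>] that by simp
  then obtain r u where ru: "E' = r * v + u * p" "deg_lt (degree v) u" using root.IH by blast
  have degv: "degree ([:-\<mu>, 1:] * v) = Suc (degree v)" using \<open>v \<noteq> 0\<close> by (subst degree_mult_eq) auto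
  have "E = [:-\<mu>, 1:] * E' + smult c p" using E' by (simp add: diff_eq_eq)
  also have "\<dots> = r * ([:-\<mu>, 1:] * v) + (u * [:-\<mu>, 1:] + [:c:]) * p"
    unfolding ru(1) by (simp add: algebra_simps)
  finally have eq: "E = r * ([:-\<mu>, 1:] * v) + (u * [:-\<mu>, 1:] + [:c:]) * p" .
  have "deg_lt (degree v + 1) (u * [:-\<mu>, 1:])" using deg_lt_mult[OF ru(2), of "[:-\<mu>, 1:]"] by simp
  moreover have "deg_lt (degree v + 1) [:c:]" by (simp add: deg_lt_iff)
  ultimately have "deg_lt (degree v + 1) (u * [:-\<mu>, 1:] + smult 1 [:c:])" by (rule deg_lt_lincomb)
  then have "deg_lt (degree ([:-\<mu>, 1:] * v)) (u * [:-\<mu>, 1:] + [:c:])" by (simp only: degv smult_1_left Suc_eq_plus1)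
  with eq show ?case by blast
qed

text \<open>The functions g E / Q with deg E < m. Clearing the denominator avoids choosing values at
  roots of Q inside \<Omega>.\<close>

definition model_space :: "complex set \<Rightarrow> (complex \<Rightarrow> complex) \<Rightarrow> complex poly \<Rightarrow> nat \<Rightarrow> (complex \<Rightarrow> complex) set" where
  "model_space \<Omega> g Q m = {f \<in> Hol \<Omega>. \<exists>E. deg_lt m E \<and> (\<forall>z\<in>\<Omega>. f z * poly Q z = g z * poly E z)}"

text \<open>Translates deg < k into the bound n of the formula; k = 0 is the case n =
  -\<infinity>.\<close>

definition pred_deg :: "nat \<Rightarrow> ereal" where
  "pred_deg k = (if k = 0 then -\<infinity> else ereal (real (k - 1)))"

lemma pdeg_le_pred_deg: "pdeg r \<le> pred_deg k \<longleftrightarrow> deg_lt k r"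
  by (auto simp: pdeg_def pred_deg_def deg_lt_iff)

text \<open>The bound on m guarantees that the contribution u p, of degree less than deg p + deg v,
  fits into the numerator space. In terms of n = m - deg v - 1 it is the condition n \<ge> deg p -
  1.\<close>

lemma fraction_space_eq:
  assumes "open \<Omega>" "g \<in> Hol \<Omega>" "p \<in> D_polys \<Omega> g" "v \<noteq> 0" "\<And>z. z \<in> \<Omega> \<Longrightarrow> poly v z \<noteq> 0"
    and m: "degree p + degree v \<le> m"
  shows "{\<lambda>z. quot_poly \<Omega> g p z * poly r z + g z * (poly u z / poly v z) | r u.
      deg_lt (m - degree v) r \<and> deg_lt (degree v) u} = model_space \<Omega> g (p * v) m" (is "?L = _")
proof (intro equalityI subsetI)
  let ?\<gamma> = "quot_poly \<Omega> g p"
  have p: "?\<gamma> \<in> Hol \<Omega>" "p \<noteq> 0" "\<And>z. poly p z = 0 \<Longrightarrow> z \<in> \<Omega>"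
    using assms(3) by (auto simp: D_polys_def)
  have \<gamma>: "?\<gamma> z * poly p z = g z" if "z \<in> \<Omega>" for z
    by (rule quot_poly_mult[OF assms(1) Hol_holomorphic[OF assms(2)] p(1,2) that])
  {
    fix f assume "f \<in> ?L"
    then obtain r u where ru: "deg_lt (m - degree v) r" "deg_lt (degree v) u"
      and f: "f = (\<lambda>z. ?\<gamma> z * poly r z + g z * (poly u z / poly v z))" by blast
    have "f \<in> Hol \<Omega>"
      unfolding f using p(1) assms(2,5) by (auto simp: Hol_def intro!: holomorphic_intros)
    moreover have "deg_lt m (r * v + smult 1 (u * p))"
      using deg_lt_mult[OF ru(1), of v] deg_lt_mult[OF ru(2), of p] m
      by (intro deg_lt_lincomb) (auto elim!: deg_lt_mono)
    moreover have "f z * poly (p * v) z = g z * poly (r * v + smult 1 (u * p)) z" if "z \<in> \<Omega>" for z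
    proof -
      have "f z * poly (p * v) z = (?\<gamma> z * poly p z) * poly r z * poly v z + g z * poly u z * poly p z"
        unfolding f using assms(5)[OF that] by (simp add: field_simps)
      then show ?thesis using \<gamma>[OF that] by (simp add: algebra_simps)
    qed
    ultimately show "f \<in> model_space \<Omega> g (p * v) m" unfolding model_space_def by blast
  next
    fix f assume "f \<in> model_space \<Omega> g (p * v) m"
    then obtain E where f: "f \<in> Hol \<Omega>" and E: "deg_lt m E" "\<And>z. z \<in> \<Omega> \<Longrightarrow> f z * poly (p * v) z = g z * poly E z"
      by (auto simp: model_space_def)
    obtain r u where ru: "E = r * v + u * p" "deg_lt (degree v) u"
      using split_numerator[OF assms(4), of p E] p(3) assms(5) by blast
    have "deg_lt m (E + smult (-1) (u * p))"
      using E(1) deg_lt_mult[OF ru(2), of p] m by (intro deg_lt_lincomb) (auto elim!: deg_lt_mono)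
    then have "deg_lt m (r * v)" by (simp add: ru(1))
    then have r: "deg_lt (m - degree v) r" using assms(4) by (rule deg_lt_mult_cancel)
    have "f z * poly v z = ?\<gamma> z * poly r z * poly v z + g z * poly u z" if "z \<in> \<Omega>" for z
    proof (rule poly_mult_cancel[OF assms(1) _ _ p(2) _ that])
      fix w assume w: "w \<in> \<Omega>"
      have "poly p w * (f w * poly v w) = ?\<gamma> w * poly p w * poly E w"
        using E(2)[OF w] \<gamma>[OF w] by (simp add: mult_ac)
      then show "poly p w * (f w * poly v w) = poly p w * (?\<gamma> w * poly r w * poly v w + g w * poly u w)"
        by (simp add: ru(1) \<gamma>[OF w, symmetric] algebra_simps)
    qed (use f[THEN Hol_holomorphic] p(1)[THEN Hol_holomorphic] assms(2)[THEN Hol_holomorphic] in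
        \<open>auto intro!: holomorphic_on_imp_continuous_on holomorphic_intros\<close>)
    then have "f z = ?\<gamma> z * poly r z + g z * (poly u z / poly v z)" if "z \<in> \<Omega>" for z
      using assms(5)[OF that] that by (simp add: field_simps)
    moreover have "f z = ?\<gamma> z * poly r z + g z * (poly u z / poly v z)" if "z \<notin> \<Omega>" for z
      using that f p(1) assms(2) by (simp add: Hol_def)
    ultimately have "f = (\<lambda>z. ?\<gamma> z * poly r z + g z * (poly u z / poly v z))" by blast
    then show "f \<in> ?L" using r ru(2) by blast
  }
qed

lemma fraction_sum_eq_model_space:
  assumes "open \<Omega>" "g \<in> Hol \<Omega>" "p \<in> D_polys \<Omega> g" "v \<noteq> 0" "\<And>z. z \<in> \<Omega> \<Longrightarrow> poly v z \<noteq> 0"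
    and m: "degree p + degree v \<le> m"
  shows "quot_poly \<Omega> g p *o polys_upto (pred_deg (m - degree v)) + g *o C_minus (root_variety v) =
    model_space \<Omega> g (p * v) m" (is "?L = _")
proof -
  let ?R = "{\<lambda>z. quot_poly \<Omega> g p z * poly r z + g z * (poly u z / poly v z) | r u.
      deg_lt (m - degree v) r \<and> deg_lt (degree v) u}"
  have "?L = ?R"
  proof (intro equalityI subsetI)
    fix f assume "f \<in> ?L"
    then obtain r h where r: "deg_lt (m - degree v) r" and h: "h \<in> C_minus (root_variety v)"
      and f: "f = quot_poly \<Omega> g p * poly r + g * h"
      by (auto simp: set_plus_def elt_set_times_def polys_upto_def pdeg_le_pred_deg)
    obtain u where u: "deg_lt (degree v) u" "\<And>z. poly v z \<noteq> 0 \<Longrightarrow> h z = poly u z / poly v z"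
      using C_minus_fraction[OF assms(4) h] by blast
    have "g z * h z = g z * (poly u z / poly v z)" for z
      using u(2)[of z] assms(2) assms(5)[of z] by (cases "z \<in> \<Omega>") (auto simp: Hol_def)
    then have "f = (\<lambda>z. quot_poly \<Omega> g p z * poly r z + g z * (poly u z / poly v z))"
      by (simp add: f fun_eq_iff)
    then show "f \<in> ?R" using r u(1) by blast
  next
    fix f assume "f \<in> ?R"
    then obtain r u where ru: "deg_lt (m - degree v) r" "deg_lt (degree v) u"
      and f: "f = (\<lambda>z. quot_poly \<Omega> g p z * poly r z + g z * (poly u z / poly v z))" by blast
    obtain h where h: "h \<in> C_minus (root_variety v)" "\<And>z. poly v z \<noteq> 0 \<Longrightarrow> h z = poly u z / poly v z"
      using partial_fractions[OF assms(4) ru(2)] by blast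
    have "g z * h z = g z * (poly u z / poly v z)" for z
      using h(2)[of z] assms(2) assms(5)[of z] by (cases "z \<in> \<Omega>") (auto simp: Hol_def)
    then have "f = quot_poly \<Omega> g p * poly r + g * h"
      by (simp add: f fun_eq_iff)
    then show "f \<in> ?L"
      using ru(1) h(1) by (auto simp: set_plus_def elt_set_times_def polys_upto_def pdeg_le_pred_deg)
  qed
  then show ?thesis using fraction_space_eq[OF assms] by simp
qed

lemma poly_of_variety:
  assumes "finite \<Upsilon>" "multiple_variety A \<Upsilon>"
  shows "\<exists>v. v \<noteq> 0 \<and> root_variety v = \<Upsilon> \<and> (\<forall>z. poly v z = 0 \<longrightarrow> z \<in> A)"
proof -
  have \<Upsilon>: "inj_on fst \<Upsilon>" "fst ` \<Upsilon> \<subseteq> A" "\<And>\<mu> m. (\<mu>, m) \<in> \<Upsilon> \<Longrightarrow> m \<ge> 1"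
    using assms(2) by (auto simp: multiple_variety_def)
  have "\<exists>v. v \<noteq> 0 \<and> root_variety v = \<Upsilon>"
    using assms(1) \<Upsilon>(1,3)
  proof (induction \<Upsilon> rule: finite_induct)
    case empty
    then show ?case by (intro exI[of _ 1]) (auto simp: root_variety_def)
  next
    case (insert x \<Upsilon>)
    obtain \<mu> m where x: "x = (\<mu>, m)" by (cases x)
    have "inj_on fst \<Upsilon>" "\<And>\<mu> m. (\<mu>, m) \<in> \<Upsilon> \<Longrightarrow> m \<ge> 1"
      using insert.prems by (auto simp: inj_on_insert)
    then obtain v where v: "v \<noteq> 0" "root_variety v = \<Upsilon>" using insert.IH by blast
    have m: "m \<ge> 1" using insert.prems(2)[of \<mu> m] x by simp
    have v\<mu>: "poly v \<mu> \<noteq> 0"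
    proof
      assume "poly v \<mu> = 0"
      then have "(\<mu>, order \<mu> v) \<in> \<Upsilon>" using v(2) by (auto simp: root_variety_def)
      then have "fst x \<in> fst ` \<Upsilon>" by (force simp: x)
      then show False using insert.prems(1) insert.hyps(2) by (auto simp: inj_on_insert)
    qed
    define w where "w = [:-\<mu>, 1:] ^ m * v"
    have "w \<noteq> 0" using v(1) by (simp add: w_def)
    have ord: "order \<nu> w = order \<nu> ([:-\<mu>, 1:] ^ m) + order \<nu> v" for \<nu>
      unfolding w_def using \<open>w \<noteq> 0\<close> by (intro order_mult) (simp add: w_def)
    have "order \<mu> w = m" using ord[of \<mu>] v\<mu> by (simp add: order_power_n_n order_0I)
    moreover have "order \<nu> w = order \<nu> v" if "\<nu> \<noteq> \<mu>" for \<nu>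
      using ord[of \<nu>] that by (simp add: order_0I poly_power)
    moreover have "poly w z = 0 \<longleftrightarrow> z = \<mu> \<or> poly v z = 0" for z
      using m by (auto simp: w_def poly_power)
    ultimately have "root_variety w = insert (\<mu>, m) (root_variety v)"
      using v\<mu> unfolding root_variety_def by (auto; metis)
    then show ?case using v(2) x \<open>w \<noteq> 0\<close> by blast
  qed
  then obtain v where "v \<noteq> 0" "root_variety v = \<Upsilon>" by blast
  then show ?thesis using \<Upsilon>(2) by (intro exI[of _ v]) (force simp: root_variety_def)
qed

section \<open>Invariance of the model spaces and of \<open>S(W)\<close>\<close>

lemma pommiez_Hol:
  assumes "open \<Omega>" "0 \<in> \<Omega>" "f \<in> Hol \<Omega>" "g \<in> Hol \<Omega>" "g 0 = 1"
  shows "pommiez \<Omega> g f \<in> Hol \<Omega>"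
proof -
  let ?F = "\<lambda>t. f t - f 0 * g t"
  note hol = Hol_holomorphic[OF assms(3)] Hol_holomorphic[OF assms(4)]
  have "(f has_field_derivative deriv f 0) (at 0)" "(g has_field_derivative deriv g 0) (at 0)"
    using holomorphic_derivI[OF hol(1) assms(1,2)] holomorphic_derivI[OF hol(2) assms(1,2)] by auto
  then have "(?F has_field_derivative (deriv f 0 - f 0 * deriv g 0)) (at 0)"
    by (auto intro!: derivative_eq_intros)
  then have d: "deriv ?F 0 = deriv f 0 - deriv g 0 * f 0" by (simp add: DERIV_imp_deriv mult.commute)
  have "(\<lambda>t. if t = 0 then deriv ?F 0 else (?F t - ?F 0) / (t - 0)) holomorphic_on \<Omega>"
    using assms(1,2) hol by (intro pole_lemma holomorphic_intros) (auto simp: interior_open)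
  then have "pommiez \<Omega> g f holomorphic_on \<Omega>"
    by (rule holomorphic_transform) (auto simp: pommiez_def d assms(5) mult.commute)
  then show ?thesis by (simp add: Hol_def pommiez_def)
qed

text \<open>Over a fixed denominator the operator acts on numerators as a backward shift with Q,
  normalized at 0, in the role of g. Invariance thus becomes a question about polynomials.\<close>

lemma pommiez_numerator:
  assumes "open \<Omega>" "0 \<in> \<Omega>" "f \<in> Hol \<Omega>" "g \<in> Hol \<Omega>" "g 0 = 1" "poly Q 0 \<noteq> 0"
    and E: "\<And>z. z \<in> \<Omega> \<Longrightarrow> f z * poly Q z = g z * poly E z"
  obtains E' where "pCons 0 E' = E - smult (poly E 0 / poly Q 0) Q"
    "\<And>z. z \<in> \<Omega> \<Longrightarrow> pommiez \<Omega> g f z * poly Q z = g z * poly E' z"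
proof -
  define c where "c = poly E 0 / poly Q 0"
  have f0: "f 0 = c" using E[OF assms(2)] assms(5,6) by (simp add: c_def field_simps)
  have "poly (E - smult c Q) 0 = 0" using assms(6) by (simp add: c_def)
  then obtain E' where E': "E - smult c Q = [:-0, 1:] * E'" using root_factor by blast
  then have E'': "pCons 0 E' = E - smult c Q" by simp
  have "pommiez \<Omega> g f z * poly Q z = g z * poly E' z" if "z \<in> \<Omega>" for z
  proof (rule linear_factor_cancel[OF assms(1) _ _ _ that, of _ _ 0 1])
    fix w assume w: "w \<in> \<Omega>"
    have "(w - 0) ^ 1 * (pommiez \<Omega> g f w * poly Q w) = (f w - c * g w) * poly Q w"
      using pommiez_eq[of g w \<Omega> f] assms(5) w by (simp add: f0 mult.assoc[symmetric])
    also have "\<dots> = g w * poly (E - smult c Q) w"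
      using E[OF w] by (simp add: algebra_simps)
    also have "\<dots> = (w - 0) ^ 1 * (g w * poly E' w)" unfolding E''[symmetric] by simp
    finally show "(w - 0) ^ 1 * (pommiez \<Omega> g f w * poly Q w) = (w - 0) ^ 1 * (g w * poly E' w)" .
  qed (use pommiez_Hol[OF assms(1-5), THEN Hol_holomorphic] Hol_holomorphic[OF assms(4)] in
      \<open>auto intro!: holomorphic_on_imp_continuous_on holomorphic_intros\<close>)
  with E'' show ?thesis using that by (simp add: c_def)
qed

lemma numerator_unique:
  assumes "open \<Omega>" "0 \<in> \<Omega>" "h holomorphic_on \<Omega>" "h 0 \<noteq> 0"
    and eq: "\<And>z. z \<in> \<Omega> \<Longrightarrow> h z * poly E z = h z * poly E' z"
  shows "E = E'"
proof (rule ccontr)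
  assume "E \<noteq> E'"
  then have fin: "finite {z. poly (E - E') z = 0}" by (intro poly_roots_finite) simp
  have "open (\<Omega> \<inter> h -` (- {0}))"
    using assms(1,3) by (intro continuous_open_preimage holomorphic_on_imp_continuous_on) auto
  moreover have "0 \<in> \<Omega> \<inter> h -` (- {0})" using assms by auto
  ultimately have "infinite (\<Omega> \<inter> h -` (- {0}))" using finite_imp_not_open by blast
  moreover have "\<Omega> \<inter> h -` (- {0}) \<subseteq> {z. poly (E - E') z = 0}" using eq by auto
  ultimately show False using fin finite_subset by blast
qed

lemma higher_deriv_poly_0: "(deriv ^^ i) (poly E) 0 = fact i * coeff E i"
proof -
  have "(deriv ^^ i) (poly E) = poly ((pderiv ^^ i) E)"
  proof (induction i)
    case (Suc i)
    then have "(deriv ^^ Suc i) (poly E) = deriv (poly ((pderiv ^^ i) E))" by simp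
    also have "\<dots> = poly ((pderiv ^^ Suc i) E)"
      by (auto simp: fun_eq_iff intro!: DERIV_imp_deriv poly_DERIV)
    finally show ?case .
  qed simp
  then show ?thesis
    by (simp add: poly_0_coeff_0 coeff_higher_pderiv pochhammer_fact)
qed

context
  fixes \<Omega> :: "complex set" and g :: "complex \<Rightarrow> complex" and \<gamma> :: "complex \<Rightarrow> complex"
    and Q :: "complex poly" and m :: nat
  assumes dom: "open \<Omega>" "connected \<Omega>" "0 \<in> \<Omega>"
    and g: "g \<in> Hol \<Omega>" "g 0 = 1"
    and Q: "poly Q 0 \<noteq> 0" "degree Q \<le> m"
    and \<gamma>: "\<gamma> \<in> Hol \<Omega>" "\<And>z. z \<in> \<Omega> \<Longrightarrow> \<gamma> z * poly Q z = g z"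
begin

lemma \<gamma>0: "\<gamma> 0 \<noteq> 0"
  using \<gamma>(2)[OF dom(3)] g(2) by auto

lemma mem_model_space:
  "f \<in> model_space \<Omega> g Q m \<longleftrightarrow> f \<in> Hol \<Omega> \<and> (\<exists>E. deg_lt m E \<and> (\<forall>z\<in>\<Omega>. f z = \<gamma> z * poly E z))"
proof -
  have "(\<forall>z\<in>\<Omega>. f z * poly Q z = g z * poly E z) \<longleftrightarrow> (\<forall>z\<in>\<Omega>. f z = \<gamma> z * poly E z)" if "f \<in> Hol \<Omega>" for E
  proof
    assume eq: "\<forall>z\<in>\<Omega>. f z * poly Q z = g z * poly E z"
    have "Q \<noteq> 0" using Q by auto
    have "f z = \<gamma> z * poly E z" if z: "z \<in> \<Omega>" for z
    proof (rule poly_mult_cancel[OF dom(1) _ _ \<open>Q \<noteq> 0\<close> _ z])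
      show "continuous_on \<Omega> f"
        by (intro holomorphic_on_imp_continuous_on Hol_holomorphic \<open>f \<in> Hol \<Omega>\<close>)
      show "continuous_on \<Omega> (\<lambda>z. \<gamma> z * poly E z)"
        by (intro holomorphic_on_imp_continuous_on holomorphic_intros Hol_holomorphic[OF \<gamma>(1)])
      show "poly Q w * f w = poly Q w * (\<gamma> w * poly E w)" if "w \<in> \<Omega>" for w
        using bspec[OF eq that] \<gamma>(2)[OF that] by (metis mult.assoc mult.commute)
    qed
    then show "\<forall>z\<in>\<Omega>. f z = \<gamma> z * poly E z" by blast
  next
    assume eq: "\<forall>z\<in>\<Omega>. f z = \<gamma> z * poly E z"
    show "\<forall>z\<in>\<Omega>. f z * poly Q z = g z * poly E z"
      using eq \<gamma>(2) by (metis mult.assoc mult.commute)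
  qed
  then show ?thesis unfolding model_space_def by blast
qed

text \<open>Membership amounts to the vanishing of all Taylor coefficients of \<open>f / \<gamma>\<close> at 0 from the \<open>m\<close>-th on.\<close>

lemma model_space_closed: "closedin (Hol_topology \<Omega>) (model_space \<Omega> g Q m)"
proof -
  have "f \<in> model_space \<Omega> g Q m"
    if f: "f \<in> Hol \<Omega>" and approx: "\<And>K \<epsilon>. compact K \<Longrightarrow> K \<subseteq> \<Omega> \<Longrightarrow> \<epsilon> > 0 \<Longrightarrow>
        \<exists>s\<in>model_space \<Omega> g Q m. \<forall>z\<in>K. cmod (s z - f z) < \<epsilon>" for f
  proof -
    have "open (\<Omega> \<inter> \<gamma> -` (- {0}))"
      using dom Hol_holomorphic[OF \<gamma>(1)]
      by (intro continuous_open_preimage holomorphic_on_imp_continuous_on) auto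
    \<comment> \<open>On this ball \<gamma> has no zeros, so uniform approximation of f yields
      uniform approximation of f / \<gamma> by polynomials of bounded degree.\<close>
    then obtain \<delta> where \<delta>: "\<delta> > 0" "cball 0 \<delta> \<subseteq> \<Omega> \<inter> \<gamma> -` (- {0})"
      using dom(3) \<gamma>0 unfolding open_contains_cball by blast
    have cont: "continuous_on (cball 0 \<delta>) (\<lambda>z. cmod (\<gamma> z))"
      using \<delta>(2) Hol_holomorphic[OF \<gamma>(1)]
      by (intro continuous_intros) (meson continuous_on_subset holomorphic_on_imp_continuous_on le_inf_iff)
    obtain x where x: "x \<in> cball 0 \<delta>" "\<And>z. z \<in> cball 0 \<delta> \<Longrightarrow> cmod (\<gamma> x) \<le> cmod (\<gamma> z)"
      using continuous_attains_inf[OF compact_cball _ cont] \<delta>(1) by (metis cball_eq_empty less_le_not_le)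
    define c where "c = cmod (\<gamma> x)"
    have "c > 0" using x(1) \<delta>(2) by (auto simp: c_def)
    define F where "F = (\<lambda>z. f z / \<gamma> z)"
    have sub: "cball 0 \<delta> \<subseteq> \<Omega>" "\<And>z. z \<in> cball 0 \<delta> \<Longrightarrow> \<gamma> z \<noteq> 0" using \<delta>(2) by auto
    have F_hol: "F holomorphic_on cball 0 \<delta>"
      unfolding F_def using sub Hol_holomorphic[OF f] Hol_holomorphic[OF \<gamma>(1)]
      by (intro holomorphic_intros) (auto intro: holomorphic_on_subset)
    have F_ball: "F holomorphic_on ball 0 \<delta>" using F_hol by (rule holomorphic_on_subset) auto
    have high: "(deriv ^^ i) F 0 = 0" if "i \<ge> m" for i
    proof (rule ccontr)
      assume ne: "(deriv ^^ i) F 0 \<noteq> 0"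
      \<comment> \<open>Chosen so that the Cauchy estimate bounds the i-th derivative of F at 0 by
        half of its own modulus.\<close>
      define \<epsilon> where "\<epsilon> = cmod ((deriv ^^ i) F 0) * \<delta> ^ i / (2 * fact i)"
      have "\<epsilon> > 0" using ne \<delta>(1) by (simp add: \<epsilon>_def)
      then obtain s where s: "s \<in> model_space \<Omega> g Q m" "\<forall>z\<in>cball 0 \<delta>. cmod (s z - f z) < \<epsilon> * c"
        using approx[OF compact_cball sub(1), of "\<epsilon> * c"] \<open>c > 0\<close> by auto
      obtain E where E: "deg_lt m E" "\<forall>z\<in>\<Omega>. s z = \<gamma> z * poly E z" using s(1) mem_model_space by blast
      have hol: "(\<lambda>z. poly E z - F z) holomorphic_on cball 0 \<delta>" by (intro holomorphic_intros F_hol)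
      have "cmod ((deriv ^^ i) (\<lambda>z. poly E z - F z) 0) \<le> fact i * \<epsilon> / \<delta> ^ i"
      proof (rule Cauchy_inequality)
        show "(\<lambda>z. poly E z - F z) holomorphic_on ball 0 \<delta>" using hol by (rule holomorphic_on_subset) auto
        show "continuous_on (cball 0 \<delta>) (\<lambda>z. poly E z - F z)" using hol by (rule holomorphic_on_imp_continuous_on)
        fix z assume "cmod (0 - z) = \<delta>"
        then have z: "z \<in> cball 0 \<delta>" by simp
        have "cmod (\<gamma> z) * cmod (poly E z - F z) = cmod (s z - f z)"
          using E(2) sub z by (simp add: F_def right_diff_distrib flip: norm_mult) (metis subsetD z)
        also have "\<dots> \<le> \<epsilon> * c" using s(2) z by (simp add: less_imp_le)
        also have "\<dots> \<le> cmod (\<gamma> z) * \<epsilon>"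
          using x(2)[OF z] \<open>\<epsilon> > 0\<close> unfolding c_def by (simp add: mult.commute mult_left_mono)
        finally show "cmod (poly E z - F z) \<le> \<epsilon>" using sub(2)[OF z] by simp
      qed (rule \<delta>(1))
      moreover have "(deriv ^^ i) (\<lambda>z. poly E z - F z) 0 = (deriv ^^ i) (poly E) 0 - (deriv ^^ i) F 0"
        using \<delta>(1) by (intro higher_deriv_diff[of _ "ball 0 \<delta>"] F_ball holomorphic_intros) auto
      moreover have "(deriv ^^ i) (poly E) 0 = 0"
        using E(1) that by (simp add: higher_deriv_poly_0 deg_lt_def)
      ultimately have "cmod ((deriv ^^ i) F 0) \<le> fact i * \<epsilon> / \<delta> ^ i" by simp
      also have "\<dots> = cmod ((deriv ^^ i) F 0) / 2" using \<delta>(1) by (simp add: \<epsilon>_def)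
      finally show False using ne by simp
    qed
    define E where "E = (\<Sum>i<m. monom (taylor F i) i)"
    have "deg_lt m E"
      unfolding deg_lt_def E_def by (auto simp: coeff_sum)
    moreover have "f z = \<gamma> z * poly E z" if "z \<in> \<Omega>" for z
    proof (rule analytic_continuation_open[of "ball (0::complex) \<delta>" \<Omega>, OF _ dom(1) _ dom(2) _ _ _ _ that])
      fix w :: complex assume w: "w \<in> ball 0 \<delta>"
      have "(\<lambda>n. taylor F n * w ^ n) sums F w" using w by (intro taylor_sums[OF F_ball]) simp
      moreover have "(\<lambda>n. taylor F n * w ^ n) sums (\<Sum>n<m. taylor F n * w ^ n)"
        by (rule sums_finite) (auto simp: taylor_def high)
      ultimately have "F w = poly E w"
        using sums_unique2 by (fastforce simp: E_def poly_sum poly_monom)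
      then show "f w = \<gamma> w * poly E w" using sub(2)[of w] w by (auto simp: F_def field_simps)
    qed (use \<delta>(1) sub(1) Hol_holomorphic[OF f] Hol_holomorphic[OF \<gamma>(1)] in \<open>auto intro!: holomorphic_intros\<close>)
    ultimately show ?thesis using f mem_model_space by blast
  qed
  then show ?thesis by (rule closedin_HolI) (auto simp: model_space_def)
qed

lemma model_space_invariant: "closed_invariant_subspace \<Omega> g (model_space \<Omega> g Q m)"
  unfolding closed_invariant_subspace_def
proof (intro conjI model_space_closed)
  show "model_space \<Omega> g Q m \<subseteq> Hol \<Omega>" by (auto simp: model_space_def)
  show "cfun.subspace (model_space \<Omega> g Q m)"
  proof (rule cfun.subspaceI)
    show "0 \<in> model_space \<Omega> g Q m"
      by (auto simp: model_space_def Hol_subspace deg_lt_def intro!: exI[of _ 0])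
    show "x + y \<in> model_space \<Omega> g Q m" if "x \<in> model_space \<Omega> g Q m" "y \<in> model_space \<Omega> g Q m" for x y
    proof -
      from that obtain E E' where "x \<in> Hol \<Omega>" "deg_lt m E" "\<forall>z\<in>\<Omega>. x z = \<gamma> z * poly E z"
        "y \<in> Hol \<Omega>" "deg_lt m E'" "\<forall>z\<in>\<Omega>. y z = \<gamma> z * poly E' z" unfolding mem_model_space by blast
      then show ?thesis
        using deg_lt_lincomb[of m E E' 1] unfolding mem_model_space
        by (auto simp: algebra_simps intro!: Hol_subspace exI[of _ "E + E'"])
    qed
    show "cscale c x \<in> model_space \<Omega> g Q m" if "x \<in> model_space \<Omega> g Q m" for c x
    proof -
      from that obtain E where "x \<in> Hol \<Omega>" "deg_lt m E" "\<forall>z\<in>\<Omega>. x z = \<gamma> z * poly E z"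
        unfolding mem_model_space by blast
      then show ?thesis
        unfolding mem_model_space
        by (auto simp: cscale_def deg_lt_def intro!: Hol_subspace(2)[unfolded cscale_def] exI[of _ "smult c E"])
    qed
  qed
  show "pommiez \<Omega> g ` model_space \<Omega> g Q m \<subseteq> model_space \<Omega> g Q m"
  proof (intro image_subsetI)
    fix f assume "f \<in> model_space \<Omega> g Q m"
    then obtain E where f: "f \<in> Hol \<Omega>" and E: "deg_lt m E" "\<And>z. z \<in> \<Omega> \<Longrightarrow> f z * poly Q z = g z * poly E z"
      by (auto simp: model_space_def)
    obtain E' where E': "pCons 0 E' = E - smult (poly E 0 / poly Q 0) Q"
      "\<And>z. z \<in> \<Omega> \<Longrightarrow> pommiez \<Omega> g f z * poly Q z = g z * poly E' z"
      using pommiez_numerator[OF dom(1,3) f g Q(1) E(2)] by blast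
    have "coeff E' i = 0" if "i \<ge> m" for i
    proof -
      have "coeff E' i = coeff (pCons 0 E') (Suc i)" by simp
      also have "\<dots> = 0" unfolding E'(1) using E(1) that Q(2) by (simp add: deg_lt_def coeff_eq_0)
      finally show ?thesis .
    qed
    then have "deg_lt m E'" by (simp add: deg_lt_def)
    then show "pommiez \<Omega> g f \<in> model_space \<Omega> g Q m"
      using pommiez_Hol[OF dom(1,3) f g] E'(2) unfolding model_space_def by blast
  qed
qed

lemma model_space_proper: "proper_in_Hol \<Omega> (model_space \<Omega> g Q m) \<longleftrightarrow> m > 0"
proof
  assume "proper_in_Hol \<Omega> (model_space \<Omega> g Q m)"
  moreover have "model_space \<Omega> g Q 0 \<subseteq> {0}" if "m = 0"
  proof
    fix f assume "f \<in> model_space \<Omega> g Q 0"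
    then have "f \<in> Hol \<Omega>" "\<forall>z\<in>\<Omega>. f z = 0"
      using mem_model_space[of f] that by (auto simp: deg_lt_iff)
    then have "f = 0" by (intro Hol_eqI[of f \<Omega>]) (auto intro: Hol_subspace)
    then show "f \<in> {0}" by simp
  qed
  moreover have "0 \<in> model_space \<Omega> g Q m"
    using cfun.subspace_0 model_space_invariant by (auto simp: closed_invariant_subspace_def)
  ultimately show "m > 0" unfolding proper_in_Hol_def by (cases "m = 0") auto
next
  assume m: "m > 0"
  have "\<gamma> \<in> model_space \<Omega> g Q m"
    unfolding mem_model_space using \<gamma>(1) m by (auto simp: deg_lt_iff intro!: exI[of _ 1])
  moreover have "\<gamma> \<noteq> 0" using \<gamma>0 by auto
  moreover have "(\<lambda>z. \<gamma> z * z ^ m) \<notin> model_space \<Omega> g Q m"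
  proof
    assume "(\<lambda>z. \<gamma> z * z ^ m) \<in> model_space \<Omega> g Q m"
    then obtain E where E: "deg_lt m E" "\<forall>z\<in>\<Omega>. \<gamma> z * z ^ m = \<gamma> z * poly E z"
      unfolding mem_model_space by blast
    have "monom 1 m = E"
      by (rule numerator_unique[OF dom(1,3) Hol_holomorphic[OF \<gamma>(1)] \<gamma>0]) (use E(2) in \<open>simp add: poly_monom\<close>)
    then show False using E(1) by (auto simp: deg_lt_def)
  qed
  moreover have "(\<lambda>z. \<gamma> z * z ^ m) \<in> Hol \<Omega>"
    using \<gamma>(1) by (intro Hol_times holomorphic_intros)
  ultimately show "proper_in_Hol \<Omega> (model_space \<Omega> g Q m)" unfolding proper_in_Hol_def by blast
qed

end

section \<open>The subspaces S(W)\<close>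

lemma S_of_variety_eq:
  assumes "open \<Omega>" "fst ` W \<subseteq> \<Omega>"
  shows "S_of_variety \<Omega> W = {f \<in> Hol \<Omega>. \<forall>(\<mu>, n)\<in>W. vanishes_to \<Omega> \<mu> n f}"
proof -
  have "(\<forall>(\<mu>, n)\<in>W. vanishes_to \<Omega> \<mu> n f) \<longleftrightarrow> (\<forall>(\<mu>, n)\<in>W. \<forall>j<n. (deriv ^^ j) f \<mu> = 0)"
    if "f \<in> Hol \<Omega>" for f
  proof (rule ball_cong[OF refl], clarify)
    fix \<mu> n assume "(\<mu>, n) \<in> W"
    then have "\<mu> \<in> \<Omega>" using assms(2) by (metis fst_conv image_subset_iff)
    then show "vanishes_to \<Omega> \<mu> n f \<longleftrightarrow> (\<forall>j<n. (deriv ^^ j) f \<mu> = 0)"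
      by (rule vanishes_to_iff_deriv[OF assms(1) _ Hol_holomorphic[OF that]])
  qed
  then show ?thesis
    unfolding S_of_variety_def by (intro Collect_cong conj_cong refl) simp
qed

lemma S_of_variety_closed:
  assumes "open \<Omega>" "fst ` W \<subseteq> \<Omega>"
  shows "closedin (Hol_topology \<Omega>) (S_of_variety \<Omega> W)"
proof -
  have "f \<in> S_of_variety \<Omega> W"
    if f: "f \<in> Hol \<Omega>" and approx: "\<And>K \<epsilon>. compact K \<Longrightarrow> K \<subseteq> \<Omega> \<Longrightarrow> \<epsilon> > 0 \<Longrightarrow>
        \<exists>s\<in>S_of_variety \<Omega> W. \<forall>z\<in>K. cmod (s z - f z) < \<epsilon>" for f
  proof -
    have "(deriv ^^ j) f \<mu> = 0" if \<mu>: "(\<mu>, n) \<in> W" "j < n" for \<mu> n j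
    proof (rule ccontr)
      assume ne: "(deriv ^^ j) f \<mu> \<noteq> 0"
      have "\<mu> \<in> \<Omega>" using \<mu>(1) assms(2) by force
      then obtain \<delta> where \<delta>: "\<delta> > 0" "cball \<mu> \<delta> \<subseteq> \<Omega>" using assms(1) open_contains_cball by blast
      define \<epsilon> where "\<epsilon> = cmod ((deriv ^^ j) f \<mu>) * \<delta> ^ j / (2 * fact j)"
      have "\<epsilon> > 0" using ne \<delta>(1) by (simp add: \<epsilon>_def)
      then obtain s where s: "s \<in> S_of_variety \<Omega> W" "\<forall>z\<in>cball \<mu> \<delta>. cmod (s z - f z) < \<epsilon>"
        using approx[OF compact_cball \<delta>(2)] by blast
      have hol: "s holomorphic_on \<Omega>" "f holomorphic_on \<Omega>" using s(1) f by (auto simp: S_of_variety_def Hol_def)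
      then have hol': "(\<lambda>z. s z - f z) holomorphic_on cball \<mu> \<delta>"
        using \<delta>(2) by (intro holomorphic_intros) (auto intro: holomorphic_on_subset)
      have "cmod ((deriv ^^ j) (\<lambda>z. s z - f z) \<mu>) \<le> fact j * \<epsilon> / \<delta> ^ j"
      proof (rule Cauchy_inequality)
        show "(\<lambda>z. s z - f z) holomorphic_on ball \<mu> \<delta>" using hol' by (rule holomorphic_on_subset) auto
        show "continuous_on (cball \<mu> \<delta>) (\<lambda>z. s z - f z)" using hol' by (rule holomorphic_on_imp_continuous_on)
        show "cmod (s z - f z) \<le> \<epsilon>" if "cmod (\<mu> - z) = \<delta>" for z
          using s(2) that by (simp add: less_imp_le dist_norm)
      qed (rule \<delta>(1))
      moreover have "(deriv ^^ j) (\<lambda>z. s z - f z) \<mu> = (deriv ^^ j) s \<mu> - (deriv ^^ j) f \<mu>"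
        using hol assms(1) \<open>\<mu> \<in> \<Omega>\<close> by (intro higher_deriv_diff)
      moreover have "(deriv ^^ j) s \<mu> = 0" using s(1) \<mu> by (auto simp: S_of_variety_def)
      ultimately have "cmod ((deriv ^^ j) f \<mu>) \<le> fact j * \<epsilon> / \<delta> ^ j" by simp
      also have "\<dots> = cmod ((deriv ^^ j) f \<mu>) / 2" using \<delta>(1) by (simp add: \<epsilon>_def)
      finally show False using ne by simp
    qed
    then show ?thesis using f by (auto simp: S_of_variety_def)
  qed
  then show ?thesis by (rule closedin_HolI) (auto simp: S_of_variety_def)
qed

text \<open>W lies below the zeros of g, so f - f(0) g satisfies the same vanishing conditions as f.
  Dividing by z preserves them, as no point of W is 0 because g(0) = 1. For properness, g belongs to
  the space and the constant 1 does not.\<close>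

lemma S_of_variety_invariant:
  assumes dom: "open \<Omega>" "connected \<Omega>" "0 \<in> \<Omega>" and g: "g \<in> Hol \<Omega>" "g 0 = 1"
    and W: "multiple_variety \<Omega> W" "W \<prec>\<^sub>v W_of_fun \<Omega> g"
  shows "closed_invariant_subspace \<Omega> g (S_of_variety \<Omega> W)" "W \<noteq> {} \<Longrightarrow> proper_in_Hol \<Omega> (S_of_variety \<Omega> W)"
proof -
  have sub: "fst ` W \<subseteq> \<Omega>" using W(1) by (simp add: multiple_variety_def)
  note eq = S_of_variety_eq[OF dom(1) sub]
  have g_nz: "g \<noteq> 0" using g(2) by auto
  have W': "\<mu> \<in> \<Omega>" "n \<ge> 1" "g \<mu> = 0" "vanishes_to \<Omega> \<mu> n g" if "(\<mu>, n) \<in> W" for \<mu> n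
  proof -
    show "n \<ge> 1" using W(1) that by (auto simp: multiple_variety_def)
    from bspec[OF W(2)[unfolded variety_le_def] that]
    obtain k where k: "(\<mu>, k) \<in> W_of_fun \<Omega> g" "n \<le> k" by auto
    then show \<mu>: "\<mu> \<in> \<Omega>" and "g \<mu> = 0" by (auto simp: W_of_fun_def zeros_def)
    obtain k' where "zmult g \<mu> = enat k'"
      using zmult_finite[OF dom(1,2) g(1) g_nz \<mu>] by metis
    then have "enat n \<le> zmult g \<mu>" using k by (auto simp: W_of_fun_def)
    then show "vanishes_to \<Omega> \<mu> n g" using le_zmult_iff[OF dom(1,2) \<mu> g(1)] by simp
  qed
  have g_mem: "g \<in> S_of_variety \<Omega> W" unfolding eq using g(1) W'(4) by auto
  show "closed_invariant_subspace \<Omega> g (S_of_variety \<Omega> W)"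
    unfolding closed_invariant_subspace_def
  proof (intro conjI S_of_variety_closed dom sub)
    show "S_of_variety \<Omega> W \<subseteq> Hol \<Omega>" by (auto simp: S_of_variety_def)
    show "cfun.subspace (S_of_variety \<Omega> W)"
    proof (rule cfun.subspaceI)
      show "0 \<in> S_of_variety \<Omega> W"
        unfolding eq by (auto intro: Hol_subspace intro!: vanishes_toI[of "\<lambda>_. 0"])
      show "x + y \<in> S_of_variety \<Omega> W" if "x \<in> S_of_variety \<Omega> W" "y \<in> S_of_variety \<Omega> W" for x y
      proof -
        have "vanishes_to \<Omega> \<mu> n (\<lambda>z. x z + 1 * y z)" if "(\<mu>, n) \<in> W" for \<mu> n
          using \<open>x \<in> _\<close> \<open>y \<in> _\<close> that unfolding eq by (intro vanishes_to_lincomb) auto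
        then show ?thesis
          using that Hol_subspace(1)[of x \<Omega> y] unfolding eq by (auto simp: plus_fun_def)
      qed
      show "cscale c x \<in> S_of_variety \<Omega> W" if "x \<in> S_of_variety \<Omega> W" for c x
      proof -
        have "vanishes_to \<Omega> \<mu> n (\<lambda>z. 0 + c * x z)" if "(\<mu>, n) \<in> W" for \<mu> n
        proof (rule vanishes_to_lincomb)
          show "vanishes_to \<Omega> \<mu> n (\<lambda>_. 0)" by (rule vanishes_toI[of "\<lambda>_. 0"]) auto
          show "vanishes_to \<Omega> \<mu> n x" using \<open>x \<in> _\<close> that unfolding eq by auto
        qed
        then show ?thesis
          using that Hol_subspace(2)[of x \<Omega> c] unfolding eq by (auto simp: cscale_def)
      qed
    qed
    show "pommiez \<Omega> g ` S_of_variety \<Omega> W \<subseteq> S_of_variety \<Omega> W"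
    proof (intro image_subsetI)
      fix f assume "f \<in> S_of_variety \<Omega> W"
      then have f: "f \<in> Hol \<Omega>" "\<And>\<mu> n. (\<mu>, n) \<in> W \<Longrightarrow> vanishes_to \<Omega> \<mu> n f" unfolding eq by auto
      have D: "pommiez \<Omega> g f \<in> Hol \<Omega>" by (rule pommiez_Hol[OF dom(1,3) f(1) g])
      have "vanishes_to \<Omega> \<mu> n (pommiez \<Omega> g f)" if \<mu>: "(\<mu>, n) \<in> W" for \<mu> n
      proof -
        have "vanishes_to \<Omega> \<mu> n (\<lambda>z. f z + (- f 0) * g z)"
          by (intro vanishes_to_lincomb f W' \<mu>)
        then obtain h where h: "h holomorphic_on \<Omega>" "\<And>z. z \<in> \<Omega> \<Longrightarrow> f z + (- f 0) * g z = (z - \<mu>) ^ n * h z"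
          using vanishes_toE by blast
        have zD: "z * pommiez \<Omega> g f z = (z - \<mu>) ^ n * h z" if "z \<in> \<Omega>" for z
          using pommiez_eq[of g z \<Omega> f] g(2) h(2)[OF that] that by simp
        have "\<mu> \<noteq> 0" using W'(3)[OF \<mu>] g(2) by auto
        then have "h 0 = 0" using zD[OF dom(3)] by simp
        then obtain k where k: "k holomorphic_on \<Omega>" "\<And>z. z \<in> \<Omega> \<Longrightarrow> h z = (z - 0) * k z"
          using divide_linear_factor[OF dom(1) h(1), of 0] by blast
        have "pommiez \<Omega> g f z = (z - \<mu>) ^ n * k z" if "z \<in> \<Omega>" for z
          by (rule linear_factor_cancel[OF dom(1) _ _ _ that, of _ _ 0 1])
            (use zD k Hol_holomorphic[OF D] in \<open>auto intro!: holomorphic_on_imp_continuous_on holomorphic_intros\<close>)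
        with k(1) show ?thesis by (rule vanishes_toI)
      qed
      then show "pommiez \<Omega> g f \<in> S_of_variety \<Omega> W" unfolding eq using D by auto
    qed
  qed
  show "proper_in_Hol \<Omega> (S_of_variety \<Omega> W)" if "W \<noteq> {}"
  proof -
    from that obtain \<mu> n where \<mu>: "(\<mu>, n) \<in> W" by auto
    define e where "e = (\<lambda>z. if z \<in> \<Omega> then 1 else 0 :: complex)"
    have "e holomorphic_on \<Omega>" by (rule holomorphic_transform[of "\<lambda>_. 1"]) (auto simp: e_def)
    then have "e \<in> Hol \<Omega>" by (simp add: Hol_def e_def)
    moreover have "(deriv ^^ 0) e \<mu> \<noteq> 0" using W'(1)[OF \<mu>] by (simp add: e_def)
    then have "e \<notin> S_of_variety \<Omega> W" using \<mu> W'(2)[OF \<mu>] unfolding S_of_variety_def by fastforce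
    ultimately show ?thesis using g_mem g_nz unfolding proper_in_Hol_def by blast
  qed
qed

lemma D_polys_quotient:
  assumes "open \<Omega>" "g \<in> Hol \<Omega>" "p \<in> D_polys \<Omega> g"
  shows "quot_poly \<Omega> g p \<in> Hol \<Omega>" "poly p 0 = 1" "p \<noteq> 0" "\<And>z. z \<notin> \<Omega> \<Longrightarrow> poly p z \<noteq> 0"
    "\<And>z. z \<in> \<Omega> \<Longrightarrow> quot_poly \<Omega> g p z * poly p z = g z"
proof -
  show p: "quot_poly \<Omega> g p \<in> Hol \<Omega>" "poly p 0 = 1" "\<And>z. z \<notin> \<Omega> \<Longrightarrow> poly p z \<noteq> 0"
    using assms(3) by (auto simp: D_polys_def)
  then show nz: "p \<noteq> 0" by auto
  show "quot_poly \<Omega> g p z * poly p z = g z" if "z \<in> \<Omega>" for z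
    by (rule quot_poly_mult[OF assms(1) Hol_holomorphic[OF assms(2)] p(1) nz that])
qed

lemma fraction_sum_invariant:
  assumes dom: "open \<Omega>" "connected \<Omega>" "0 \<in> \<Omega>" and g: "g \<in> Hol \<Omega>" "g 0 = 1"
    and p: "p \<in> D_polys \<Omega> g" and v: "v \<noteq> 0" "\<And>z. z \<in> \<Omega> \<Longrightarrow> poly v z \<noteq> 0"
    and m: "degree p + degree v \<le> m"
  defines "S \<equiv> quot_poly \<Omega> g p *o polys_upto (pred_deg (m - degree v)) + g *o C_minus (root_variety v)"
  shows "closed_invariant_subspace \<Omega> g S" "proper_in_Hol \<Omega> S \<longleftrightarrow> m > 0"
proof -
  note pD = D_polys_quotient[OF dom(1) g(1) p]
  define \<gamma> where "\<gamma> = (\<lambda>z. quot_poly \<Omega> g p z / poly v z)"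
  have \<gamma>: "\<gamma> \<in> Hol \<Omega>" using pD(1) v(2) by (auto simp: \<gamma>_def Hol_def intro!: holomorphic_intros)
  have \<gamma>Q: "\<gamma> z * poly (p * v) z = g z" if "z \<in> \<Omega>" for z
    using pD(5)[OF that] v(2)[OF that] by (simp add: \<gamma>_def)
  have Q: "poly (p * v) 0 \<noteq> 0" "degree (p * v) \<le> m"
    using pD(2) v(2)[OF dom(3)] m degree_mult_le[of p v] by auto
  have S: "S = model_space \<Omega> g (p * v) m"
    unfolding S_def by (rule fraction_sum_eq_model_space[OF dom(1) g(1) p v m])
  show "closed_invariant_subspace \<Omega> g S" "proper_in_Hol \<Omega> S \<longleftrightarrow> m > 0"
    unfolding S using model_space_invariant[OF dom g Q \<gamma> \<gamma>Q] model_space_proper[OF dom g Q \<gamma> \<gamma>Q] by auto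
qed

lemma fraction_sum_of_variety_invariant:
  assumes dom: "open \<Omega>" "connected \<Omega>" "0 \<in> \<Omega>" and g: "g \<in> Hol \<Omega>" "g 0 = 1"
    and p: "p \<in> D_polys \<Omega> g"
    and n: "n = -\<infinity> \<or> (\<exists>k::nat. n = ereal (real k) \<and> int k \<ge> int (degree p) - 1)"
    and \<Upsilon>: "finite \<Upsilon>" "multiple_variety (- \<Omega>) \<Upsilon>"
  defines "S \<equiv> quot_poly \<Omega> g p *o polys_upto n + g *o C_minus \<Upsilon>"
  shows "closed_invariant_subspace \<Omega> g S" "proper_in_Hol \<Omega> S \<longleftrightarrow> n \<noteq> -\<infinity> \<or> \<Upsilon> \<noteq> {}"
proof -
  obtain v where v: "v \<noteq> 0" "root_variety v = \<Upsilon>" "\<And>z. poly v z = 0 \<Longrightarrow> z \<notin> \<Omega>"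
    using poly_of_variety[OF \<Upsilon>] by auto
  have v_nz: "poly v z \<noteq> 0" if "z \<in> \<Omega>" for z using v(3) that by auto
  have \<Upsilon>_empty: "\<Upsilon> = {} \<longleftrightarrow> degree v = 0"
  proof
    assume "\<Upsilon> = {}"
    then have "\<nexists>z. poly v z = 0" using v(2) by (auto simp: root_variety_def)
    then show "degree v = 0" using alg_closed_imp_poly_has_root[of v] by auto
  next
    assume "degree v = 0"
    then show "\<Upsilon> = {}" using v(1,2) by (auto simp: root_variety_def elim!: degree_eq_zeroE)
  qed
  have "closed_invariant_subspace \<Omega> g S \<and> (proper_in_Hol \<Omega> S \<longleftrightarrow> n \<noteq> -\<infinity> \<or> \<Upsilon> \<noteq> {})"
  proof (cases "n = -\<infinity>")
    case True
    \<comment> \<open>For n = -\<infinity> the first summand is {0} for every denominator; with 1 as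
      denominator the degree condition holds for m = degree v.\<close>
    have one: "1 \<in> D_polys \<Omega> g"
      using quot_poly_eqI[OF dom(1) g(1), of 1 g] g(1) by (simp add: D_polys_def)
    have "polys_upto (-\<infinity>) = {0}" by (auto simp: polys_upto_def pdeg_def fun_eq_iff)
    then have "S = quot_poly \<Omega> g 1 *o polys_upto (pred_deg (degree v - degree v)) + g *o C_minus (root_variety v)"
      by (simp add: S_def True pred_deg_def v(2) elt_set_times_def)
    then show ?thesis
      using fraction_sum_invariant[OF dom g one v(1) v_nz, of "degree v"] True \<Upsilon>_empty by auto
  next
    case False
    then obtain k where k: "n = ereal (real k)" "int k \<ge> int (degree p) - 1" using n by auto
    \<comment> \<open>\<open>Suc k\<close> counts the coefficients of polynomials of degree at most
      k, and \<open>degree v\<close> those of the proper fractions.\<close>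
    define m where "m = Suc k + degree v"
    have m: "degree p + degree v \<le> m" using k(2) by (simp add: m_def)
    have "pred_deg (m - degree v) = n" by (simp add: m_def pred_deg_def k)
    then have "S = quot_poly \<Omega> g p *o polys_upto (pred_deg (m - degree v)) + g *o C_minus (root_variety v)"
      by (simp add: S_def v(2))
    then show ?thesis
      using fraction_sum_invariant[OF dom g p v(1) v_nz m] False by (simp add: m_def)
  qed
  then show "closed_invariant_subspace \<Omega> g S" "proper_in_Hol \<Omega> S \<longleftrightarrow> n \<noteq> -\<infinity> \<or> \<Upsilon> \<noteq> {}" by auto
qed

section \<open>Classification of the invariant subspaces\<close>

text \<open>At points that are not common zeros the minimal order is 0, so conditions over W(S)
  extend to all of \<Omega>; a nonzero element makes every minimal order finite, hence faithfully
  recorded by \<open>the_enat\<close>.\<close>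

lemma S_of_variety_W_of_set:
  assumes dom: "open \<Omega>" "connected \<Omega>" and S: "S \<subseteq> Hol \<Omega>" "s \<in> S" "s \<noteq> 0"
  shows "S_of_variety \<Omega> (W_of_set \<Omega> S) = {f \<in> Hol \<Omega>. \<forall>\<mu>\<in>\<Omega>. zmult_set S \<mu> \<le> zmult f \<mu>}"
proof -
  have fin: "zmult_set S \<mu> = enat (the_enat (zmult_set S \<mu>))" if "\<mu> \<in> \<Omega>" for \<mu>
  proof -
    obtain k where "zmult s \<mu> = enat k"
      using zmult_finite[OF dom _ S(3) \<open>\<mu> \<in> \<Omega>\<close>] S by (metis subsetD)
    moreover have "zmult_set S \<mu> \<le> zmult s \<mu>" unfolding zmult_set_def using S(2) by (rule INF_lower)
    ultimately show ?thesis by (cases "zmult_set S \<mu>") auto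
  qed
  have zs: "zeros_set \<Omega> S \<subseteq> \<Omega>" using S(2) by (auto simp: zeros_set_def zeros_def)
  have out: "zmult_set S \<mu> = 0" if "\<mu> \<in> \<Omega>" "\<mu> \<notin> zeros_set \<Omega> S" for \<mu>
  proof -
    from that obtain h where h: "h \<in> S" "h \<mu> \<noteq> 0" by (auto simp: zeros_set_def zeros_def)
    then have "zmult h \<mu> = 0" by (auto simp: zmult_def)
    moreover have "zmult_set S \<mu> \<le> zmult h \<mu>" unfolding zmult_set_def using h(1) by (rule INF_lower)
    ultimately show ?thesis by simp
  qed
  have sub: "fst ` W_of_set \<Omega> S \<subseteq> \<Omega>" using zs by (auto simp: W_of_set_def)
  have "(\<forall>(\<mu>, n)\<in>W_of_set \<Omega> S. vanishes_to \<Omega> \<mu> n f) \<longleftrightarrow> (\<forall>\<mu>\<in>\<Omega>. zmult_set S \<mu> \<le> zmult f \<mu>)"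
    if f: "f \<in> Hol \<Omega>" for f
  proof -
    have iff: "vanishes_to \<Omega> \<mu> (the_enat (zmult_set S \<mu>)) f \<longleftrightarrow> zmult_set S \<mu> \<le> zmult f \<mu>" if "\<mu> \<in> \<Omega>" for \<mu>
      using le_zmult_iff[OF dom that f, of "the_enat (zmult_set S \<mu>)"] fin[OF that] by simp
    have "(\<forall>(\<mu>, n)\<in>W_of_set \<Omega> S. vanishes_to \<Omega> \<mu> n f) \<longleftrightarrow>
        (\<forall>\<mu>\<in>zeros_set \<Omega> S. vanishes_to \<Omega> \<mu> (the_enat (zmult_set S \<mu>)) f)"
      by (auto simp: W_of_set_def)
    also have "\<dots> \<longleftrightarrow> (\<forall>\<mu>\<in>zeros_set \<Omega> S. zmult_set S \<mu> \<le> zmult f \<mu>)"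
      using iff zs by (intro ball_cong) auto
    also have "\<dots> \<longleftrightarrow> (\<forall>\<mu>\<in>\<Omega>. zmult_set S \<mu> \<le> zmult f \<mu>)"
      using zs out by (metis subsetD zero_le)
    finally show ?thesis .
  qed
  then show ?thesis
    unfolding S_of_variety_eq[OF dom(1) sub] by (intro Collect_cong conj_cong refl) simp
qed

section \<open>Polynomial factorizations and uniqueness of the decomposition\<close>

lemma poly_split_roots:
  fixes Q :: "complex poly"
  assumes "Q \<noteq> 0"
  shows "\<exists>p v. Q = p * v \<and> (\<forall>z. poly p z = 0 \<longrightarrow> z \<in> A) \<and> (\<forall>z. poly v z = 0 \<longrightarrow> z \<notin> A)"
  using assms
proof (induction Q rule: complex_poly_root_induct)
  case (const c)
  then show ?case by (intro exI[of _ "[:c:]"] exI[of _ 1]) auto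
next
  case (root Q \<mu>)
  then obtain p v where pv: "Q = p * v" "\<forall>z. poly p z = 0 \<longrightarrow> z \<in> A" "\<forall>z. poly v z = 0 \<longrightarrow> z \<notin> A" by blast
  show ?case
  proof (cases "\<mu> \<in> A")
    case True
    with pv show ?thesis by (intro exI[of _ "[:-\<mu>, 1:] * p"] exI[of _ v]) (auto simp: algebra_simps)
  next
    case False
    with pv show ?thesis by (intro exI[of _ p] exI[of _ "[:-\<mu>, 1:] * v"]) (auto simp: algebra_simps)
  qed
qed

lemma poly_eq_of_orders:
  fixes p q :: "complex poly"
  assumes "p \<noteq> 0" "q \<noteq> 0" "\<And>\<mu>. order \<mu> p = order \<mu> q" "poly p 0 = 1" "poly q 0 = 1"
  shows "p = q"
proof -
  have "\<exists>c. q = smult c p"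
    using assms(1-3)
  proof (induction p arbitrary: q rule: complex_poly_root_induct)
    case (const c)
    then have "\<nexists>\<mu>. poly q \<mu> = 0"
      by (metis order_0I order_root pCons_0_0 pCons_eq_0_iff poly_pCons mult_zero_right add_0_right poly_0)
    then obtain d where "q = [:d:]" using alg_closed_imp_poly_has_root[of q] by (metis degree_eq_zeroE neq0_conv)
    then show ?case using const.hyps by (intro exI[of _ "d / c"]) simp
  next
    case (root p \<mu>)
    have nz: "[:-\<mu>, 1:] * p \<noteq> 0" using root.hyps by (intro no_zero_divisors) auto
    have "order \<mu> ([:-\<mu>, 1:] * p) \<noteq> 0" using nz order_root[of "[:-\<mu>, 1:] * p" \<mu>] by simp
    then have "poly q \<mu> = 0" using root.prems order_root[of q \<mu>] by metis
    then obtain q' where q': "q = [:-\<mu>, 1:] * q'" using root_factor by blast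
    have "q' \<noteq> 0" using q' root.prems(1) by auto
    have "order \<nu> p = order \<nu> q'" for \<nu>
      using root.prems(2)[of \<nu>] order_mult[OF nz, of \<nu>] order_mult[of "[:-\<mu>, 1:]" q' \<nu>] root.prems(1)
      unfolding q' by simp
    then obtain c where "q' = smult c p" using root.IH \<open>q' \<noteq> 0\<close> by blast
    then show ?case by (intro exI[of _ c]) (simp add: q')
  qed
  then show ?thesis using assms(4,5) by auto
qed

lemma reduce_fraction:
  fixes u v :: "complex poly"
  assumes "v \<noteq> 0"
  shows "\<exists>u1 v1 w. v = v1 * w \<and> u = u1 * w \<and> lead_coeff v1 = 1 \<and> (\<forall>z. \<not> (poly u1 z = 0 \<and> poly v1 z = 0))"
  using assms
proof (induction "degree v" arbitrary: u v rule: less_induct)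
  case less
  show ?case
  proof (cases "\<exists>z. poly u z = 0 \<and> poly v z = 0")
    case True
    then obtain \<mu> u' v' where uv: "u = [:-\<mu>, 1:] * u'" "v = [:-\<mu>, 1:] * v'" using root_factor by meson
    then have "v' \<noteq> 0" using less.prems by auto
    then have "degree v' < degree v" unfolding uv by (subst degree_mult_eq) auto
    then obtain u1 v1 w where "v' = v1 * w" "u' = u1 * w" "lead_coeff v1 = 1"
      "\<forall>z. \<not> (poly u1 z = 0 \<and> poly v1 z = 0)" using less.hyps[OF _ \<open>v' \<noteq> 0\<close>] by metis
    then show ?thesis
      by (intro exI[of _ u1] exI[of _ v1] exI[of _ "[:-\<mu>, 1:] * w"]) (simp add: uv mult.left_commute)
  next
    case False
    define c where "c = lead_coeff v"
    have "c \<noteq> 0" using less.prems by (simp add: c_def)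
    then show ?thesis
      using False by (intro exI[of _ "smult (1 / c) u"] exI[of _ "smult (1 / c) v"] exI[of _ "[:c:]"])
        (auto simp: c_def)
  qed
qed

lemma dvd_of_no_common_root:
  fixes q :: "complex poly"
  assumes "q \<noteq> 0" "\<And>z. poly q z = 0 \<Longrightarrow> poly b z \<noteq> 0" "q dvd a * b"
  shows "q dvd a"
  using assms
proof (induction q arbitrary: a rule: complex_poly_root_induct)
  case (const c)
  then show ?case by (simp add: is_unit_triv unit_imp_dvd)
next
  case (root q \<mu>)
  obtain k where k: "a * b = [:-\<mu>, 1:] * q * k" using root.prems(2) by (rule dvdE)
  have "poly a \<mu> * poly b \<mu> = 0" using arg_cong[OF k, of "\<lambda>x. poly x \<mu>"] by simp
  then have "poly a \<mu> = 0" using root.prems(1)[of \<mu>] by simp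
  then obtain a' where a': "a = [:-\<mu>, 1:] * a'" using root_factor by blast
  have "[:-\<mu>, 1:] * (a' * b) = [:-\<mu>, 1:] * (q * k)" using k unfolding a' by (simp only: mult.assoc)
  then have "a' * b = q * k" by (metis mult_cancel_left one_neq_zero pCons_eq_0_iff)
  then have "q dvd a'" using root.IH[of a'] root.prems(1) by simp
  then show ?case unfolding a' by (rule mult_dvd_mono[OF dvd_refl])
qed

text \<open>Clearing denominators gives (r - r') v v' = p (u' v - u v'). The roots of p lie in
  \<Omega> and those of v v' off it, so r - r' = p s, and then s v v' = u' v - u v' forces s = 0 by
  degree. Coprimality and monic denominators settle u and v.\<close>

lemma is_decomp_unique:
  assumes dom: "open \<Omega>" "0 \<in> \<Omega>" and g: "g \<in> Hol \<Omega>" "g 0 = 1" and p: "p \<in> D_polys \<Omega> g"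
    and d: "is_decomp \<Omega> g p f r u v" "is_decomp \<Omega> g p f r' u' v'"
  shows "r = r' \<and> u = u' \<and> v = v'"
proof -
  note pD = D_polys_quotient[OF dom(1) g(1) p]
  have lc: "lead_coeff v = 1" "lead_coeff v' = 1" and nz: "v \<noteq> 0" "v' \<noteq> 0"
    and deg: "pdeg u < pdeg v" "pdeg u' < pdeg v'"
    and v\<Omega>: "\<And>z. z \<in> \<Omega> \<Longrightarrow> poly v z \<noteq> 0" "\<And>z. z \<in> \<Omega> \<Longrightarrow> poly v' z \<noteq> 0"
    and cop: "\<And>z. \<not> (poly u z = 0 \<and> poly v z = 0)" "\<And>z. \<not> (poly u' z = 0 \<and> poly v' z = 0)"
    using d by (auto simp: is_decomp_def)
  have eq: "r * v * v' + p * u * v' = r' * v * v' + p * u' * v"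
  proof (rule numerator_unique[OF dom Hol_holomorphic[OF g(1)]])
    show "g 0 \<noteq> 0" using g by simp
    fix z assume z: "z \<in> \<Omega>"
    let ?q = "quot_poly \<Omega> g p z"
    have "f z = ?q * poly r z + g z * (poly u z / poly v z)" "f z = ?q * poly r' z + g z * (poly u' z / poly v' z)"
      using d unfolding is_decomp_def by (metis, metis)
    then have "?q * poly r z + g z * (poly u z / poly v z) = ?q * poly r' z + g z * (poly u' z / poly v' z)"
      by simp
    then have "?q * poly r z * poly v z * poly v' z + g z * poly u z * poly v' z =
        ?q * poly r' z * poly v z * poly v' z + g z * poly u' z * poly v z"
      using v\<Omega>[OF z] by (simp add: field_simps)
    then have "(?q * poly r z * poly v z * poly v' z + g z * poly u z * poly v' z) * poly p z =
        (?q * poly r' z * poly v z * poly v' z + g z * poly u' z * poly v z) * poly p z" by simp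
    then show "g z * poly (r * v * v' + p * u * v') z = g z * poly (r' * v * v' + p * u' * v) z"
      by (simp add: pD(5)[OF z, symmetric] algebra_simps)
  qed
  then have eq': "(r - r') * (v * v') = p * (u' * v - u * v')" by (simp add: algebra_simps)
  have "p dvd r - r'"
  proof (rule dvd_of_no_common_root[OF pD(3)])
    show "p dvd (r - r') * (v * v')" unfolding eq' by simp
    show "poly (v * v') z \<noteq> 0" if "poly p z = 0" for z
      using pD(4)[of z] v\<Omega>[of z] that by (cases "z \<in> \<Omega>") auto
  qed
  then obtain s where s: "r - r' = p * s" by (rule dvdE)
  then have "p * (s * (v * v')) = p * (u' * v - u * v')" using eq' by (simp add: mult.assoc)
  then have sv: "s * (v * v') = u' * v - u * v'" using pD(3) by simp
  have below: "deg_lt (degree x) y" if "pdeg y < pdeg x" "x \<noteq> 0" for x y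
    using that by (auto simp: pdeg_def deg_lt_iff split: if_splits)
  have "deg_lt (degree v' + degree v) (u' * v + smult (-1) (u * v'))"
    using deg_lt_mult[OF below[OF deg(1) nz(1)], of v'] deg_lt_mult[OF below[OF deg(2) nz(2)], of v]
    by (intro deg_lt_lincomb) (auto simp: add.commute)
  then have "deg_lt (degree v' + degree v) (s * (v * v'))" by (simp add: sv)
  then have "deg_lt (degree v' + degree v - degree (v * v')) s" by (rule deg_lt_mult_cancel) (use nz in auto)
  then have "s = 0" using nz by (simp add: degree_mult_eq deg_lt_iff)
  then have "r = r'" and uv: "u' * v = u * v'" using s sv by auto
  have "v dvd v' * u" by (metis uv dvd_triv_right mult.commute)
  then have "v dvd v'" using dvd_of_no_common_root[OF nz(1)] cop(1) by blast
  moreover have "v' dvd v * u'" by (metis uv dvd_triv_right mult.commute)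
  then have "v' dvd v" using dvd_of_no_common_root[OF nz(2)] cop(2) by blast
  ultimately have "degree v = degree v'" using nz by (meson dvd_imp_degree_le order_antisym)
  moreover obtain k where k: "v' = v * k" using \<open>v dvd v'\<close> by (rule dvdE)
  ultimately have "degree k = 0" using nz by (auto simp: degree_mult_eq)
  then obtain c where "k = [:c:]" by (rule degree_eq_zeroE)
  then have "v = v'" using lc k by (simp split: if_splits)
  then have "u = u'" using uv nz by simp
  then show ?thesis using \<open>r = r'\<close> \<open>v = v'\<close> by blast
qed

text \<open>Take a common denominator of least degree. A root shared with all numerators could be
  cancelled, lowering the degree, so the numerators satisfy the assumptions of
  \<open>numerator_space\<close> and form a full space of bounded degree.\<close>

lemma rational_invariant_subspace:
  assumes dom: "open \<Omega>" "connected \<Omega>" "0 \<in> \<Omega>" and g: "g \<in> Hol \<Omega>" "g 0 = 1"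
    and inv: "closed_invariant_subspace \<Omega> g S" "S \<noteq> {0}"
    and rat: "Q0 \<noteq> 0" "\<And>f. f \<in> S \<Longrightarrow> \<exists>E. degree E \<le> M0 \<and> (\<forall>z\<in>\<Omega>. f z * poly Q0 z = g z * poly E z)"
  obtains Q m \<gamma> where "poly Q 0 = 1" "degree Q \<le> m" "m > 0" "S = model_space \<Omega> g Q m"
    "\<gamma> \<in> S" "\<And>z. z \<in> \<Omega> \<Longrightarrow> \<gamma> z * poly Q z = g z"
proof -
  have g0: "g 0 \<noteq> 0" using g by simp
  note g_hol = Hol_holomorphic[OF g(1)]
  define den where "den = (\<lambda>Q. Q \<noteq> 0 \<and>
      (\<exists>M. \<forall>f\<in>S. \<exists>E. degree E \<le> M \<and> (\<forall>z\<in>\<Omega>. f z * poly Q z = g z * poly E z)))"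
  have "den Q0" unfolding den_def using rat by blast
  then obtain Q1 where Q1: "den Q1" "\<And>Q. den Q \<Longrightarrow> degree Q1 \<le> degree Q"
    using ex_has_least_nat[of den Q0 degree] by blast
  \<comment> \<open>Stated for every denominator of least degree: it is used for \<open>Q1\<close>
    at the point 0 and then for the normalized multiple \<open>Q\<close>.\<close>
  have no_root: "\<exists>f\<in>S. \<exists>E. (\<forall>z\<in>\<Omega>. f z * poly Q z = g z * poly E z) \<and> poly E \<mu> \<noteq> 0"
    if Q: "den Q" "degree Q = degree Q1" and \<mu>: "poly Q \<mu> = 0" for Q \<mu>
  proof (rule ccontr)
    assume none: "\<not> ?thesis"
    obtain Q' where Q': "Q = [:-\<mu>, 1:] * Q'" using root_factor[OF \<mu>] by blast
    have nz: "Q' \<noteq> 0" using Q' Q(1) by (auto simp: den_def)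
    from Q(1) obtain M where M: "\<forall>f\<in>S. \<exists>E. degree E \<le> M \<and> (\<forall>z\<in>\<Omega>. f z * poly Q z = g z * poly E z)"
      by (auto simp: den_def)
    have "\<exists>E. degree E \<le> M \<and> (\<forall>z\<in>\<Omega>. f z * poly Q' z = g z * poly E z)" if f: "f \<in> S" for f
    proof -
      obtain E where E: "degree E \<le> M" "\<forall>z\<in>\<Omega>. f z * poly Q z = g z * poly E z" using M f by blast
      have "poly E \<mu> = 0" using none f E(2) by blast
      then obtain E' where E': "E = [:-\<mu>, 1:] * E'" using root_factor by blast
      have "degree E' \<le> degree E"
        unfolding E' by (cases "E' = 0") (auto simp: degree_mult_eq simp del: mult_pCons_left)
      moreover have "f z * poly Q' z = g z * poly E' z" if "z \<in> \<Omega>" for z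
        by (rule linear_factor_cancel[OF dom(1) _ _ _ that, of _ _ \<mu> 1])
          (use E(2) Hol_holomorphic[OF inv_subset_Hol[OF inv(1) f]] g_hol in
            \<open>auto simp: Q' E' algebra_simps intro!: holomorphic_on_imp_continuous_on holomorphic_intros\<close>)
      ultimately show ?thesis using E(1) by (intro exI[of _ E']) auto
    qed
    then have "den Q'" unfolding den_def using nz by blast
    moreover have "degree Q = Suc (degree Q')" unfolding Q' using nz by (subst degree_mult_eq) auto
    ultimately show False using Q1(2)[of Q'] Q(2) by simp
  qed
  \<comment> \<open>At z = 0 the relation f Q1 = g E reads f(0) Q1(0) = E(0), so a root of Q1 at 0
    would be shared by all numerators.\<close>
  have "poly Q1 0 \<noteq> 0"
  proof
    assume 0: "poly Q1 0 = 0"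
    obtain f E where "\<forall>z\<in>\<Omega>. f z * poly Q1 z = g z * poly E z" "poly E 0 \<noteq> 0"
      using no_root[OF Q1(1) refl 0] by blast
    then show False using bspec[of \<Omega> _ 0] dom(3) 0 g(2) by fastforce
  qed
  define c where "c = 1 / poly Q1 0"
  define Q where "Q = smult c Q1"
  have "c \<noteq> 0" using \<open>poly Q1 0 \<noteq> 0\<close> by (simp add: c_def)
  have Q_0: "poly Q 0 = 1" using \<open>poly Q1 0 \<noteq> 0\<close> by (simp add: Q_def c_def)
  have degQ: "degree Q = degree Q1" using \<open>c \<noteq> 0\<close> by (simp add: Q_def)
  obtain M where M: "\<And>f. f \<in> S \<Longrightarrow> \<exists>E. degree E \<le> M \<and> (\<forall>z\<in>\<Omega>. f z * poly Q z = g z * poly E z)"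
  proof -
    from Q1(1) obtain M where M: "\<forall>f\<in>S. \<exists>E. degree E \<le> M \<and> (\<forall>z\<in>\<Omega>. f z * poly Q1 z = g z * poly E z)"
      by (auto simp: den_def)
    have "\<exists>E. degree E \<le> M \<and> (\<forall>z\<in>\<Omega>. f z * poly Q z = g z * poly E z)" if "f \<in> S" for f
    proof -
      from M \<open>f \<in> S\<close> obtain E where "degree E \<le> M" "\<forall>z\<in>\<Omega>. f z * poly Q1 z = g z * poly E z" by blast
      then show ?thesis by (intro exI[of _ "smult c E"]) (auto simp: Q_def \<open>c \<noteq> 0\<close>)
    qed
    then show ?thesis using that by blast
  qed
  have "Q \<noteq> 0" using Q_0 by auto
  have "den Q" unfolding den_def using M \<open>Q \<noteq> 0\<close> by blast
  define V where "V = {E. \<exists>f\<in>S. \<forall>z\<in>\<Omega>. f z * poly Q z = g z * poly E z}"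
  interpret numerator_space V Q M
  proof
    show "poly Q 0 = 1" by (rule Q_0)
    show "0 \<in> V" unfolding V_def using inv_zero[OF inv(1)] by (auto intro!: bexI[of _ "\<lambda>_. 0"])
    show "p + smult a q \<in> V" if "p \<in> V" "q \<in> V" for p q a
    proof -
      from that obtain f h where fh: "f \<in> S" "h \<in> S"
        "\<forall>z\<in>\<Omega>. f z * poly Q z = g z * poly p z" "\<forall>z\<in>\<Omega>. h z * poly Q z = g z * poly q z"
        by (auto simp: V_def)
      then have "\<forall>z\<in>\<Omega>. (f z + a * h z) * poly Q z = g z * poly (p + smult a q) z"
        by (simp add: distrib_left distrib_right mult.assoc mult.left_commute[of _ a])
      then show ?thesis
        unfolding V_def by (intro CollectI bexI[of _ "\<lambda>z. f z + a * h z"] inv_lincomb[OF inv(1) fh(1,2)])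
    qed
    show "\<exists>q\<in>V. pCons 0 q = p - smult (poly p 0) Q" if "p \<in> V" for p
    proof -
      from that obtain f where f: "f \<in> S" "\<And>z. z \<in> \<Omega> \<Longrightarrow> f z * poly Q z = g z * poly p z"
        by (auto simp: V_def)
      have "poly Q 0 \<noteq> 0" using Q_0 by simp
      from pommiez_numerator[OF dom(1,3) inv_subset_Hol[OF inv(1) f(1)] g this f(2)]
      obtain q where "pCons 0 q = p - smult (poly p 0 / poly Q 0) Q"
        "\<And>z. z \<in> \<Omega> \<Longrightarrow> pommiez \<Omega> g f z * poly Q z = g z * poly q z" by blast
      then show ?thesis
        using inv_pommiez[OF inv(1) f(1)] Q_0 by (intro bexI[of _ q]) (auto simp: V_def)
    qed
    show "degree p \<le> M" if "p \<in> V" for p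
    proof -
      from that obtain f where f: "f \<in> S" "\<And>z. z \<in> \<Omega> \<Longrightarrow> f z * poly Q z = g z * poly p z"
        by (auto simp: V_def)
      obtain E where E: "degree E \<le> M" "\<forall>z\<in>\<Omega>. f z * poly Q z = g z * poly E z" using M[OF f(1)] by blast
      have "p = E"
        by (rule numerator_unique[OF dom(1,3) g_hol g0]) (use f(2) E(2) in force)
      then show ?thesis using E(1) by simp
    qed
    show "\<exists>p\<in>V. poly p \<mu> \<noteq> 0" if "poly Q \<mu> = 0" for \<mu>
      using no_root[OF \<open>den Q\<close> degQ that] unfolding V_def by blast
  qed
  have cancel: "f = h" if fh: "f \<in> Hol \<Omega>" "h \<in> Hol \<Omega>" "\<And>z. z \<in> \<Omega> \<Longrightarrow> f z * poly Q z = h z * poly Q z" for f h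
  proof (rule Hol_eqI[OF fh(1,2)])
    show "f z = h z" if "z \<in> \<Omega>" for z
      by (rule poly_mult_cancel[OF dom(1) _ _ \<open>Q \<noteq> 0\<close> _ that])
        (use fh(3) Hol_holomorphic[OF fh(1)] Hol_holomorphic[OF fh(2)] in
          \<open>auto intro!: holomorphic_on_imp_continuous_on simp: mult.commute\<close>)
  qed
  have "V \<noteq> {0}"
  proof
    assume V: "V = {0}"
    have "f = 0" if "f \<in> S" for f
    proof -
      obtain E where E: "\<forall>z\<in>\<Omega>. f z * poly Q z = g z * poly E z" using M[OF \<open>f \<in> S\<close>] by blast
      then have "E \<in> V" unfolding V_def using that by blast
      then have "E = 0" using V by simp
      then show ?thesis
        using E by (intro cancel inv_subset_Hol[OF inv(1) that] Hol_subspace) auto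
    qed
    then show False using inv(2) cfun.subspace_0[OF inv_subspace[OF inv(1)]] by blast
  qed
  then obtain m where m: "m > 0" "degree Q \<le> m" "V = {p. deg_lt m p}" using eq_deg_lt by blast
  have "S = model_space \<Omega> g Q m"
  proof (intro equalityI subsetI)
    fix f assume f: "f \<in> S"
    obtain E where E: "\<forall>z\<in>\<Omega>. f z * poly Q z = g z * poly E z" using M[OF f] by blast
    then have "E \<in> V" unfolding V_def using f by blast
    then show "f \<in> model_space \<Omega> g Q m"
      unfolding model_space_def using m(3) E inv_subset_Hol[OF inv(1) f] by blast
  next
    fix f assume "f \<in> model_space \<Omega> g Q m"
    then obtain E where f: "f \<in> Hol \<Omega>" and E: "E \<in> V" "\<forall>z\<in>\<Omega>. f z * poly Q z = g z * poly E z"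
      unfolding model_space_def m(3) by blast
    then obtain h where h: "h \<in> S" "\<forall>z\<in>\<Omega>. h z * poly Q z = g z * poly E z" by (auto simp: V_def)
    have "f = h" using E(2) h(2) by (intro cancel f inv_subset_Hol[OF inv(1) h(1)]) simp
    then show "f \<in> S" using h(1) by simp
  qed
  moreover have "1 \<in> V" using m by (simp add: deg_lt_iff)
  then obtain \<gamma> where "\<gamma> \<in> S" "\<And>z. z \<in> \<Omega> \<Longrightarrow> \<gamma> z * poly Q z = g z" by (auto simp: V_def)
  ultimately show ?thesis using that Q_0 m by blast
qed

section \<open>The invariants p_S, n(S) and Upsilon(S) of a model space\<close>

locale rational_subspace =
  fixes \<Omega> :: "complex set" and g :: "complex \<Rightarrow> complex" and p v :: "complex poly" and m :: nat
  assumes dom: "open \<Omega>" "connected \<Omega>" "0 \<in> \<Omega>" and g: "g \<in> Hol \<Omega>" "g 0 = 1"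
    and p: "p \<in> D_polys \<Omega> g" and v: "v \<noteq> 0" "\<And>z. z \<in> \<Omega> \<Longrightarrow> poly v z \<noteq> 0"
    and m: "degree p + degree v \<le> m" "m > 0"
begin

abbreviation "S \<equiv> model_space \<Omega> g (p * v) m"

abbreviation "\<gamma>p \<equiv> quot_poly \<Omega> g p"

definition \<gamma> :: "complex \<Rightarrow> complex" where "\<gamma> = (\<lambda>z. \<gamma>p z / poly v z)"

lemmas pD = D_polys_quotient[OF dom(1) g(1) p]

lemma \<gamma>_Hol: "\<gamma> \<in> Hol \<Omega>"
  using pD(1) v(2) by (auto simp: \<gamma>_def Hol_def intro!: holomorphic_intros)

lemma \<gamma>_mult: "z \<in> \<Omega> \<Longrightarrow> \<gamma> z * poly (p * v) z = g z"
  using pD(5)[of z] v(2)[of z] by (simp add: \<gamma>_def)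

lemma Q: "poly (p * v) 0 \<noteq> 0" "degree (p * v) \<le> m"
  using pD(2) v(2)[OF dom(3)] m degree_mult_le[of p v] by auto

lemma mem_S: "f \<in> S \<longleftrightarrow> f \<in> Hol \<Omega> \<and> (\<exists>E. deg_lt m E \<and> (\<forall>z\<in>\<Omega>. f z = \<gamma> z * poly E z))"
  by (rule mem_model_space[OF dom g Q \<gamma>_Hol \<gamma>_mult])

lemma S_eq: "S = {\<lambda>z. \<gamma>p z * poly r z + g z * (poly u z / poly v z) | r u.
      deg_lt (m - degree v) r \<and> deg_lt (degree v) u}"
  by (rule fraction_space_eq[OF dom(1) g(1) p v m(1), symmetric])

lemma \<gamma>_mem: "\<gamma> \<in> S"
  unfolding mem_S using \<gamma>_Hol m(2) by (auto simp: deg_lt_iff intro!: exI[of _ 1])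

lemma \<gamma>_nz: "\<gamma> \<noteq> 0"
  using \<gamma>_mult[OF dom(3)] g(2) by auto

lemma \<gamma>p_nz: "\<gamma>p \<noteq> 0"
  using pD(5)[OF dom(3)] g(2) by auto

lemma zmult_\<gamma>: "\<mu> \<in> \<Omega> \<Longrightarrow> zmult \<gamma>p \<mu> = zmult \<gamma> \<mu>"
proof -
  assume \<mu>: "\<mu> \<in> \<Omega>"
  obtain h k where h: "h holomorphic_on \<Omega>" "h \<mu> \<noteq> 0" "\<And>z. z \<in> \<Omega> \<Longrightarrow> \<gamma> z = (z - \<mu>) ^ k * h z" "zmult \<gamma> \<mu> = enat k"
    using zmult_finite[OF dom(1,2) \<gamma>_Hol \<gamma>_nz \<mu>] by metis
  have "zmult \<gamma>p \<mu> = enat k"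
  proof (rule zmult_eqI[OF dom(1) \<mu>])
    show "(\<lambda>z. h z * poly v z) holomorphic_on \<Omega>" by (intro holomorphic_intros h)
    show "h \<mu> * poly v \<mu> \<noteq> 0" using h(2) v(2)[OF \<mu>] by simp
    show "\<gamma>p z = (z - \<mu>) ^ k * (h z * poly v z)" if "z \<in> \<Omega>" for z
      using h(3)[OF that] v(2)[OF that] by (simp add: \<gamma>_def field_simps)
  qed
  then show ?thesis using h(4) by simp
qed

text \<open>Every element is a polynomial multiple of \<gamma>, itself an element, so \<gamma> has
  the least order everywhere; v has no zeros in \<Omega>, hence \<gamma> and g / p have equal
  orders.\<close>

lemma zmult_set_S: "\<mu> \<in> \<Omega> \<Longrightarrow> zmult_set S \<mu> = zmult \<gamma>p \<mu>"
proof (rule antisym)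
  assume \<mu>: "\<mu> \<in> \<Omega>"
  show "zmult_set S \<mu> \<le> zmult \<gamma>p \<mu>"
    unfolding zmult_\<gamma>[OF \<mu>] zmult_set_def using \<gamma>_mem by (rule INF_lower)
  obtain h k where h: "h holomorphic_on \<Omega>" "\<And>z. z \<in> \<Omega> \<Longrightarrow> \<gamma> z = (z - \<mu>) ^ k * h z" "zmult \<gamma> \<mu> = enat k"
    using zmult_finite[OF dom(1,2) \<gamma>_Hol \<gamma>_nz \<mu>] by metis
  show "zmult \<gamma>p \<mu> \<le> zmult_set S \<mu>"
    unfolding zmult_\<gamma>[OF \<mu>] zmult_set_def
  proof (rule INF_greatest)
    fix f assume "f \<in> S"
    then obtain E where f: "f \<in> Hol \<Omega>" "\<And>z. z \<in> \<Omega> \<Longrightarrow> f z = \<gamma> z * poly E z" unfolding mem_S by blast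
    have "vanishes_to \<Omega> \<mu> k f"
      by (rule vanishes_toI[of "\<lambda>z. h z * poly E z"]) (auto intro!: holomorphic_intros h simp: f(2) h(2))
    then show "zmult \<gamma> \<mu> \<le> zmult f \<mu>" using le_zmult_iff[OF dom(1,2) \<mu> f(1), of k] h(3) by simp
  qed
qed

lemma W_S: "W_of_set \<Omega> S = W_of_fun \<Omega> \<gamma>p"
proof -
  have "zeros_set \<Omega> S = zeros \<Omega> \<gamma>p"
  proof (intro equalityI subsetI)
    fix z assume "z \<in> zeros_set \<Omega> S"
    then have "z \<in> zeros \<Omega> \<gamma>" using \<gamma>_mem by (auto simp: zeros_set_def)
    then show "z \<in> zeros \<Omega> \<gamma>p" using v(2) by (auto simp: zeros_def \<gamma>_def)
  next
    fix z assume "z \<in> zeros \<Omega> \<gamma>p"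
    then have "z \<in> \<Omega>" "\<gamma> z = 0" by (auto simp: zeros_def \<gamma>_def)
    then show "z \<in> zeros_set \<Omega> S" unfolding zeros_set_def zeros_def by (auto simp: mem_S)
  qed
  then show ?thesis
    unfolding W_of_set_def W_of_fun_def using zmult_set_S by (auto simp: zeros_def)
qed

text \<open>The order of p at a point of \<Omega> is that of g minus that of g / p, and off \<Omega>
  it is 0. So W(g / p) determines all roots of p, and the value 1 at 0 fixes the constant.\<close>

lemma p_of_S: "p_of \<Omega> g S = p"
  unfolding p_of_def
proof (rule the_equality)
  show "p \<in> D_polys \<Omega> g \<and> W_of_set \<Omega> S = W_of_fun \<Omega> \<gamma>p" using p W_S by blast
  fix p' assume "p' \<in> D_polys \<Omega> g \<and> W_of_set \<Omega> S = W_of_fun \<Omega> (quot_poly \<Omega> g p')"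
  then have p': "p' \<in> D_polys \<Omega> g" and W: "W_of_fun \<Omega> (quot_poly \<Omega> g p') = W_of_fun \<Omega> \<gamma>p"
    using W_S by auto
  note pD' = D_polys_quotient[OF dom(1) g(1) p']
  let ?\<gamma>p' = "quot_poly \<Omega> g p'"
  have \<gamma>p'_nz: "?\<gamma>p' \<noteq> 0" using pD'(5)[OF dom(3)] g(2) by auto
  have zm: "zmult ?\<gamma>p' \<mu> = zmult \<gamma>p \<mu>" if \<mu>: "\<mu> \<in> \<Omega>" for \<mu>
  proof -
    obtain k where k: "zmult \<gamma>p \<mu> = enat k" using zmult_finite[OF dom(1,2) pD(1) \<gamma>p_nz \<mu>] by metis
    obtain k' where k': "zmult ?\<gamma>p' \<mu> = enat k'" using zmult_finite[OF dom(1,2) pD'(1) \<gamma>p'_nz \<mu>] by metis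
    have "fst ` W_of_fun \<Omega> f = zeros \<Omega> f" for f by (force simp: W_of_fun_def image_iff)
    then have z: "zeros \<Omega> ?\<gamma>p' = zeros \<Omega> \<gamma>p" using W by metis
    show ?thesis
    proof (cases "\<mu> \<in> zeros \<Omega> \<gamma>p")
      case True
      then have "(\<mu>, k) \<in> W_of_fun \<Omega> \<gamma>p" using k by (auto simp: W_of_fun_def)
      then have "(\<mu>, k) \<in> W_of_fun \<Omega> ?\<gamma>p'" using W by simp
      then show ?thesis using k k' by (auto simp: W_of_fun_def)
    next
      case False
      then have "\<gamma>p \<mu> \<noteq> 0" "?\<gamma>p' \<mu> \<noteq> 0" using z \<mu> by (auto simp: zeros_def)
      then show ?thesis by (auto simp: zmult_def)
    qed
  qed
  have "order \<mu> p' = order \<mu> p" for \<mu>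
  proof (cases "\<mu> \<in> \<Omega>")
    case \<mu>: True
    have sum: "zmult g \<mu> = enat (k + order \<mu> q)" if q: "q \<in> D_polys \<Omega> g" and k: "zmult (quot_poly \<Omega> g q) \<mu> = enat k" for q k
    proof -
      note qD = D_polys_quotient[OF dom(1) g(1) q]
      have "quot_poly \<Omega> g q \<noteq> 0" using qD(5)[OF dom(3)] g(2) by auto
      then obtain h where h: "h holomorphic_on \<Omega>" "h \<mu> \<noteq> 0" "\<And>z. z \<in> \<Omega> \<Longrightarrow> quot_poly \<Omega> g q z = (z - \<mu>) ^ k * h z"
        using zmult_finite[OF dom(1,2) qD(1) _ \<mu>] k by (metis enat.inject)
      obtain w where w: "q = [:-\<mu>, 1:] ^ order \<mu> q * w" "\<not> [:-\<mu>, 1:] dvd w"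
        using order_decomp[OF qD(3)] by blast
      show ?thesis
      proof (rule zmult_eqI[OF dom(1) \<mu>])
        show "(\<lambda>z. h z * poly w z) holomorphic_on \<Omega>" by (intro holomorphic_intros h)
        show "h \<mu> * poly w \<mu> \<noteq> 0" using h(2) w(2) by (simp add: poly_eq_0_iff_dvd)
        fix z assume z: "z \<in> \<Omega>"
        have "poly q z = (z - \<mu>) ^ order \<mu> q * poly w z" by (subst w(1)) (simp add: poly_power)
        then show "g z = (z - \<mu>) ^ (k + order \<mu> q) * (h z * poly w z)"
          using qD(5)[OF z] h(3)[OF z] by (simp add: power_add mult_ac)
      qed
    qed
    obtain k where k: "zmult \<gamma>p \<mu> = enat k" using zmult_finite[OF dom(1,2) pD(1) \<gamma>p_nz \<mu>] by metis
    then show ?thesis using sum[OF p k] sum[OF p', of k] zm[OF \<mu>] by simp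
  next
    case False
    then show ?thesis using pD(4) pD'(4) by (simp add: order_0I)
  qed
  then show "p' = p" using pD pD' by (intro poly_eq_of_orders) auto
qed

lemma decomp_eqI:
  assumes "f \<noteq> 0" "is_decomp \<Omega> g p f r u v'"
  shows "decomp \<Omega> g S f = (r, u, v')"
proof -
  have "(THE (r, u, v). is_decomp \<Omega> g p f r u v) = (r, u, v')"
  proof (rule the_equality)
    show "case (r, u, v') of (r, u, v) \<Rightarrow> is_decomp \<Omega> g p f r u v" using assms(2) by simp
    fix x assume "case x of (r, u, v) \<Rightarrow> is_decomp \<Omega> g p f r u v"
    then show "x = (r, u, v')"
      using is_decomp_unique[OF dom(1,3) g p _ assms(2)] by (auto split: prod.splits)
  qed
  then show ?thesis using assms(1) by (simp add: decomp_def p_of_S)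
qed

lemma decomp_S:
  assumes "f \<in> S"
  shows "deg_lt (m - degree v) (r_of \<Omega> g S f)" "v_of \<Omega> g S f dvd v"
proof -
  have "deg_lt (m - degree v) (r_of \<Omega> g S f) \<and> v_of \<Omega> g S f dvd v"
  proof (cases "f = 0")
    case True
    then show ?thesis by (simp add: r_of_def v_of_def decomp_def deg_lt_def)
  next
    case False
    obtain r u where ru: "deg_lt (m - degree v) r" "deg_lt (degree v) u"
      and f: "f = (\<lambda>z. \<gamma>p z * poly r z + g z * (poly u z / poly v z))"
      using assms unfolding S_eq by blast
    obtain u1 v1 w where uv: "v = v1 * w" "u = u1 * w" "lead_coeff v1 = 1"
      "\<forall>z. \<not> (poly u1 z = 0 \<and> poly v1 z = 0)" using reduce_fraction[OF v(1)] by metis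
    have nz: "v1 \<noteq> 0" "w \<noteq> 0" using uv(1) v(1) by auto
    have v1: "poly v1 z \<noteq> 0" "poly w z \<noteq> 0" if "z \<in> \<Omega>" for z using v(2)[OF that] uv(1) by auto
    have "deg_lt (degree v1) u1"
      using ru(2) nz unfolding uv(1,2) by (cases "u1 = 0") (auto simp: deg_lt_iff degree_mult_eq)
    then have "pdeg u1 < pdeg v1" using nz by (auto simp: pdeg_def deg_lt_iff)
    moreover have "g z * (poly u z / poly v z) = g z * (poly u1 z / poly v1 z)" for z
      using v1[of z] g(1) by (cases "z \<in> \<Omega>") (auto simp: uv(1,2) Hol_def)
    ultimately have "is_decomp \<Omega> g p f r u1 v1"
      using uv(3,4) v1 unfolding is_decomp_def f by auto
    from decomp_eqI[OF False this] show ?thesis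
      using ru(1) uv(1) by (simp add: r_of_def v_of_def)
  qed
  then show "deg_lt (m - degree v) (r_of \<Omega> g S f)" "v_of \<Omega> g S f dvd v" by auto
qed

lemma n_of_S: "n_of \<Omega> g S = pred_deg (m - degree v)"
  unfolding n_of_def
proof (rule antisym)
  show "(SUP f\<in>S. pdeg (r_of \<Omega> g S f)) \<le> pred_deg (m - degree v)"
    using decomp_S(1) by (intro SUP_least) (simp add: pdeg_le_pred_deg)
  show "pred_deg (m - degree v) \<le> (SUP f\<in>S. pdeg (r_of \<Omega> g S f))"
  proof (cases "m - degree v = 0")
    case True
    then show ?thesis by (simp add: pred_deg_def)
  next
    case False
    define k where "k = m - degree v - 1"
    define r where "r = monom (1::complex) k"
    define f where "f = (\<lambda>z. \<gamma>p z * poly r z + g z * (poly 0 z / poly 1 z))"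
    have r: "deg_lt (m - degree v) r" using False by (auto simp: deg_lt_def r_def k_def)
    have "f = (\<lambda>z. \<gamma>p z * poly r z + g z * (poly 0 z / poly v z))" by (simp add: f_def)
    moreover have "deg_lt (degree v) 0" by (simp add: deg_lt_def)
    ultimately have "f \<in> S" unfolding S_eq using r by blast
    have "f \<noteq> 0"
    proof
      assume "f = 0"
      have "r = 0"
      proof (rule numerator_unique[OF dom(1,3) Hol_holomorphic[OF pD(1)]])
        show "\<gamma>p 0 \<noteq> 0" using pD(5)[OF dom(3)] g(2) by auto
        show "\<gamma>p z * poly r z = \<gamma>p z * poly 0 z" for z
          using fun_cong[OF \<open>f = 0\<close>, of z] by (simp add: f_def)
      qed
      then show False by (simp add: r_def monom_eq_0_iff)
    qed
    moreover have "is_decomp \<Omega> g p f r 0 1" by (simp add: is_decomp_def f_def pdeg_def)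
    ultimately have "r_of \<Omega> g S f = r" using decomp_eqI by (simp add: r_of_def)
    moreover have "pdeg r = pred_deg (m - degree v)"
      using False by (simp add: pdeg_def r_def pred_deg_def monom_eq_0_iff degree_monom_eq k_def)
    ultimately show ?thesis using \<open>f \<in> S\<close> by (metis SUP_upper)
  qed
qed

text \<open>A single function, a constant multiple of g / v, attains the pole orders at all roots of
  v simultaneously, since its fraction is already reduced.\<close>

lemma v_attained:
  assumes "degree v > 0"
  obtains f where "f \<in> S - {0}" "v_of \<Omega> g S f = smult (1 / lead_coeff v) v"
proof -
  define c where "c = lead_coeff v"
  have c: "c \<noteq> 0" using v(1) by (simp add: c_def)
  define v1 where "v1 = smult (1 / c) v"
  define f where "f = (\<lambda>z. \<gamma>p z * poly 0 z + g z * (poly 1 z / poly v1 z))"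
  have "f = (\<lambda>z. \<gamma>p z * poly 0 z + g z * (poly [:c:] z / poly v z))"
    using c by (simp add: f_def v1_def fun_eq_iff)
  moreover have "deg_lt (degree v) [:c:]" "deg_lt (m - degree v) 0"
    using assms by (auto simp: deg_lt_iff)
  ultimately have "f \<in> S" unfolding S_eq by blast
  have "f 0 \<noteq> 0" using g(2) c v(2)[OF dom(3)] by (simp add: f_def v1_def)
  then have "f \<noteq> 0" by auto
  have "is_decomp \<Omega> g p f 0 1 v1"
    using c v assms unfolding is_decomp_def f_def
    by (auto simp: v1_def pdeg_def c_def)
  from decomp_eqI[OF \<open>f \<noteq> 0\<close> this] have "v_of \<Omega> g S f = v1" by (simp add: v_of_def)
  with \<open>f \<in> S\<close> \<open>f \<noteq> 0\<close> show ?thesis using that by (simp add: v1_def c_def)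
qed

lemma Upsilon_of_S: "Upsilon_of \<Omega> g S = root_variety v"
proof -
  have attained: "\<exists>f\<in>S - {0}. \<forall>\<nu>. order \<nu> (v_of \<Omega> g S f) = order \<nu> v \<and>
      (poly (v_of \<Omega> g S f) \<nu> = 0 \<longleftrightarrow> poly v \<nu> = 0)" if "poly v \<mu> = 0" for \<mu>
  proof -
    have "degree v > 0" using v(1) that by (metis degree_eq_zeroE neq0_conv pCons_0_0 poly_pCons mult_zero_right add_0_right poly_0)
    then obtain f where "f \<in> S - {0}" "v_of \<Omega> g S f = smult (1 / lead_coeff v) v" using v_attained by blast
    then show ?thesis using v(1) by (intro bexI[of _ f]) (auto simp: order_smult)
  qed
  have P: "P_of \<Omega> g S = {\<mu>. poly v \<mu> = 0}"
  proof (intro equalityI subsetI)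
    fix \<mu> assume "\<mu> \<in> P_of \<Omega> g S"
    then obtain f where "f \<in> S" "poly (v_of \<Omega> g S f) \<mu> = 0" by (auto simp: P_of_def)
    then have "poly v \<mu> = 0" using decomp_S(2)[of f] by (metis dvd_def mult_zero_left poly_mult)
    then show "\<mu> \<in> {\<mu>. poly v \<mu> = 0}" by simp
  next
    fix \<mu> assume "\<mu> \<in> {\<mu>. poly v \<mu> = 0}"
    then show "\<mu> \<in> P_of \<Omega> g S" using attained[of \<mu>] v(2) unfolding P_of_def by blast
  qed
  have "n_mult_of \<Omega> g S \<mu> = enat (order \<mu> v)" if "poly v \<mu> = 0" for \<mu>
    unfolding n_mult_of_def
  proof (rule antisym)
    show "(SUP f\<in>S. enat (order \<mu> (v_of \<Omega> g S f))) \<le> enat (order \<mu> v)"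
      using dvd_imp_order_le[OF v(1) decomp_S(2)] by (intro SUP_least) simp
    from attained[OF that] obtain f where "f \<in> S" "order \<mu> (v_of \<Omega> g S f) = order \<mu> v" by blast
    then show "enat (order \<mu> v) \<le> (SUP f\<in>S. enat (order \<mu> (v_of \<Omega> g S f)))" by (metis SUP_upper)
  qed
  then show ?thesis unfolding Upsilon_of_def root_variety_def P by auto
qed

lemma S_formula: "S = quot_poly \<Omega> g (p_of \<Omega> g S) *o polys_upto (n_of \<Omega> g S) + g *o C_minus (Upsilon_of \<Omega> g S)"
  unfolding p_of_S n_of_S Upsilon_of_S by (rule fraction_sum_eq_model_space[OF dom(1) g(1) p v m(1), symmetric])

end

lemma rational_subspace_formula:
  assumes dom: "open \<Omega>" "connected \<Omega>" "0 \<in> \<Omega>" and g: "g \<in> Hol \<Omega>" "g 0 = 1"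
    and Q: "poly Q 0 = 1" "degree Q \<le> m" "m > 0" and S: "S = model_space \<Omega> g Q m" "\<gamma> \<in> S"
      "\<And>z. z \<in> \<Omega> \<Longrightarrow> \<gamma> z * poly Q z = g z"
  shows "S = quot_poly \<Omega> g (p_of \<Omega> g S) *o polys_upto (n_of \<Omega> g S) + g *o C_minus (Upsilon_of \<Omega> g S)"
proof -
  have Qnz: "Q \<noteq> 0" using Q by auto
  obtain p1 v1 where pv: "Q = p1 * v1" "\<And>z. poly p1 z = 0 \<Longrightarrow> z \<in> \<Omega>" "\<And>z. poly v1 z = 0 \<Longrightarrow> z \<notin> \<Omega>"
    using poly_split_roots[OF Qnz, of \<Omega>] by blast
  \<comment> \<open>The constant is moved from the factor with roots in \<Omega> to the other one,
    so that p(0) = 1. Then g / p = \<gamma> v is holomorphic and p belongs to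
    \<open>D_polys\<close>.\<close>
  define c where "c = poly p1 0"
  have "c \<noteq> 0" using Q(1) unfolding pv(1) c_def by auto
  define p where "p = smult (1 / c) p1"
  define v where "v = smult c v1"
  have Qpv: "Q = p * v" using \<open>c \<noteq> 0\<close> by (simp add: pv(1) p_def v_def)
  have nz: "p \<noteq> 0" "v \<noteq> 0" using Qnz Qpv by auto
  have v\<Omega>: "poly v z \<noteq> 0" if "z \<in> \<Omega>" for z using pv(3)[of z] that \<open>c \<noteq> 0\<close> by (auto simp: v_def)
  have \<gamma>: "\<gamma> \<in> Hol \<Omega>" using S(1,2) by (simp add: model_space_def)
  have "(\<lambda>z. \<gamma> z * poly v z) \<in> Hol \<Omega>" using \<gamma> by (intro Hol_times holomorphic_intros)
  moreover from this have "quot_poly \<Omega> g p = (\<lambda>z. \<gamma> z * poly v z)"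
    using S(3) by (intro quot_poly_eqI[OF dom(1) _ nz(1)]) (auto simp: Qpv mult_ac)
  ultimately have "p \<in> D_polys \<Omega> g"
    using pv(2) \<open>c \<noteq> 0\<close> by (auto simp: D_polys_def p_def c_def)
  then interpret rational_subspace \<Omega> g p v m
    using dom g nz v\<Omega> Q(2,3) by unfold_locales (auto simp: Qpv degree_mult_eq)
  show ?thesis using S_formula unfolding S(1) Qpv .
qed

section \<open>The two alternatives\<close>

lemma subset_g0_rational_model_space:
  assumes "open \<Omega>" "Q \<noteq> 0"
  shows "subset_g0_rational \<Omega> g (model_space \<Omega> g Q m)"
  unfolding subset_g0_rational_def
proof
  fix f assume "f \<in> model_space \<Omega> g Q m"
  then obtain E where f: "f \<in> Hol \<Omega>" and E: "\<And>z. z \<in> \<Omega> \<Longrightarrow> f z * poly Q z = g z * poly E z"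
    by (auto simp: model_space_def)
  have "regularize \<Omega> (\<lambda>z. g z * (poly E z / poly Q z)) = f"
  proof (rule regularize_eqI[OF assms(1) f poly_roots_finite[OF assms(2)]])
    show "g z * (poly E z / poly Q z) = f z" if "z \<in> \<Omega> - {z. poly Q z = 0}" for z
      using E[of z] that by (auto simp: field_simps)
  qed
  then show "\<exists>R\<in>rational_functions. f = regularize \<Omega> (\<lambda>z. g z * R z)"
    unfolding rational_functions_def using assms(2)
    by (intro bexI[of _ "\<lambda>z. poly E z / poly Q z"]) auto
qed

lemma closed_invariant_subspace_cases:
  assumes dom: "open \<Omega>" "connected \<Omega>" "simply_connected \<Omega>" "0 \<in> \<Omega>" "\<Omega> \<noteq> UNIV"
    and g: "g \<in> Hol \<Omega>" "g 0 = 1"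
    and inv: "closed_invariant_subspace \<Omega> g S" and nz: "S \<noteq> {0}"
  shows "S = S_of_variety \<Omega> (W_of_set \<Omega> S) \<or>
        (subset_g0_rational \<Omega> g S \<and>
         S = quot_poly \<Omega> g (p_of \<Omega> g S) *o polys_upto (n_of \<Omega> g S) + g *o C_minus (Upsilon_of \<Omega> g S))"
proof -
  obtain \<phi> \<psi> where "\<phi> holomorphic_on \<Omega>" "\<psi> holomorphic_on ball 0 1"
    "\<forall>z\<in>\<Omega>. \<phi> z \<in> ball 0 1 \<and> \<psi> (\<phi> z) = z" "\<forall>w\<in>ball 0 1. \<psi> w \<in> \<Omega> \<and> \<phi> (\<psi> w) = w"
    using Riemann_mapping_theorem[of \<Omega>] dom by auto
  then interpret disc_chart \<Omega> \<phi> \<psi>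
    using dom by unfold_locales auto
  obtain s where s: "s \<in> S" "s \<noteq> 0" using nz cfun.subspace_0[OF inv_subspace[OF inv]] by blast
  show ?thesis
  proof (cases "\<forall>q\<in>Hol \<Omega>. (\<lambda>z. g z * q z) \<in> S")
    case True
    have "S_of_variety \<Omega> (W_of_set \<Omega> S) = {f \<in> Hol \<Omega>. \<forall>\<mu>\<in>\<Omega>. zmult_set S \<mu> \<le> zmult f \<mu>}"
      using inv_subset_Hol[OF inv] s by (intro S_of_variety_W_of_set dom) auto
    also have "\<dots> = S"
    proof (intro equalityI subsetI)
      fix f assume "f \<in> {f \<in> Hol \<Omega>. \<forall>\<mu>\<in>\<Omega>. zmult_set S \<mu> \<le> zmult f \<mu>}"
      then have f: "f \<in> Hol \<Omega>" "\<And>\<mu>. \<mu> \<in> \<Omega> \<Longrightarrow> zmult_set S \<mu> \<le> zmult f \<mu>" by auto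
      show "f \<in> S" by (rule mem_of_zmult_ge[OF dom(4) g inv bspec[OF True] f])
    next
      fix f assume "f \<in> S"
      then show "f \<in> {f \<in> Hol \<Omega>. \<forall>\<mu>\<in>\<Omega>. zmult_set S \<mu> \<le> zmult f \<mu>}"
        using inv_subset_Hol[OF inv] by (auto simp: zmult_set_def intro: INF_lower)
    qed
    finally show ?thesis by simp
  next
    case False
    then obtain q where "q \<in> Hol \<Omega>" "(\<lambda>z. g z * q z) \<notin> S" by blast
    from rational_of_not_ideal[OF dom(4) g inv this]
    obtain Q0 M where "Q0 \<noteq> 0" "\<And>f. f \<in> S \<Longrightarrow> \<exists>E. degree E \<le> M \<and> (\<forall>z\<in>\<Omega>. f z * poly Q0 z = g z * poly E z)"
      by blast
    from rational_invariant_subspace[OF dom(1,2,4) g inv nz this]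
    obtain Q m \<gamma> where Q: "poly Q 0 = 1" "degree Q \<le> m" "m > 0" "S = model_space \<Omega> g Q m"
      "\<gamma> \<in> S" "\<And>z. z \<in> \<Omega> \<Longrightarrow> \<gamma> z * poly Q z = g z" by blast
    have "Q \<noteq> 0" using Q(1) by auto
    then show ?thesis
      using rational_subspace_formula[OF dom(1,2,4) g Q] subset_g0_rational_model_space[OF dom(1)] Q(4)
      by simp
  qed
qed

theorem mainTheorem2:
  fixes \<Omega> :: "complex set" and g\<^sub>0 :: "complex \<Rightarrow> complex"
  assumes "open \<Omega>" and "connected \<Omega>" and "simply_connected \<Omega>" and "0 \<in> \<Omega>" and "\<Omega> \<noteq> UNIV"
    and "g\<^sub>0 \<in> Hol \<Omega>" and "g\<^sub>0 0 = 1" and "zeros \<Omega> g\<^sub>0 \<noteq> {}"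
  shows
    "(\<forall>W. multiple_variety \<Omega> W \<and> W \<noteq> {} \<and> W \<prec>\<^sub>v W_of_fun \<Omega> g\<^sub>0 \<longrightarrow>
        closed_invariant_subspace \<Omega> g\<^sub>0 (S_of_variety \<Omega> W) \<and>
        proper_in_Hol \<Omega> (S_of_variety \<Omega> W)) \<and>
     (\<forall>p (n::ereal) \<Upsilon>.
        p \<in> D_polys \<Omega> g\<^sub>0 \<and>
        (n = -\<infinity> \<or> (\<exists>k::nat. n = ereal (real k) \<and> int k \<ge> int (degree p) - 1)) \<and>
        finite \<Upsilon> \<and> multiple_variety (- \<Omega>) \<Upsilon> \<longrightarrow>
        (let S = quot_poly \<Omega> g\<^sub>0 p *o polys_upto n + g\<^sub>0 *o C_minus \<Upsilon> in
           closed_invariant_subspace \<Omega> g\<^sub>0 S \<and>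
           (proper_in_Hol \<Omega> S \<longleftrightarrow> n \<noteq> -\<infinity> \<or> \<Upsilon> \<noteq> {}))) \<and>
     (\<forall>S. closed_invariant_subspace \<Omega> g\<^sub>0 S \<and> proper_in_Hol \<Omega> S \<longrightarrow>
        S = S_of_variety \<Omega> (W_of_set \<Omega> S) \<or>
        (subset_g0_rational \<Omega> g\<^sub>0 S \<and>
         S = quot_poly \<Omega> g\<^sub>0 (p_of \<Omega> g\<^sub>0 S) *o polys_upto (n_of \<Omega> g\<^sub>0 S)
             + g\<^sub>0 *o C_minus (Upsilon_of \<Omega> g\<^sub>0 S)))"
proof -
  note dom = assms(1,2,4) and g = assms(6,7)
  have i: "closed_invariant_subspace \<Omega> g\<^sub>0 (S_of_variety \<Omega> W) \<and> proper_in_Hol \<Omega> (S_of_variety \<Omega> W)"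
    if "multiple_variety \<Omega> W \<and> W \<noteq> {} \<and> W \<prec>\<^sub>v W_of_fun \<Omega> g\<^sub>0" for W
    using S_of_variety_invariant[OF dom g] that by blast
  have ii: "let S = quot_poly \<Omega> g\<^sub>0 p *o polys_upto n + g\<^sub>0 *o C_minus \<Upsilon> in
      closed_invariant_subspace \<Omega> g\<^sub>0 S \<and> (proper_in_Hol \<Omega> S \<longleftrightarrow> n \<noteq> -\<infinity> \<or> \<Upsilon> \<noteq> {})"
    if "p \<in> D_polys \<Omega> g\<^sub>0 \<and>
        (n = -\<infinity> \<or> (\<exists>k::nat. n = ereal (real k) \<and> int k \<ge> int (degree p) - 1)) \<and>
        finite \<Upsilon> \<and> multiple_variety (- \<Omega>) \<Upsilon>" for p n \<Upsilon>
    unfolding Let_def using fraction_sum_of_variety_invariant[OF dom g, of p n \<Upsilon>] that by blast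
  have iii: "S = S_of_variety \<Omega> (W_of_set \<Omega> S) \<or>
      (subset_g0_rational \<Omega> g\<^sub>0 S \<and>
       S = quot_poly \<Omega> g\<^sub>0 (p_of \<Omega> g\<^sub>0 S) *o polys_upto (n_of \<Omega> g\<^sub>0 S)
           + g\<^sub>0 *o C_minus (Upsilon_of \<Omega> g\<^sub>0 S))"
    if "closed_invariant_subspace \<Omega> g\<^sub>0 S \<and> proper_in_Hol \<Omega> S" for S
    using that by (intro closed_invariant_subspace_cases[OF assms(1-5) g]) (auto simp: proper_in_Hol_def)
  show ?thesis
    by (rule conjI[OF _ conjI]; intro allI impI) (rule i, assumption, rule ii, assumption, rule iii, assumption)
qed

end
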